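(* Let $p$ be a prime with $p\equiv -3\pmod 8$, let $s\ge 1$, $q=p^s$, and let $m\ge 2$ be an integer with $2^{m+1}\mid(q-1)$. Let $n\ge 1$ and let $N$ be the number of $(x_1,\dots,x_n)\in\mathbb F_q^n$ with $x_1^{2^m}+\dots+x_n^{2^m}=0$. For $r=1,2,\dots,m$ let $C_r,D_r$ be integers with $$p^{s/2^{r-1}}=C_r^2+D_r^2,\qquad C_r\equiv -1\pmod 4,\qquad p\nmid C_r.$$ Then \begin{align*} N=\,&q^{n-1}+\frac{q-1}{2^mq}\cdot\Bigl[2^{m-2}\cdot\Bigl((q^{\frac12}+2D_2q^{\frac14})^n+(q^{\frac12}-2D_2q^{\frac14})^n\Bigr)\\ &+\sum_{t=1}^{m-2}2^{m-t-2}\Bigl((-q^{\frac12}+\sum_{r=2}^t 2^{r-1}C_rq^{\frac{2^{r-1}-1}{2^{r}}}-2^t C_{t+1}q^{\frac{2^{t}-1}{2^{t+1}}}+2^{t+1} D_{t+2}q^{\frac{2^{t+1}-1}{2^{t+2}}})^n\\ &\qquad+(-q^{\frac12}+\sum_{r=2}^t 2^{r-1}C_rq^{\frac{2^{r-1}-1}{2^{r}}}-2^t C_{t+1}q^{\frac{2^{t}-1}{2^{t+1}}}-2^{t+1} D_{t+2}q^{\frac{2^{t+1}-1}{2^{t+2}}})^n\Bigr)\\ &+\Bigl(-q^{\frac 12}+\sum_{r=2}^{m-1}2^{r-1}C_r q^{\frac{2^{r-1}-1}{2^{r}}}-2^{m-1}C_m q^{\frac{2^{m-1}-1}{2^{m}}}\Bigr)^n\\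 &+\Bigl(-q^{\frac 12}+\sum_{r=2}^{m}2^{r-1}C_r q^{\frac{2^{r-1}-1}{2^{r}}}\Bigr)^n\Bigr]. \end{align*}
   Context: Powers $q^{a}$ with rational $a$ denote positive real powers. Empty sums are zero. Under the hypotheses, $2^{m-1}\mid s$, so $p^{s/2^{r-1}}$ is an integer for $r\le m$; the conditions determine $C_r$ uniquely and $D_r$ up to sign, and the formula holds for either choice of signs. *)

theory Defs
  imports Complex_Main "HOL-Computational_Algebra.Primes" "HOL-Library.Cardinality" "HOL-Number_Theory.Cong"
begin

definition diag_count :: "nat \<Rightarrow> nat \<Rightarrow> ('a::{field,finite}) itself \<Rightarrow> nat" where
  "diag_count n m _ = card {xs :: 'a list. length xs = n \<and> (\<Sum>x\<leftarrow>xs. x ^ (2 ^ m)) = 0}"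

end

theory Submission
  imports Defs "HOL-Number_Theory.Residues" "HOL-Computational_Algebra.Polynomial"
begin

text \<open>
  Orthogonality of an additive character \<open>\<psi>\<close> gives
  \<open>q N = q ^ n + (q - 1) / 2 ^ m * (\<Sum>j<2 ^ m. \<eta> j ^ n)\<close>, where
  \<open>\<eta> j = (\<Sum>x. \<psi> (g ^ j * x ^ 2 ^ m))\<close>, and \<open>\<eta> j\<close> is a combination of the Gauss sums of the characters
  of order \<open>2 ^ r\<close>, \<open>1 \<le> r \<le> m\<close>. Since \<open>p\<close> generates the residues congruent to \<open>1\<close> modulo \<open>4\<close>,
  Frobenius invariance leaves only one such Gauss sum \<open>G\<^sub>r\<close>, up to complex conjugation, for each \<open>r\<close>.
  Here \<open>G\<^sub>1 = - \<surd>q\<close> (Stickelberger), and the Davenport--Hasse relation for quadratic twists becomes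
  \<open>G\<^sub>r\<^sup>2 = G\<^sub>1 G\<^sub>r\<^sub>-\<^sub>1\<close> for \<open>r \<ge> 3\<close>. For \<open>r = 2\<close> one has \<open>G\<^sub>2\<^sup>2 = G\<^sub>1 J\<close> with a quartic Jacobi sum \<open>J\<close>, a
  Gaussian integer of norm \<open>q\<close> that is prime to \<open>p\<close>. Uniqueness of the representation of \<open>p ^ k\<close> as a sum
  of two squares then determines \<open>G\<^sub>r\<close> up to a fourth root of unity, a \<open>2\<close>-adic parity argument excludes
  the factor \<open>\<plusminus>\<i>\<close>, and the recursion fixes the sign for \<open>r < m\<close>. The remaining sign ambiguities (of \<open>G\<^sub>m\<close> and
  of the imaginary parts) only permute the values \<open>\<eta> j\<close>.
\<close>

section \<open>Arithmetic and combinatorial preliminaries\<close>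

text \<open>The main obstacle is that a square determines a Gauss sum only up to sign, and the
  recursion passes from \<open>r\<close> to \<open>r + 1\<close> through squares. If C is odd and D
  is even, the square of C + D i has real part 1 mod 4, whereas \<open>C r\<close> is -1 mod 4. So
  C_r + D_r i is, up to conjugation, minus the square of C_(r+1) + D_(r+1) i, and this minus cancels
  the one in G_1 = -sqrt q. The sign of G_r thus becomes the sign in front of the square that should
  be the square of G_(r+1), and parity forces it to be 1. The sign of each G_r is therefore read off
  from its successor, which is why the argument stops at \<open>m\<close>. The residue 5 mod 8
  serves two purposes: it makes \<open>p\<close> generate the classes 1 mod 4, and it leaves exactly
  two factors 2 in \<open>p - 1\<close>, the fact on which the parity argument turns. Divisibility
  of \<open>q - 1\<close> by \<open>2 ^ (m + 1)\<close> makes the characters even and forces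
  \<open>2 ^ (m - 1)\<close> to divide \<open>s\<close>, so that a Frobenius power of 2-power order
  is available. Galois conjugation on the p-th roots of unity appears only as scaling of the field
  variable by elements of the prime field.\<close>

lemma sum_two_squares_prime_power_unique:
  fixes A B C D :: int
  assumes "prime p" "odd p" and AB: "A\<^sup>2 + B\<^sup>2 = int p ^ k" and CD: "C\<^sup>2 + D\<^sup>2 = int p ^ k"
    and pA: "\<not> int p dvd A" and pC: "\<not> int p dvd C" and odd: "odd A" "odd C"
  shows "\<bar>A\<bar> = \<bar>C\<bar>" "\<bar>B\<bar> = \<bar>D\<bar>"
proof -
  define K where "K = int p ^ k"
  have K0: "K > 0" using \<open>prime p\<close> by (simp add: K_def prime_gt_0_nat)
  have pp: "prime (int p)" using \<open>prime p\<close> by simp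
  have oddK: "odd K" using \<open>odd p\<close> by (simp add: K_def)
  have "A\<^sup>2 = C\<^sup>2"
  proof (cases "k = 0")
    case True
    then have "A\<^sup>2 + B\<^sup>2 = 1" "C\<^sup>2 + D\<^sup>2 = 1" using AB CD by auto
    moreover have "A\<^sup>2 > 0" "C\<^sup>2 > 0" "B\<^sup>2 \<ge> 0" "D\<^sup>2 \<ge> 0" using odd by auto
    ultimately have "A\<^sup>2 = 1" "C\<^sup>2 = 1" by linarith+
    then show ?thesis by simp
  next
    case False
    then have pK: "int p dvd K" by (simp add: K_def)
    have pD: "\<not> int p dvd D"
    proof
      assume "int p dvd D"
      then have "int p dvd K - D\<^sup>2" using pK by (simp add: power2_eq_square)
      moreover have "K - D\<^sup>2 = C\<^sup>2" using CD K_def by linarith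
      ultimately have "int p dvd C\<^sup>2" by simp
      with pC pp show False using prime_dvd_power by blast
    qed
    \<comment> \<open>The factorization lets \<open>K\<close> divide a product; since
      \<open>p\<close> cannot divide both factors (else it would divide \<open>2 * A * D\<close>),
      the whole prime power divides one of them.\<close>
    have prod: "(A * D - B * C) * (A * D + B * C) = K * (A\<^sup>2 - C\<^sup>2)"
    proof -
      have "(A * D - B * C) * (A * D + B * C) = A\<^sup>2 * D\<^sup>2 - B\<^sup>2 * C\<^sup>2"
        by (simp add: algebra_simps power2_eq_square)
      also have "D\<^sup>2 = K - C\<^sup>2" using CD K_def by linarith
      also have "B\<^sup>2 = K - A\<^sup>2" using AB K_def by linarith
      finally show ?thesis by (simp add: algebra_simps)
    qed
    have p2: "\<not> int p dvd 2 * A * D"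
    proof
      assume "int p dvd 2 * A * D"
      then have "int p dvd 2" using pp pA pD by (simp add: prime_dvd_mult_iff)
      then have "p dvd 2" by presburger
      with \<open>prime p\<close> \<open>odd p\<close> show False
        by (metis dvd_refl primes_dvd_imp_eq two_is_prime_nat)
    qed
    \<comment> \<open>Stated for a variable \<open>B'\<close> so that it serves both
      \<open>B\<close> and \<open>-B\<close>. By the two-squares identity the quotient
      \<open>e\<close> satisfies e^2 <= 1. If \<open>e = 0\<close> the vectors are proportional;
      otherwise they are orthogonal, so K = A^2 + C^2 would be even.\<close>
    have key: "A\<^sup>2 = C\<^sup>2" if "K dvd A * D - B' * C" "A\<^sup>2 + B'\<^sup>2 = K" for B'
    proof -
      from that(1) obtain e where e: "A * D - B' * C = K * e" by blast
      have id: "(A * C + B' * D)\<^sup>2 + (A * D - B' * C)\<^sup>2 = K\<^sup>2"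
      proof -
        have "(A * C + B' * D)\<^sup>2 + (A * D - B' * C)\<^sup>2 = (A\<^sup>2 + B'\<^sup>2) * (C\<^sup>2 + D\<^sup>2)"
          by (simp add: algebra_simps power2_eq_square)
        then show ?thesis using that CD K_def by (simp add: power2_eq_square)
      qed
      show ?thesis
      proof (cases "e = 0")
        case True
        then have eq: "A * D = B' * C" using e by simp
        have "A\<^sup>2 * K = A\<^sup>2 * C\<^sup>2 + (A * D)\<^sup>2"
          using CD K_def by (simp add: algebra_simps power_mult_distrib flip: distrib_left)
        also have "\<dots> = (A\<^sup>2 + B'\<^sup>2) * C\<^sup>2" by (simp add: eq algebra_simps power_mult_distrib)
        finally show ?thesis using that K0 by simp
      next
        case False
        then have "e\<^sup>2 \<ge> 1" by (simp add: int_one_le_iff_zero_less)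
        then have "K\<^sup>2 * 1 \<le> K\<^sup>2 * e\<^sup>2" by (intro mult_left_mono) auto
        moreover have "(A * C + B' * D)\<^sup>2 + K\<^sup>2 * e\<^sup>2 = K\<^sup>2"
          using id e by (simp add: power_mult_distrib)
        ultimately have "(A * C + B' * D)\<^sup>2 \<le> 0" by linarith
        then have z: "A * C = - (B' * D)" by simp
        have "A\<^sup>2 * C\<^sup>2 = B'\<^sup>2 * D\<^sup>2" using arg_cong[OF z, of "\<lambda>x. x\<^sup>2"] by (simp add: power_mult_distrib)
        also have "B'\<^sup>2 = K - A\<^sup>2" using that by linarith
        also have "D\<^sup>2 = K - C\<^sup>2" using CD K_def by linarith
        finally have "K * (K - A\<^sup>2 - C\<^sup>2) = 0" by (simp add: algebra_simps)
        then have "K = A\<^sup>2 + C\<^sup>2" using K0 by simp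
        then have "even K" using odd by simp
        with oddK show ?thesis by simp
      qed
    qed
    have "coprime K (A * D - B * C) \<or> coprime K (A * D + B * C)"
    proof (rule ccontr)
      assume "\<not> ?thesis"
      then have "int p dvd A * D - B * C" "int p dvd A * D + B * C"
        unfolding K_def using prime_imp_coprime[OF pp] by (auto simp: coprime_power_left_iff)
      then have "int p dvd (A * D - B * C) + (A * D + B * C)" by (rule dvd_add)
      with p2 show False by (simp add: algebra_simps)
    qed
    moreover have "K dvd (A * D - B * C) * (A * D + B * C)" using prod by simp
    ultimately have "K dvd A * D - B * C \<or> K dvd A * D - (- B) * C"
      by (auto simp: coprime_dvd_mult_right_iff coprime_dvd_mult_left_iff)
    then show ?thesis using key[of B] key[of "-B"] AB K_def by auto
  qed
  moreover from this have "B\<^sup>2 = D\<^sup>2" using AB CD by linarith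
  ultimately show "\<bar>A\<bar> = \<bar>C\<bar>" "\<bar>B\<bar> = \<bar>D\<bar>" by (auto simp: power2_eq_iff)
qed

section \<open>Powers of p modulo powers of two\<close>

lemma power_mod_8_odd:
  fixes p s :: nat
  assumes "p mod 8 = 5" "odd s" shows "p ^ s mod 8 = 5"
proof -
  obtain k where k: "s = 2 * k + 1" using \<open>odd s\<close> by (auto elim: oddE)
  have "p ^ s mod 8 = (5 ^ s) mod 8" by (metis assms(1) power_mod)
  also have "(5::nat) ^ s = 25 ^ k * 5" by (simp add: k power_mult)
  also have "\<dots> mod 8 = ((25 mod 8) ^ k * 5) mod 8" by (metis mod_mult_left_eq power_mod)
  finally show ?thesis by simp
qed

lemma power_mod_4_eq_1:
  fixes p s :: nat
  assumes "p mod 4 = 1" shows "p ^ s mod 4 = 1"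
  using assms by (metis mod_mod_trivial power_mod power_one)

text \<open>Odd powers of \<open>p\<close> are 5 mod 8, so \<open>s\<close> is even as soon as 8
  divides p^s - 1. Halving \<open>s\<close> then removes exactly one factor 2, because p^l + 1 is 2
  mod 4.\<close>

lemma two_power_dvd_exponent:
  fixes p :: nat
  assumes "p mod 8 = 5" "2 ^ (k + 2) dvd p ^ s - 1"
  shows "2 ^ k dvd s"
  using assms(2)
proof (induction k arbitrary: s)
  case 0
  then show ?case by simp
next
  case (Suc k)
  have p4: "p mod 4 = 1" using assms(1) by presburger
  have "8 dvd p ^ s - 1"
    by (rule dvd_trans[OF _ Suc.prems]) (simp add: power_add)
  then have "even s" using power_mod_8_odd[OF assms(1), of s] by presburger
  then obtain l where l: "s = 2 * l" by blast
  have "p ^ s - 1 = (p ^ l + 1) * (p ^ l - 1)"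
    by (simp add: l mult_2 power_add diff_mult_distrib2)
  moreover have "(p ^ l + 1) mod 4 = 2" using power_mod_4_eq_1[OF p4, of l] by presburger
  then have "p ^ l + 1 = 2 * ((p ^ l + 1) div 2)" "odd ((p ^ l + 1) div 2)" by presburger+
  then obtain j where j: "p ^ l + 1 = 2 * j" "odd j" by blast
  ultimately have "p ^ s - 1 = 2 * (j * (p ^ l - 1))" by (simp only: mult.assoc)
  then have "2 * 2 ^ (k + 2) dvd 2 * (j * (p ^ l - 1))" using Suc.prems by (simp only: add_Suc power_Suc)
  then have "2 ^ (k + 2) dvd j * (p ^ l - 1)" by (subst (asm) nat_mult_dvd_cancel_disj) simp
  moreover have "coprime (2 ^ (k + 2)) j" using j(2) by (metis coprime_left_2_iff_odd coprime_power_left_iff)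
  ultimately have "2 ^ (k + 2) dvd p ^ l - 1" using coprime_dvd_mult_right_iff by blast
  then have "2 ^ k dvd l" by (rule Suc.IH)
  then show ?case by (simp add: l)
qed

lemma power_two_power_form:
  fixes p :: nat
  assumes "p mod 8 = 5"
  shows "\<exists>j. odd j \<and> p ^ (2 ^ k) = 1 + 2 ^ (k + 2) * j"
proof (induction k)
  case 0
  have "p = 1 + 4 * (2 * (p div 8) + 1)" using assms by presburger
  then show ?case by (intro exI[of _ "2 * (p div 8) + 1"]) simp
next
  case (Suc k)
  then obtain j where j: "odd j" "p ^ (2 ^ k) = 1 + 2 ^ (k + 2) * j" by blast
  have "p ^ (2 ^ Suc k) = (1 + 2 ^ (k + 2) * j)\<^sup>2" unfolding j(2)[symmetric] by (simp add: mult.commute flip: power_mult)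
  also have "\<dots> = 1 + 2 ^ (Suc k + 2) * (j + 2 ^ (k + 1) * j\<^sup>2)"
    by (simp add: power2_eq_square algebra_simps power_add)
  finally show ?case using j(1) by (intro exI[of _ "j + 2 ^ (k + 1) * j\<^sup>2"]) simp
qed

text \<open>Lifting one bit at a time: if p^k agrees with \<open>u\<close> modulo 2^(r+2) but not
  modulo the next power, the factor p^(2^r) = 1 + 2^(r+2) * odd flips precisely the wrong
  bit.\<close>

lemma power_generates_1_mod_4:
  fixes p u :: nat
  assumes "p mod 8 = 5" "u mod 4 = 1"
  shows "\<exists>k. [p ^ k = u] (mod 2 ^ (r + 2))"
proof (induction r)
  case 0
  show ?case using assms by (intro exI[of _ 0]) (simp add: cong_def)
next
  case (Suc r)
  then obtain k where k: "[p ^ k = u] (mod 2 ^ (r + 2))" by blast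
  show ?case
  proof (cases "[p ^ k = u] (mod 2 ^ (Suc r + 2))")
    case False
    obtain j where j: "odd j" "p ^ (2 ^ r) = 1 + 2 ^ (r + 2) * j"
      using power_two_power_form[OF assms(1)] by blast
    have oddp: "odd (p ^ k)" using assms(1) by (simp, presburger)
    have "int (2 ^ (r + 2)) dvd int (p ^ k) - int u"
      using k by (simp add: cong_int_iff[symmetric] cong_iff_dvd_diff)
    then obtain e where e: "int (p ^ k) - int u = int (2 ^ (r + 2)) * e" by blast
    have "odd e"
    proof
      assume "even e"
      then obtain e' where "e = 2 * e'" by blast
      then have "int (p ^ k) - int u = int (2 ^ (Suc r + 2)) * e'" using e by simp
      then have "int (2 ^ (Suc r + 2)) dvd int (p ^ k) - int u" by simp
      then have "[int (p ^ k) = int u] (mod int (2 ^ (Suc r + 2)))" by (simp add: cong_iff_dvd_diff)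
      then show False using False by (metis cong_int_iff)
    qed
    have "int (p ^ (k + 2 ^ r)) - int u = int (2 ^ (r + 2)) * (e + int (p ^ k * j))"
    proof -
      have "int (p ^ (k + 2 ^ r)) = int (p ^ k) + int (2 ^ (r + 2)) * int (p ^ k * j)"
        by (simp add: power_add[of p] j(2) algebra_simps)
      then show ?thesis using e by (simp add: algebra_simps)
    qed
    moreover have "even (e + int (p ^ k * j))" using \<open>odd e\<close> oddp j(1) by simp
    then obtain d where "e + int (p ^ k * j) = 2 * d" by blast
    ultimately have "int (2 ^ (Suc r + 2)) dvd int (p ^ (k + 2 ^ r)) - int u"
      by simp
    then have "[p ^ (k + 2 ^ r) = u] (mod 2 ^ (Suc r + 2))"
      by (metis cong_iff_dvd_diff cong_int_iff)
    then show ?thesis by blast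
  qed blast
qed

section \<open>Parity of sets with a fixed-point-free map of 2-power order\<close>

lemma even_card_involution:
  assumes "finite S" "\<And>x. x \<in> S \<Longrightarrow> f x \<in> S" "\<And>x. x \<in> S \<Longrightarrow> f (f x) = x"
    "\<And>x. x \<in> S \<Longrightarrow> f x \<noteq> x"
  shows "even (card S)"
  using assms
proof (induction S rule: finite_psubset_induct)
  case (psubset S)
  show ?case
  proof (cases "S = {}")
    case False
    then obtain x where x: "x \<in> S" by blast
    let ?T = "S - {x, f x}"
    have "even (card ?T)"
    proof (rule psubset.IH)
      show "?T \<subset> S" using x by blast
      fix y assume y: "y \<in> ?T"
      then show "f (f y) = y" "f y \<noteq> y" using psubset.prems by auto
      have "f y \<noteq> x" using y psubset.prems(2)[of y] by auto
      moreover have "f y \<noteq> f x" using y x psubset.prems(2) by (metis DiffD1 DiffD2 insertI1)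
      ultimately show "f y \<in> ?T" using y psubset.prems(1) by auto
    qed
    moreover have "card S = card ?T + 2"
    proof -
      have "card {x, f x} = 2" using psubset.prems(3)[OF x] by auto
      moreover have "{x, f x} \<subseteq> S" using x psubset.prems(1) by auto
      moreover have "card {x, f x} \<le> card S" using \<open>{x, f x} \<subseteq> S\<close> psubset.hyps by (intro card_mono) auto
      ultimately show ?thesis using card_Diff_subset[of "{x, f x}" S] by auto
    qed
    ultimately show ?thesis by simp
  qed simp
qed

text \<open>On the points of period 2 the map is an involution. On the remaining points its square
  has no fixed point and half the period, so the induction applies to it.\<close>

lemma even_card_two_power_period:
  assumes "finite S" "\<And>x. x \<in> S \<Longrightarrow> f x \<in> S" "\<And>x. x \<in> S \<Longrightarrow> (f ^^ (2 ^ k)) x = x"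
    "\<And>x. x \<in> S \<Longrightarrow> f x \<noteq> x"
  shows "even (card S)"
  using assms
proof (induction k arbitrary: f S)
  case 0
  then have "S = {}" by fastforce
  then show ?case by simp
next
  case (Suc k)
  define T where "T = {x \<in> S. f (f x) = x}"
  have "even (card T)"
    by (rule even_card_involution[of T f]) (use Suc.prems in \<open>auto simp: T_def\<close>)
  moreover have "even (card (S - T))"
  proof (rule Suc.IH[of "S - T" "f ^^ 2"])
    show "finite (S - T)" using Suc.prems by simp
    fix x assume x: "x \<in> S - T"
    have inj: "y = z" if "f y = f z" "y \<in> S" "z \<in> S" for y z
    proof -
      have "(2::nat) ^ Suc k \<noteq> 0" by simp
      then obtain l where "(2::nat) ^ Suc k = Suc l" using not0_implies_Suc by blast
      then have "(f ^^ l) (f y) = y" "(f ^^ l) (f z) = z"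
        using Suc.prems(3)[OF that(2)] Suc.prems(3)[OF that(3)]
        by (simp_all del: power_Suc funpow.simps add: funpow_Suc_right)
      with that show ?thesis by metis
    qed
    have fS: "f x \<in> S" "f (f x) \<in> S" "f (f (f x)) \<in> S" using x Suc.prems(2) by auto
    have "f (f x) \<notin> T"
    proof
      assume "f (f x) \<in> T"
      then have "f (f (f (f x))) = f (f x)" by (simp add: T_def)
      then have "f (f x) = x" using inj fS x Suc.prems(2) by (metis DiffD1)
      with x show False by (simp add: T_def)
    qed
    then show "(f ^^ 2) x \<in> S - T" using fS by (simp add: numeral_2_eq_2)
    show "((f ^^ 2) ^^ 2 ^ k) x = x" using Suc.prems(3)[of x] x by (simp add: funpow_mult mult.commute)
    show "(f ^^ 2) x \<noteq> x" using x by (simp add: numeral_2_eq_2 T_def)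
  qed
  moreover have "card S = card T + card (S - T)"
    using Suc.prems(1) card_Diff_subset[of T S] card_mono[of S T] by (auto simp: T_def)
  ultimately show ?case by simp
qed

section \<open>Valuations of factorials and a binomial coefficient prime to p\<close>

lemma multiplicity_fact_prime_step:
  fixes p n r :: nat
  assumes "prime p" "r < p"
  shows "multiplicity p (fact (p * n + r)) = n + multiplicity p (fact n)"
proof -
  have p0: "p > 0" using assms prime_gt_0_nat by blast
  have A: "multiplicity p (fact (k + r)) = multiplicity p (fact k)" if "p dvd k" "r < p" for k r
    using that(2)
  proof (induction r)
    case (Suc r)
    have "\<not> p dvd Suc (k + r)"
    proof
      assume "p dvd Suc (k + r)"
      then have "p dvd Suc r" using that(1) by (metis add_Suc_right dvd_add_right_iff)
      then show False using Suc.prems by (meson dvd_imp_le not_le zero_less_Suc)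
    qed
    then have "multiplicity p (Suc (k + r)) = 0" by (rule not_dvd_imp_multiplicity_0)
    moreover have "multiplicity p (fact (k + Suc r) :: nat) = multiplicity p (Suc (k + r)) + multiplicity p (fact (k + r) :: nat)"
      using assms(1) by (simp add: prime_elem_multiplicity_mult_distrib del: mult_Suc of_nat_Suc)
    ultimately show ?case using Suc by simp
  qed simp
  have "multiplicity p (fact (p * n) :: nat) = n + multiplicity p (fact n :: nat)"
  proof (induction n)
    case (Suc n)
    obtain r where r: "p = Suc r" using p0 gr0_implies_Suc by blast
    have "multiplicity p (fact (p * Suc n) :: nat) = multiplicity p (fact (Suc (p * n + r)) :: nat)"
      by (simp add: r add.commute add.left_commute del: fact_Suc)
    also have "\<dots> = multiplicity p (Suc (p * n + r)) + multiplicity p (fact (p * n + r) :: nat)"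
      using assms(1) by (simp add: prime_elem_multiplicity_mult_distrib del: mult_Suc of_nat_Suc)
    also have "Suc (p * n + r) = p * Suc n" by (simp add: r)
    also have "multiplicity p (p * Suc n) = 1 + multiplicity p (Suc n)"
      using assms(1) p0 by (subst prime_elem_multiplicity_mult_distrib) (auto simp del: of_nat_Suc)
    also have "multiplicity p (fact (p * n + r) :: nat) = multiplicity p (fact (p * n) :: nat)"
      by (rule A) (simp_all add: \<open>p = Suc r\<close> del: mult_Suc)
    also have "\<dots> = n + multiplicity p (fact n :: nat)" by (rule Suc.IH)
    also have "1 + multiplicity p (Suc n) + (n + multiplicity p (fact n :: nat)) = Suc n + multiplicity p (fact (Suc n) :: nat)"
      using assms(1) by (simp add: prime_elem_multiplicity_mult_distrib del: mult_Suc of_nat_Suc)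
    finally show ?case .
  qed simp
  then show ?thesis using A[of "p * n" r] assms(2) by simp
qed

text \<open>All \<open>s\<close> base-p digits of (p^s - 1) / 4 equal b = (p - 1) / 4. Since 3 b <
  p, adding this number to its double produces no carry; the induction on \<open>s\<close> strips
  one digit at a time with the Legendre step.\<close>

lemma not_dvd_binomial_quarter:
  fixes p :: nat
  assumes "prime p" "p mod 4 = 1"
  shows "\<not> p dvd (3 * ((p ^ s - 1) div 4)) choose ((p ^ s - 1) div 4)"
proof -
  define c where "c = (\<lambda>s. (p ^ s - 1) div 4)"
  define b where "b = (p - 1) div 4"
  have pb: "p = 4 * b + 1" using assms(2) by (simp add: b_def) presburger
  have c4: "p ^ s = 4 * c s + 1" for s
    using power_mod_4_eq_1[OF assms(2), of s] by (simp add: c_def) presburger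
  have cS: "c (Suc s) = p * c s + b" for s
  proof -
    have "4 * c (Suc s) + 1 = p * (4 * c s + 1)" using c4[of s] c4[of "Suc s"] by simp
    also have "\<dots> = 4 * (p * c s + b) + 1" using pb by (simp add: algebra_simps)
    finally show ?thesis by simp
  qed
  have v: "multiplicity p (fact (3 * c s) :: nat) = multiplicity p (fact (c s) :: nat) + multiplicity p (fact (2 * c s) :: nat)"
    for s
  proof (induction s)
    case (Suc s)
    have e: "3 * c (Suc s) = p * (3 * c s) + 3 * b" "2 * c (Suc s) = p * (2 * c s) + 2 * b"
      by (simp_all add: cS)
    have "3 * b < p" "2 * b < p" "b < p" using pb by auto
    then show ?case unfolding e unfolding cS[of s] using Suc.IH
      by (simp add: multiplicity_fact_prime_step[OF assms(1)])
  qed (simp add: c_def)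
  have "fact (c s) * fact (3 * c s - c s) * (3 * c s choose c s) = (fact (3 * c s) :: nat)"
    by (rule binomial_fact_lemma) simp
  then have "multiplicity p (fact (3 * c s) :: nat) = multiplicity p (fact (c s) * fact (2 * c s) * (3 * c s choose c s))"
    by simp
  also have "\<dots> = multiplicity p (fact (c s) :: nat) + multiplicity p (fact (2 * c s) :: nat) + multiplicity p (3 * c s choose c s)"
    using assms(1) by (simp add: prime_elem_multiplicity_mult_distrib)
  finally have "multiplicity p (3 * c s choose c s) = 0" using v[of s] by simp
  moreover have "3 * c s choose c s \<noteq> 0" by simp
  ultimately show ?thesis using assms(1)
    by (metis c_def multiplicity_eq_zero_iff not_prime_unit)
qed

text \<open>Provides integrality of traces from the p-th roots of unity: summing over all of them
  keeps only exponents divisible by \<open>p\<close>. The term \<open>c = 0\<close> is included and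
  has to be treated separately in applications.\<close>

lemma sum_int_poly_roots_of_unity:
  fixes P :: "int poly" and \<omega> :: complex
  assumes "\<omega> ^ p = 1" "\<And>k. \<omega> ^ k = 1 \<longleftrightarrow> p dvd k"
  shows "\<exists>T. (\<Sum>c<p. poly (map_poly of_int P) (\<omega> ^ c)) = of_int (int p * T)"
proof -
  have "(\<Sum>c<p. poly (map_poly of_int P) (\<omega> ^ c)) = (\<Sum>c<p. \<Sum>k\<le>degree P. of_int (coeff P k) * (\<omega> ^ c) ^ k)"
    by (simp add: poly_altdef degree_map_poly coeff_map_poly)
  also have "\<dots> = (\<Sum>k\<le>degree P. of_int (coeff P k) * (\<Sum>c<p. (\<omega> ^ k) ^ c))"
    by (subst sum.swap) (simp add: sum_distrib_left flip: power_mult, simp add: mult.commute)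
  also have "\<dots> = (\<Sum>k\<le>degree P. of_int (int p * (if p dvd k then coeff P k else 0)))"
  proof (rule sum.cong[OF refl])
    fix k
    show "of_int (coeff P k) * (\<Sum>c<p. (\<omega> ^ k) ^ c) = of_int (int p * (if p dvd k then coeff P k else 0))"
    proof (cases "p dvd k")
      case True
      then have "\<omega> ^ k = 1" using assms by blast
      then show ?thesis using True by simp
    next
      case False
      then have "\<omega> ^ k \<noteq> 1" using assms by blast
      moreover have "(\<omega> ^ k) ^ p = 1" using assms(1) by (metis power_mult mult.commute power_one)
      ultimately have "(\<Sum>c<p. (\<omega> ^ k) ^ c) = 0" by (simp add: geometric_sum)
      then show ?thesis using False by simp
    qed
  qed
  also have "\<dots> = of_int (int p * (\<Sum>k\<le>degree P. if p dvd k then coeff P k else 0))"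
    by (simp add: sum_distrib_left)
  finally show ?thesis by blast
qed

section \<open>The cyclic unit group and the trace of a finite field\<close>

lemma finite_field_power_card_minus_1:
  fixes x :: "'a::{field,finite}"
  assumes "x \<noteq> 0"
  shows "x ^ (CARD('a) - 1) = 1"
proof -
  let ?U = "UNIV - {0::'a}"
  have "(\<Prod>y\<in>?U. y) = (\<Prod>y\<in>?U. x * y)"
    by (rule prod.reindex_bij_witness[of _ "\<lambda>y. x * y" "\<lambda>y. y / x"]) (use assms in auto)
  also have "\<dots> = x ^ (CARD('a) - 1) * (\<Prod>y\<in>?U. y)" by (simp add: prod.distrib)
  finally show ?thesis by simp
qed

lemma finite_field_has_generator:
  "\<exists>g::'a::{field,finite}. bij_betw (\<lambda>k. g ^ k) {..<CARD('a) - 1} (UNIV - {0})"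
proof -
  \<comment> \<open>The type-class field is repackaged as a carrier-based structure to make the
    cyclicity theorem for its unit group applicable.\<close>
  define R where "R = \<lparr>carrier = (UNIV :: 'a set), monoid.mult = (*), one = (1 :: 'a), zero = (0 :: 'a), add = (+)\<rparr>"
  interpret R: ring R
    by unfold_locales (auto simp: R_def algebra_simps Units_def intro: exI[of _ "- _"] add.right_inverse add.left_inverse)
  interpret R: field R
  proof unfold_locales
    have "\<exists>y. y * x = 1" if "x \<noteq> 0" for x :: 'a using that by (intro exI[of _ "inverse x"]) simp
    then show "Units R = carrier R - {\<zero>\<^bsub>R\<^esub>}" by (auto simp: R_def Units_def mult.commute)
  qed (auto simp: R_def mult.commute)
  have pow: "x [^]\<^bsub>R\<^esub> (k::nat) = x ^ k" for x k
    by (induction k) (simp_all add: R_def mult.commute)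
  have cR: "carrier (mult_of R) = UNIV - {0}" by (simp add: R_def carrier_mult_of)
  from R.finite_field_mult_group_has_gen obtain g :: 'a where g: "g \<noteq> 0"
    and gen: "UNIV - {0} = {g ^ i | i::nat. True}"
    unfolding cR pow by (auto simp: R_def)
  define d where "d = CARD('a) - 1"
  have d0: "d > 0"
  proof -
    have "card {0, 1::'a} \<le> CARD('a)" by (intro card_mono) auto
    then show ?thesis by (simp add: d_def)
  qed
  have gd: "g ^ d = 1" using finite_field_power_card_minus_1[OF g] by (simp add: d_def)
  have "UNIV - {0} \<subseteq> (\<lambda>k. g ^ k) ` {..<d}"
  proof
    fix x :: 'a assume "x \<in> UNIV - {0}"
    then obtain i where i: "x = g ^ i" using gen by auto
    have "g ^ i = g ^ (d * (i div d) + i mod d)" by simp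
    also have "\<dots> = g ^ (i mod d)" by (simp only: power_add power_mult gd power_one mult_1)
    finally show "x \<in> (\<lambda>k. g ^ k) ` {..<d}" using d0 i by auto
  qed
  moreover have "(\<lambda>k. g ^ k) ` {..<d} \<subseteq> UNIV - {0}" using g by auto
  ultimately have im: "(\<lambda>k. g ^ k) ` {..<d} = UNIV - {0}" by blast
  have "card (UNIV - {0::'a}) = d" by (simp add: d_def)
  then have "inj_on (\<lambda>k. g ^ k) {..<d}" by (intro eq_card_imp_inj_on) (simp_all add: im)
  then show ?thesis using im unfolding bij_betw_def d_def by blast
qed

lemma sum_lessThan_mult_residues:
  fixes f :: "nat \<Rightarrow> 'b::comm_monoid_add"
  assumes "d > 0"
  shows "(\<Sum>k<d * U. f k) = (\<Sum>j<d. \<Sum>l<U. f (j + d * l))"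
proof -
  have "(\<Sum>j<d. \<Sum>l<U. f (j + d * l)) = (\<Sum>(j, l)\<in>{..<d} \<times> {..<U}. f (j + d * l))"
    by (simp add: sum.cartesian_product)
  also have "\<dots> = (\<Sum>k<d * U. f k)"
  proof (rule sum.reindex_bij_witness[of _ "\<lambda>k. (k mod d, k div d)" "\<lambda>(j, l). j + d * l"])
    fix a assume a: "a \<in> {..<d} \<times> {..<U}"
    then obtain j l where [simp]: "a = (j, l)" and "j < d" "l < U" by auto
    then show "(case a of (j, l) \<Rightarrow> j + d * l) \<in> {..<d * U}"
      using mult_le_mono2[of "Suc l" U d] by simp
  next
    fix k assume "k \<in> {..<d * U}"
    then show "(k mod d, k div d) \<in> {..<d} \<times> {..<U}"
      using assms by (auto simp: less_mult_imp_div_less mult.commute)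
  qed (use assms in auto)
  finally show ?thesis ..
qed

lemma sum_lessThan_periodic:
  fixes f :: "nat \<Rightarrow> 'b::comm_semiring_1"
  assumes "\<And>k. f (k + U) = f k"
  shows "(\<Sum>k<U * d. f k) = of_nat d * (\<Sum>k<U. f k)"
proof (cases "U = 0")
  case False
  have per: "f (k + U * l) = f k" for k l
    by (induction l) (use assms in \<open>simp_all add: add.assoc[symmetric] add.commute[of U]\<close>)
  show ?thesis using False by (simp add: sum_lessThan_mult_residues per sum_distrib_left)
qed simp

lemma map_poly_of_int_mult:
  "map_poly of_int (P * Q) = (map_poly of_int P * map_poly of_int Q :: complex poly)"
  by (rule poly_eqI) (simp add: coeff_map_poly coeff_mult)

text \<open>The trace sum is fixed by the p-th power map. The polynomial x^p - x has at most
  \<open>p\<close> roots, and the images of 0, ..., p - 1 already account for \<open>p\<close> of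
  them, so the trace is one of these.\<close>

lemma finite_field_trace_exists:
  assumes "prime p" and card: "CARD('a::{field,finite}) = p ^ s"
  shows "\<exists>tr. \<forall>x::'a. tr x < p \<and> of_nat (tr x) = (\<Sum>i<s. x ^ (p ^ i))"
proof -
  have pc: "prime CHAR('a)" by (rule prime_CHAR_semidom) (simp add: finite_imp_CHAR_pos)
  moreover have "CHAR('a) dvd p ^ s" using CHAR_dvd_CARD[where 'a = 'a] card by simp
  ultimately have char: "CHAR('a) = p" using assms(1) by (meson prime_dvd_power primes_dvd_imp_eq)
  have p1: "p > 1" using assms(1) prime_gt_1_nat by blast
  have card1: "CARD('a) > 1" using card_mono[of UNIV "{0, 1::'a}"] by simp
  have power_q: "x ^ (p ^ s) = x" for x :: 'a
  proof (cases "x = 0")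
    case False
    then show ?thesis
      using power_minus_mult[of "CARD('a)" x] finite_field_power_card_minus_1[OF False] p1 by (simp add: card)
  qed (use p1 in simp)
  define P :: "'a poly" where "P = Polynomial.monom 1 p - Polynomial.monom 1 1"
  have "Polynomial.coeff P p = 1" using p1 by (simp add: P_def)
  then have "P \<noteq> 0" by auto
  have "degree P \<le> p" unfolding P_def using p1
    by (intro degree_diff_le order.trans[OF degree_monom_le]) auto
  define K where "K = {x::'a. x ^ p = x}"
  have "K = {x. poly P x = 0}" by (simp add: K_def P_def poly_monom)
  then have "card K \<le> p" using card_poly_roots_bound[OF \<open>P \<noteq> 0\<close>] \<open>degree P \<le> p\<close> by simp
  define I where "I = (of_nat :: nat \<Rightarrow> 'a) ` {..<p}"
  have "I \<subseteq> K"
  proof -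
    have "(of_nat c :: 'a) ^ p = of_nat c" for c
    proof (induction c)
      case (Suc c)
      then show ?case using freshmans_dream[OF pc, of p 1 "of_nat c"] char by simp
    qed (use p1 in simp)
    then show ?thesis by (auto simp: I_def K_def)
  qed
  moreover have "card I = p"
  proof -
    have "inj_on (of_nat :: nat \<Rightarrow> 'a) {..<p}"
    proof (rule inj_onI)
      fix a b assume "a \<in> {..<p}" "b \<in> {..<p}" "(of_nat a :: 'a) = of_nat b"
      then show "a = b" using of_nat_eq_iff_cong_CHAR[of a b, where 'a = 'a] char
          cong_less_modulus_unique_nat[of a b p] by simp
    qed
    then show ?thesis by (simp add: I_def card_image)
  qed
  ultimately have "I = K" using \<open>card K \<le> p\<close> by (intro card_seteq) auto
  have "\<exists>t<p. (of_nat t :: 'a) = (\<Sum>i<s. x ^ (p ^ i))" for x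
  proof -
    have "(\<Sum>i<s. x ^ (p ^ i)) ^ p = (\<Sum>i<s. x ^ (p ^ Suc i))"
      using freshmans_dream_sum[OF pc char[symmetric], of "\<lambda>i. x ^ (p ^ i)" "{..<s}"]
      by (simp add: mult.commute flip: power_mult)
    also have "\<dots> = (\<Sum>i<Suc s. x ^ (p ^ i)) - x" by (subst sum.lessThan_Suc_shift) simp
    also have "\<dots> = (\<Sum>i<s. x ^ (p ^ i))" by (simp add: power_q)
    finally have "(\<Sum>i<s. x ^ (p ^ i)) \<in> I" unfolding \<open>I = K\<close> by (simp add: K_def)
    then show ?thesis unfolding I_def by (auto simp: image_iff)
  qed
  then show ?thesis by metis
qed

lemma sum_power_eq_sum_lists:
  fixes f :: "'a::finite \<Rightarrow> 'b::comm_semiring_1"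
  shows "(\<Sum>x\<in>UNIV. f x) ^ n = (\<Sum>xs | length xs = n. prod_list (map f xs))"
proof (induction n)
  case (Suc n)
  have "(\<Sum>x\<in>UNIV. f x) ^ Suc n = (\<Sum>x\<in>UNIV. \<Sum>xs | length xs = n. prod_list (map f (x # xs)))"
    by (simp add: Suc.IH sum_product)
  also have "\<dots> = (\<Sum>(x, xs)\<in>UNIV \<times> {xs. length xs = n}. prod_list (map f (x # xs)))"
    by (simp add: sum.cartesian_product)
  also have "\<dots> = (\<Sum>xs | length xs = Suc n. prod_list (map f xs))"
    by (rule sum.reindex_bij_witness[of _ "\<lambda>xs. (hd xs, tl xs)" "\<lambda>(x, xs). x # xs"])
      (auto simp: length_Suc_conv)
  finally show ?case .
qed simp

text \<open>Sorts the indices by 2-adic valuation and by the residue of the odd part mod 4, the only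
  data on which the periods will depend. The induction peels off the odd indices and halves the even
  ones; 0 and the midpoint remain.\<close>

lemma sum_lessThan_two_power_two_adic:
  fixes F :: "nat \<Rightarrow> 'b::comm_monoid_add"
  shows "(\<Sum>j<2 ^ (m + 2). F j) =
    (\<Sum>t = 0..m. \<Sum>k<2 ^ (m - t). F (2 ^ t * (4 * k + 1)) + F (2 ^ t * (4 * k + 3)))
      + F (2 ^ (m + 1)) + F 0"
proof (induction m arbitrary: F)
  case 0
  show ?case by (simp add: add_ac eval_nat_numeral)
next
  case (Suc m)
  have "(\<Sum>j<2 ^ (Suc m + 2). F j) = (\<Sum>j<4 * 2 ^ Suc m. F j)" by simp
  also have "\<dots> = (\<Sum>l<2 ^ Suc m. F (4 * l)) + (\<Sum>l<2 ^ Suc m. F (1 + 4 * l))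
      + (\<Sum>l<2 ^ Suc m. F (2 + 4 * l)) + (\<Sum>l<2 ^ Suc m. F (3 + 4 * l))"
  proof -
    have "{..<4::nat} = {0, 1, 2, 3}" by auto
    then show ?thesis by (subst sum_lessThan_mult_residues) (simp_all add: add_ac)
  qed
  also have "(\<Sum>l<2 ^ Suc m. F (4 * l)) + (\<Sum>l<2 ^ Suc m. F (1 + 4 * l))
      + (\<Sum>l<2 ^ Suc m. F (2 + 4 * l)) + (\<Sum>l<2 ^ Suc m. F (3 + 4 * l))
    = (\<Sum>k<2 ^ Suc m. F (4 * k + 1) + F (4 * k + 3))
      + ((\<Sum>l<2 ^ Suc m. F (4 * l)) + (\<Sum>l<2 ^ Suc m. F (2 + 4 * l)))"
    unfolding sum.distrib by (simp only: add_ac)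
  also have "(\<Sum>l<2 ^ Suc m. F (4 * l)) + (\<Sum>l<2 ^ Suc m. F (2 + 4 * l)) = (\<Sum>j<2 * 2 ^ Suc m. F (2 * j))"
  proof -
    have "{..<2::nat} = {0, 1}" by auto
    then show ?thesis by (subst sum_lessThan_mult_residues) (simp_all add: distrib_left mult.assoc[symmetric])
  qed
  also have "(\<Sum>j<2 * 2 ^ Suc m. F (2 * j)) = (\<Sum>j<2 ^ (m + 2). F (2 * j))" by simp
  also have "\<dots> = (\<Sum>t = 0..m. \<Sum>k<2 ^ (m - t). F (2 ^ Suc t * (4 * k + 1)) + F (2 ^ Suc t * (4 * k + 3)))
      + F (2 ^ (Suc m + 1)) + F 0"
    unfolding Suc.IH[of "\<lambda>j. F (2 * j)"] by (simp add: mult.assoc)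
  also have "(\<Sum>t = 0..m. \<Sum>k<2 ^ (m - t). F (2 ^ Suc t * (4 * k + 1)) + F (2 ^ Suc t * (4 * k + 3)))
    = (\<Sum>t = 1..Suc m. \<Sum>k<2 ^ (Suc m - t). F (2 ^ t * (4 * k + 1)) + F (2 ^ t * (4 * k + 3)))"
    using sum.shift_bounds_cl_Suc_ivl[of "\<lambda>t. \<Sum>k<2 ^ (Suc m - t). F (2 ^ t * (4 * k + 1)) + F (2 ^ t * (4 * k + 3))" 0 m]
    by simp
  finally show ?case
    by (subst sum.atLeast_Suc_atMost[of 0]) (simp_all add: add_ac)
qed

lemma two_power_minus_two:
  assumes "2 \<le> r"
  shows "(2::'b::comm_semiring_1) ^ r = 2 ^ (r - 2) * 4" "(2::'b) ^ (r - 1) = 2 * 2 ^ (r - 2)"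
proof -
  obtain k where "r = Suc (Suc k)" using assms by (metis add_2_eq_Suc le_Suc_ex)
  then show "(2::'b::comm_semiring_1) ^ r = 2 ^ (r - 2) * 4" "(2::'b) ^ (r - 1) = 2 * 2 ^ (r - 2)"
    by (simp_all add: mult_ac)
qed

lemma two_power_dvd_power_minus_1:
  fixes Q :: nat
  assumes "odd Q"
  shows "2 ^ k * (Q - 1) dvd Q ^ (2 ^ k) - 1"
proof (induction k)
  case (Suc k)
  have Q: "Q ^ (2 ^ Suc k) - 1 = (Q ^ (2 ^ k) + 1) * (Q ^ (2 ^ k) - 1)"
    by (simp add: mult_2 power_add diff_mult_distrib2)
  have "2 dvd Q ^ (2 ^ k) + 1" using assms by simp
  then have "2 * (2 ^ k * (Q - 1)) dvd (Q ^ (2 ^ k) + 1) * (Q ^ (2 ^ k) - 1)"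
    using Suc.IH by (rule mult_dvd_mono)
  then show ?case unfolding Q by (simp add: mult.assoc)
qed simp

lemma Complex_square:
  "(Complex (of_int c) (of_int (\<delta> * d)))\<^sup>2 = Complex (of_int (c\<^sup>2 - d\<^sup>2)) (of_int (\<delta> * (2 * c * d)))"
  if "\<delta> = 1 \<or> \<delta> = -1" for c d \<delta> :: int
  using that by (auto simp: complex_eq_iff power2_eq_square)

lemma abs_eq_sign: "\<bar>x\<bar> = \<bar>y\<bar> \<Longrightarrow> \<exists>\<epsilon>::int. (\<epsilon> = 1 \<or> \<epsilon> = -1) \<and> x = \<epsilon> * y" for x y :: int
  by (metis abs_eq_iff mult_1 mult_minus1)

section \<open>Characters of the finite field\<close>

text \<open>\<open>tr\<close> is the absolute trace, encoded by its representative below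
  \<open>p\<close>, so that it can serve as an exponent of a complex root of unity.\<close>

locale diagonal_field =
  fixes p s m :: nat and g :: "'a::{field,finite}" and tr :: "'a \<Rightarrow> nat"
  assumes prime_p: "prime p" and p_mod_8: "p mod 8 = 5"
    and card_field: "CARD('a) = p ^ s" and m_ge_2: "m \<ge> 2"
    and dvd_q1: "2 ^ (m + 1) dvd (p ^ s - 1)"
    and generator: "bij_betw (\<lambda>k. g ^ k) {..<p ^ s - 1} (UNIV - {0})"
    and tr_less: "\<And>x. tr x < p" and of_nat_tr: "\<And>x. of_nat (tr x) = (\<Sum>i<s. x ^ (p ^ i))"
begin

abbreviation q :: nat where "q \<equiv> p ^ s"

lemma char_eq: "CHAR('a) = p"
proof -
  have "prime CHAR('a)" by (rule prime_CHAR_semidom) (simp add: finite_imp_CHAR_pos)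
  moreover have "CHAR('a) dvd p ^ s" using CHAR_dvd_CARD[where 'a = 'a] card_field by simp
  ultimately show ?thesis using prime_p by (meson prime_dvd_power primes_dvd_imp_eq)
qed

lemma p_ge_5: "p \<ge> 5" using p_mod_8 by presburger

lemma p_odd: "odd p" using p_mod_8 by presburger

lemma p_mod_4: "p mod 4 = 1" using p_mod_8 by presburger

lemma s_dvd: "2 ^ (m - 1) dvd s"
proof -
  have "m + 1 = (m - 1) + 2" using m_ge_2 by simp
  with dvd_q1 show ?thesis using two_power_dvd_exponent[OF p_mod_8, of "m - 1" s] by simp
qed

lemma s_even: "even s"
proof -
  have "(2::nat) dvd 2 ^ (m - 1)" using m_ge_2 by (intro dvd_power) auto
  then show ?thesis using s_dvd dvd_trans by blast
qed

lemma q_gt_1: "q > 1"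
  using card_field card_mono[of UNIV "{0, 1::'a}"] by simp

lemma s_pos: "s > 0" using q_gt_1 by (cases s) auto

lemma dvd_q1': "2 ^ m dvd q - 1"
  using dvd_q1 by (metis dvd_trans le_imp_power_dvd le_add1)

lemma even_q1: "even (q - 1)"
  using dvd_q1 by (metis dvd_power dvd_trans zero_less_Suc Suc_eq_plus1)

lemma g_nonzero: "g \<noteq> 0"
proof
  assume "g = 0"
  have "4 dvd q - 1" using power_mod_4_eq_1[OF p_mod_4, of s] by presburger
  then have "q - 1 \<ge> 4" using q_gt_1 by (intro dvd_imp_le) auto
  then have "(1::nat) \<in> {..<q-1}" by auto
  then have "g ^ 1 \<in> UNIV - {0}" using generator unfolding bij_betw_def by blast
  with \<open>g = 0\<close> show False by simp
qed

lemma power_q1: "x \<noteq> 0 \<Longrightarrow> (x::'a) ^ (q - 1) = 1"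
  using finite_field_power_card_minus_1[of x] by (simp add: card_field)

lemma power_q: "(x::'a) ^ q = x"
proof (cases "x = 0")
  case False
  then show ?thesis using power_minus_mult[of q x] power_q1[OF False] order.strict_trans[OF zero_less_one q_gt_1] by (simp del: zero_less_power_eq zero_less_power)
qed (use p_ge_5 in simp)

lemma sum_nonzero: "(\<Sum>x\<in>UNIV - {0::'a}. f x) = (\<Sum>k<q - 1. f (g ^ k))"
  using sum.reindex_bij_betw[OF generator, of f] by simp

lemma sum_field:
  fixes f :: "'a \<Rightarrow> 'b::comm_monoid_add"
  shows "(\<Sum>x\<in>UNIV. f x) = f 0 + (\<Sum>k<q - 1. f (g ^ k))"
  by (subst sum.remove[of UNIV 0]) (simp_all add: sum_nonzero)

lemma generator_cong: "g ^ k = g ^ l \<longleftrightarrow> [k = l] (mod (q - 1))"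
proof -
  have red: "g ^ k = g ^ (k mod (q - 1))" for k
  proof -
    have "g ^ k = g ^ ((q - 1) * (k div (q - 1)) + k mod (q - 1))" by simp
    also have "\<dots> = g ^ (k mod (q - 1))"
      by (simp only: power_add power_mult power_q1[OF g_nonzero] power_one mult_1)
    finally show ?thesis .
  qed
  have "k mod (q - 1) < q - 1" for k using q_gt_1 by simp
  then have "g ^ (k mod (q - 1)) = g ^ (l mod (q - 1)) \<longleftrightarrow> k mod (q - 1) = l mod (q - 1)"
    using inj_on_eq_iff[OF bij_betw_imp_inj_on[OF generator]] by simp
  then show ?thesis using red[of k] red[of l] by (simp add: cong_def)
qed

definition lg :: "'a \<Rightarrow> nat" where
  "lg x = (SOME k. k < q - 1 \<and> g ^ k = x)"

lemma power_lg: "x \<noteq> 0 \<Longrightarrow> g ^ lg x = x"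
proof -
  assume "x \<noteq> 0"
  then have "x \<in> (\<lambda>k. g ^ k) ` {..<q - 1}" using generator unfolding bij_betw_def by blast
  then have "\<exists>k. k < q - 1 \<and> g ^ k = x" by auto
  then show ?thesis unfolding lg_def by (rule someI2_ex) auto
qed

lemma frob_add: "(x + y :: 'a) ^ (p ^ k) = x ^ (p ^ k) + y ^ (p ^ k)"
  by (rule freshmans_dream') (use char_eq prime_p in auto)

section \<open>The canonical additive character\<close>

definition \<omega> :: complex where "\<omega> = cis (2 * pi / p)"

lemma \<omega>_power: "\<omega> ^ k = 1 \<longleftrightarrow> p dvd k"
proof -
  have "\<omega> ^ k = cis (2 * pi * k / p)" by (simp add: \<omega>_def DeMoivre algebra_simps)
  moreover have "cis (2 * pi * k / p) = 1 \<longleftrightarrow> p dvd k"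
  proof
    assume "p dvd k"
    then obtain j where "k = p * j" by blast
    then have "2 * pi * k / p = 2 * pi * real j" using p_ge_5 by simp
    then show "cis (2 * pi * k / p) = 1" by (simp add: cis_multiple_2pi)
  next
    assume "cis (2 * pi * k / p) = 1"
    then have "cos (2 * pi * k / p) = 1" by (metis cis.simps(1) one_complex.simps(1))
    then obtain j :: int where "2 * pi * k / p = real_of_int j * 2 * pi" using cos_one_2pi_int by auto
    then have "real k = real_of_int j * real p" using p_ge_5 by (simp add: field_simps)
    then have "real_of_int (int k) = real_of_int (j * int p)" by simp
    then have "int k = j * int p" using of_int_eq_iff by blast
    then have "int p dvd int k" by simp
    then show "p dvd k" by simp
  qed
  ultimately show ?thesis by simp
qed

lemma \<omega>_p: "\<omega> ^ p = 1" by (simp add: \<omega>_power)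

lemma norm_\<omega>: "norm \<omega> = 1" by (simp add: \<omega>_def)

lemma \<omega>_cong: "[a = b] (mod p) \<Longrightarrow> \<omega> ^ a = \<omega> ^ b"
proof -
  assume "[a = b] (mod p)"
  moreover have "\<omega> ^ a = \<omega> ^ (a mod p)" for a
  proof -
    have "\<omega> ^ a = \<omega> ^ (p * (a div p) + a mod p)" by simp
    also have "\<dots> = \<omega> ^ (a mod p)" by (simp only: power_add power_mult \<omega>_p power_one mult_1)
    finally show ?thesis .
  qed
  ultimately show ?thesis by (metis cong_def)
qed

definition \<psi> :: "'a \<Rightarrow> complex" where "\<psi> x = \<omega> ^ tr x"

lemma of_nat_eq_iff_cong: "(of_nat a :: 'a) = of_nat b \<longleftrightarrow> [a = b] (mod p)"
  using of_nat_eq_iff_cong_CHAR[where 'a = 'a] char_eq by simp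

lemma \<psi>_add: "\<psi> (x + y) = \<psi> x * \<psi> y"
proof -
  have "(of_nat (tr (x + y)) :: 'a) = of_nat (tr x + tr y)"
    by (simp add: of_nat_tr frob_add sum.distrib)
  then show ?thesis unfolding \<psi>_def power_add[symmetric]
    by (intro \<omega>_cong) (simp only: of_nat_eq_iff_cong)
qed

lemma \<psi>_0 [simp]: "\<psi> 0 = 1"
proof -
  have "\<psi> 0 = \<psi> 0 * \<psi> 0" using \<psi>_add[of 0 0] by simp
  moreover have "\<psi> 0 \<noteq> 0" using norm_\<omega> by (auto simp: \<psi>_def)
  ultimately show ?thesis by simp
qed

lemma norm_\<psi> [simp]: "norm (\<psi> x) = 1" by (simp add: \<psi>_def norm_power norm_\<omega>)

lemma \<psi>_uminus: "\<psi> (- x) = cnj (\<psi> x)"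
proof -
  have "\<psi> x * \<psi> (- x) = 1" by (simp flip: \<psi>_add)
  moreover have "\<psi> x * cnj (\<psi> x) = 1" by (simp add: complex_norm_square[symmetric])
  moreover have "\<psi> x \<noteq> 0" using norm_\<psi>[of x] by force
  ultimately show ?thesis by (metis mult_left_cancel)
qed

lemma \<psi>_of_nat_mult: "\<psi> (of_nat c * x) = \<psi> x ^ c"
  by (induction c) (simp_all add: algebra_simps \<psi>_add)

lemma tr_frob: "tr (x ^ (p ^ k)) = tr x"
proof -
  have "[tr (x ^ (p ^ k)) = tr x] (mod p)"
  proof (induction k)
    case (Suc k)
    have "(of_nat (tr (y ^ p)) :: 'a) = of_nat (tr y)" for y
    proof -
      have "(of_nat (tr (y ^ p)) :: 'a) = (\<Sum>i<s. y ^ (p ^ Suc i))"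
        by (simp add: of_nat_tr power_mult)
      also have "\<dots> = (\<Sum>i<Suc s. y ^ (p ^ i)) - y"
        by (subst sum.lessThan_Suc_shift) simp
      also have "\<dots> = of_nat (tr y)" by (simp add: of_nat_tr power_q)
      finally show ?thesis .
    qed
    then have "[tr ((x ^ (p ^ k)) ^ p) = tr (x ^ (p ^ k))] (mod p)" by (simp only: of_nat_eq_iff_cong)
    moreover have "x ^ (p ^ Suc k) = (x ^ (p ^ k)) ^ p" by (simp add: mult.commute flip: power_mult)
    ultimately show ?case using Suc cong_trans by metis
  qed simp
  then show ?thesis using tr_less tr_less by (rule cong_less_modulus_unique_nat)
qed

lemma \<psi>_frob: "\<psi> (x ^ (p ^ k)) = \<psi> x"
  by (simp add: \<psi>_def tr_frob)

text \<open>If the character were trivial, the trace polynomial, which is nonzero of degree at most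
  p^(s-1), would vanish at all q = p^s field elements.\<close>

lemma \<psi>_nontrivial: "\<exists>x. \<psi> x \<noteq> 1"
proof (rule ccontr)
  assume "\<not> ?thesis"
  then have "p dvd tr x" for x using \<omega>_power by (auto simp: \<psi>_def)
  then have "tr x = 0" for x using tr_less[of x] by (meson dvd_imp_le not_le gr0I)
  then have tr0: "(\<Sum>i<s. x ^ (p ^ i)) = 0" for x :: 'a using of_nat_tr[of x] by simp
  define P :: "'a poly" where "P = (\<Sum>i<s. Polynomial.monom 1 (p ^ i))"
  have "poly P x = 0" for x by (simp add: P_def poly_sum poly_monom tr0)
  then have "{x. poly P x = 0} = UNIV" by auto
  moreover have "Polynomial.coeff P (p ^ (s - 1)) = 1"
  proof -
    have "Polynomial.coeff P (p ^ (s - 1)) = (\<Sum>i<s. if i = s - 1 then 1 else 0)"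
      unfolding P_def coeff_sum using p_ge_5
      by (intro sum.cong) (auto simp: power_inject_exp)
    then show ?thesis using s_pos by simp
  qed
  then have "P \<noteq> 0" by auto
  ultimately have "q \<le> degree P" using card_poly_roots_bound[of P] card_field by simp
  also have "degree P \<le> p ^ (s - 1)" unfolding P_def
  proof (rule degree_sum_le)
    fix i assume "i \<in> {..<s}"
    then have "p ^ i \<le> p ^ (s - 1)" using p_ge_5 by (intro power_increasing) auto
    then show "degree (Polynomial.monom (1::'a) (p ^ i)) \<le> p ^ (s - 1)"
      using degree_monom_le order.trans by blast
  qed simp
  finally have "p ^ s \<le> p ^ (s - 1)" .
  moreover have "p ^ (s - 1) < p ^ s" using s_pos p_ge_5 by (intro power_strict_increasing) auto
  ultimately show False by simp
qed

lemma sum_\<psi>: "(\<Sum>x\<in>UNIV. \<psi> x) = 0"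
proof -
  obtain y where y: "\<psi> y \<noteq> 1" using \<psi>_nontrivial by blast
  have "(\<Sum>x\<in>UNIV. \<psi> x) = (\<Sum>x\<in>UNIV. \<psi> (y + x))"
    by (rule sum.reindex_bij_witness[of _ "\<lambda>x. y + x" "\<lambda>x. x - y"]) auto
  also have "\<dots> = \<psi> y * (\<Sum>x\<in>UNIV. \<psi> x)" by (simp add: \<psi>_add sum_distrib_left)
  finally show ?thesis using y by simp
qed

lemma sum_\<psi>_mult: "(\<Sum>x\<in>UNIV. \<psi> (c * x)) = (if c = 0 then of_nat q else 0)"
proof (cases "c = 0")
  case False
  then have "(\<Sum>x\<in>UNIV. \<psi> (c * x)) = (\<Sum>x\<in>UNIV. \<psi> x)"
    by (intro sum.reindex_bij_witness[of _ "\<lambda>x. x / c" "\<lambda>x. c * x"]) auto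
  then show ?thesis using False sum_\<psi> by simp
qed (simp add: card_field)

section \<open>Gauss and Jacobi sums\<close>

definition \<zeta> :: complex where "\<zeta> = cis (2 * pi / 2 ^ m)"

lemma norm_\<zeta>: "norm \<zeta> = 1" by (simp add: \<zeta>_def)

lemma \<zeta>_power: "\<zeta> ^ k = 1 \<longleftrightarrow> 2 ^ m dvd k"
proof -
  have "\<zeta> ^ k = cis (2 * pi * k / 2 ^ m)" by (simp add: \<zeta>_def DeMoivre algebra_simps)
  moreover have "cis (2 * pi * k / 2 ^ m) = 1 \<longleftrightarrow> 2 ^ m dvd k"
  proof
    assume "2 ^ m dvd k"
    then obtain j where "k = 2 ^ m * j" by blast
    then have "2 * pi * k / 2 ^ m = 2 * pi * real j" by simp
    then show "cis (2 * pi * k / 2 ^ m) = 1" by (simp add: cis_multiple_2pi)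
  next
    assume "cis (2 * pi * k / 2 ^ m) = 1"
    then have "cos (2 * pi * k / 2 ^ m) = 1" by (metis cis.simps(1) one_complex.simps(1))
    then obtain j :: int where "2 * pi * k / 2 ^ m = real_of_int j * 2 * pi" using cos_one_2pi_int by auto
    then have "real_of_int (int k) = real_of_int (j * int (2 ^ m))" by (simp add: field_simps)
    then have "int k = j * int (2 ^ m)" using of_int_eq_iff by blast
    then have "int (2 ^ m) dvd int k" by simp
    then show "2 ^ m dvd k" by (simp only: int_dvd_int_iff)
  qed
  ultimately show ?thesis by simp
qed

lemma \<zeta>_cong: "[a = b] (mod 2 ^ m) \<Longrightarrow> \<zeta> ^ a = \<zeta> ^ b"
proof -
  assume "[a = b] (mod 2 ^ m)"
  moreover have "\<zeta> ^ a = \<zeta> ^ (a mod 2 ^ m)" for a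
  proof -
    have "\<zeta> ^ 2 ^ m = 1" by (simp add: \<zeta>_power)
    moreover have "\<zeta> ^ a = \<zeta> ^ (2 ^ m * (a div 2 ^ m) + a mod 2 ^ m)" by simp
    ultimately show ?thesis by (simp only: power_add power_mult power_one mult_1)
  qed
  ultimately show ?thesis by (metis cong_def)
qed

lemma \<zeta>_half: "\<zeta> ^ (2 ^ (m - 1)) = -1"
proof -
  have "2 ^ m = 2 * (2::real) ^ (m - 1)" using m_ge_2 by (simp flip: power_Suc)
  then have "2 * pi / 2 ^ m * 2 ^ (m - 1) = pi" by simp
  then show ?thesis by (simp add: \<zeta>_def DeMoivre mult.commute)
qed

lemma \<zeta>_quarter: "\<zeta> ^ (2 ^ (m - 2)) = \<i>"
proof -
  obtain k where k: "m = Suc (Suc k)" using m_ge_2 by (metis add_2_eq_Suc le_Suc_ex)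
  then have e: "real (2 ^ (m - 2)) * (2 * pi / 2 ^ m) = pi / 2" by simp
  show ?thesis unfolding \<zeta>_def DeMoivre e by simp
qed

text \<open>The i-th power of the character of order 2^m that sends \<open>g\<close> to
  \<open>\<zeta>\<close>. Even the trivial character vanishes at 0, which makes \<open>G 0\<close>
  equal to -1.\<close>

definition X :: "nat \<Rightarrow> 'a \<Rightarrow> complex" where
  "X i x = (if x = 0 then 0 else \<zeta> ^ (i * lg x))"

lemma X_0 [simp]: "X i 0 = 0" by (simp add: X_def)

lemma X_g: "X i (g ^ k) = \<zeta> ^ (i * k)"
proof -
  have "g ^ lg (g ^ k) = g ^ k" using g_nonzero by (intro power_lg) simp
  then have "[lg (g ^ k) = k] (mod (q - 1))" by (simp only: generator_cong)
  then have "[lg (g ^ k) = k] (mod 2 ^ m)" using dvd_q1' by (metis cong_dvd_modulus_nat)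
  then have "[i * lg (g ^ k) = i * k] (mod 2 ^ m)" by (rule cong_scalar_left)
  then show ?thesis using g_nonzero by (simp add: X_def \<zeta>_cong)
qed

lemma X_1 [simp]: "X i 1 = 1" using X_g[of i 0] by simp

lemma nonzero_power_g: "x \<noteq> 0 \<Longrightarrow> \<exists>k. x = g ^ k"
  using power_lg by metis

lemma X_mult: "X i (x * y) = X i x * X i y"
proof (cases "x = 0 \<or> y = 0")
  case False
  then obtain k l where "x = g ^ k" "y = g ^ l" using nonzero_power_g by metis
  then show ?thesis by (simp only: X_g power_add[symmetric] distrib_left)
qed auto

lemma X_power: "X i (x ^ n) = X i x ^ n"
  by (induction n) (simp_all add: X_mult)

lemma X_add: "X (i + j) x = X i x * X j x"
  by (simp add: X_def power_add distrib_right)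

lemma X_exp: "n > 0 \<Longrightarrow> X (i * n) x = X i x ^ n"
  by (simp add: X_def mult.assoc mult.commute[of n] flip: power_mult)

lemma X_cong: "[i = j] (mod 2 ^ m) \<Longrightarrow> X i x = X j x"
  by (simp add: X_def \<zeta>_cong cong_scalar_right)

lemma norm_X: "x \<noteq> 0 \<Longrightarrow> norm (X i x) = 1"
  by (simp add: X_def norm_power norm_\<zeta>)

lemma X_cnj:
  assumes "2 ^ m dvd i + j"
  shows "X j x = cnj (X i x)"
proof (cases "x = 0")
  case False
  have "X i x * X j x = 1"
    using assms False by (simp add: X_def distrib_right[symmetric] power_add[symmetric] \<zeta>_power)
  moreover have "X i x * cnj (X i x) = 1" using norm_X[OF False] by (simp add: complex_norm_square[symmetric])
  moreover have "X i x \<noteq> 0" using norm_X[OF False, of i] by force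
  ultimately show ?thesis by (metis mult_left_cancel)
qed simp

lemma g_half: "g ^ ((q - 1) div 2) = -1"
proof -
  let ?y = "g ^ ((q - 1) div 2)"
  have "?y ^ 2 = g ^ (q - 1)" using even_q1 by (simp flip: power_mult)
  then have "?y ^ 2 = 1" using power_q1[OF g_nonzero] by simp
  moreover have "?y \<noteq> 1"
  proof
    assume "?y = 1"
    then have "?y = g ^ 0" by simp
    then have "[(q - 1) div 2 = 0] (mod (q - 1))" by (simp only: generator_cong)
    then have "(q - 1) dvd (q - 1) div 2" by (simp add: cong_0_iff)
    moreover have "0 < (q - 1) div 2" using even_q1 q_gt_1 by presburger
    ultimately show False using q_gt_1 by (auto dest: dvd_imp_le)
  qed
  ultimately show ?thesis using power2_eq_1_iff by blast
qed

text \<open>Here -1 is g to the power (q - 1) / 2, and this exponent is a multiple of 2^m because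
  2^(m+1) divides q - 1. Evenness keeps signs out of the conjugation rule for Gauss sums.\<close>

lemma X_uminus_1: "X i (- 1) = 1"
proof -
  have "2 ^ m dvd (q - 1) div 2" using dvd_q1 by (auto elim!: dvdE)
  then show ?thesis by (simp only: g_half[symmetric] X_g) (simp add: \<zeta>_power)
qed

lemma X_uminus: "X i (- x) = X i x"
  using X_mult[of i "-1" x] X_uminus_1 by simp

lemma X_nontrivial: "\<not> 2 ^ m dvd i \<Longrightarrow> X i g \<noteq> 1"
  using X_g[of i 1] \<zeta>_power[of i] by simp

lemma sum_X:
  assumes "\<not> 2 ^ m dvd i"
  shows "(\<Sum>x\<in>UNIV. X i x) = 0"
proof -
  have "(\<Sum>x\<in>UNIV. X i x) = (\<Sum>x\<in>UNIV. X i (g * x))"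
    using g_nonzero by (intro sum.reindex_bij_witness[of _ "\<lambda>x. g * x" "\<lambda>x. x / g"]) auto
  also have "\<dots> = X i g * (\<Sum>x\<in>UNIV. X i x)" by (simp add: X_mult sum_distrib_left)
  finally show ?thesis using X_nontrivial[OF assms] by simp
qed

definition G :: "nat \<Rightarrow> complex" where "G i = (\<Sum>x\<in>UNIV. X i x * \<psi> x)"

definition J :: "nat \<Rightarrow> nat \<Rightarrow> complex" where "J i j = (\<Sum>x\<in>UNIV. X i x * X j (1 - x))"

lemma G_cong: "[i = j] (mod 2 ^ m) \<Longrightarrow> G i = G j"
  unfolding G_def using X_cong by simp

lemma G_cnj: "2 ^ m dvd i + j \<Longrightarrow> G j = cnj (G i)"
proof -
  assume a: "2 ^ m dvd i + j"
  have "cnj (G i) = (\<Sum>x\<in>UNIV. X j x * \<psi> (- x))"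
    by (simp add: G_def X_cnj[OF a] \<psi>_uminus)
  also have "\<dots> = (\<Sum>x\<in>UNIV. X j (- x) * \<psi> x)"
    by (rule sum.reindex_bij_witness[of _ uminus uminus]) auto
  finally show ?thesis by (simp add: X_uminus G_def)
qed

text \<open>Collect the product by t = x + y. For nonzero t, scaling x by t turns the inner
  convolution into a Jacobi sum times \<open>X (i + j) t\<close>; for t = 0 it is a complete sum of
  a nontrivial character.\<close>

lemma G_mult:
  assumes "\<not> 2 ^ m dvd i + j"
  shows "G i * G j = J i j * G (i + j)"
proof -
  have "G i * G j = (\<Sum>x\<in>UNIV. \<Sum>y\<in>UNIV. X i x * X j y * \<psi> (x + y))"
    by (simp add: G_def sum_product \<psi>_add mult_ac)
  also have "\<dots> = (\<Sum>x\<in>UNIV. \<Sum>t\<in>UNIV. X i x * X j (t - x) * \<psi> t)"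
  proof (rule sum.cong[OF refl])
    fix x
    show "(\<Sum>y\<in>UNIV. X i x * X j y * \<psi> (x + y)) = (\<Sum>t\<in>UNIV. X i x * X j (t - x) * \<psi> t)"
      by (rule sum.reindex_bij_witness[of _ "\<lambda>t. t - x" "\<lambda>y. x + y"]) auto
  qed
  also have "\<dots> = (\<Sum>t\<in>UNIV. (\<Sum>x\<in>UNIV. X i x * X j (t - x)) * \<psi> t)"
    by (subst sum.swap) (simp add: sum_distrib_right)
  also have "\<dots> = (\<Sum>t\<in>UNIV. J i j * X (i + j) t * \<psi> t)"
  proof (rule sum.cong[OF refl])
    fix t
    have "(\<Sum>x\<in>UNIV. X i x * X j (t - x)) = J i j * X (i + j) t"
    proof (cases "t = 0")
      case True
      have "(\<Sum>x\<in>UNIV. X i x * X j (t - x)) = (\<Sum>x\<in>UNIV. X (i + j) x)"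
        by (simp add: True X_uminus X_add)
      then show ?thesis using sum_X[OF assms] True by simp
    next
      case False
      have "(\<Sum>x\<in>UNIV. X i x * X j (t - x)) = (\<Sum>x\<in>UNIV. X i (t * x) * X j (t - t * x))"
        using False by (intro sum.reindex_bij_witness[of _ "\<lambda>x. t * x" "\<lambda>x. x / t"]) auto
      also have "\<dots> = (\<Sum>x\<in>UNIV. X i x * X j (1 - x) * X (i + j) t)"
      proof (rule sum.cong[OF refl])
        fix x
        have "t - t * x = t * (1 - x)" by (simp add: algebra_simps)
        then show "X i (t * x) * X j (t - t * x) = X i x * X j (1 - x) * X (i + j) t"
          by (simp only: X_mult X_add mult_ac)
      qed
      finally show ?thesis by (simp add: J_def sum_distrib_right)
    qed
    then show "(\<Sum>x\<in>UNIV. X i x * X j (t - x)) * \<psi> t = J i j * X (i + j) t * \<psi> t" by simp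
  qed
  finally show ?thesis by (simp add: G_def sum_distrib_left mult.assoc)
qed

text \<open>Substituting x = y z frees the multiplicative character from y; the sum over nonzero y
  is then q - 1 at z = 1 and -1 elsewhere.\<close>

lemma G_norm:
  assumes "\<not> 2 ^ m dvd i"
  shows "G i * cnj (G i) = of_nat q"
proof -
  have "G i * cnj (G i) = (\<Sum>y\<in>UNIV. cnj (X i y) * (\<Sum>x\<in>UNIV. X i x * \<psi> (x - y)))"
  proof -
    have "\<psi> (x - y) = \<psi> x * cnj (\<psi> y)" for x y using \<psi>_add[of x "-y"] by (simp add: \<psi>_uminus)
    then show ?thesis
      unfolding G_def by (simp add: sum_distrib_left sum_distrib_right mult_ac)
  qed
  also have "\<dots> = (\<Sum>y\<in>UNIV - {0}. cnj (X i y) * (\<Sum>x\<in>UNIV. X i x * \<psi> (x - y)))"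
    by (rule sum.mono_neutral_right) auto
  also have "\<dots> = (\<Sum>y\<in>UNIV - {0}. \<Sum>z\<in>UNIV. X i z * \<psi> ((z - 1) * y))"
  proof (rule sum.cong[OF refl])
    fix y :: 'a assume y: "y \<in> UNIV - {0}"
    have "(\<Sum>x\<in>UNIV. X i x * \<psi> (x - y)) = (\<Sum>z\<in>UNIV. X i (y * z) * \<psi> ((z - 1) * y))"
      using y by (intro sum.reindex_bij_witness[of _ "\<lambda>x. y * x" "\<lambda>x. x / y"]) (auto simp: algebra_simps)
    moreover have "cnj (X i y) * X i (y * z) = X i z" for z
      using norm_X[of y i] y by (simp add: X_mult mult.assoc[symmetric] mult.commute[of "cnj _"] complex_norm_square[symmetric])
    ultimately show "cnj (X i y) * (\<Sum>x\<in>UNIV. X i x * \<psi> (x - y)) = (\<Sum>z\<in>UNIV. X i z * \<psi> ((z - 1) * y))"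
      by (simp add: sum_distrib_left mult.assoc[symmetric])
  qed
  also have "\<dots> = (\<Sum>z\<in>UNIV. X i z * (\<Sum>y\<in>UNIV - {0}. \<psi> ((z - 1) * y)))"
    by (subst sum.swap) (simp add: sum_distrib_left)
  also have "\<dots> = (\<Sum>z\<in>UNIV. X i z * ((if z = 1 then of_nat q else 0) - 1))"
  proof (rule sum.cong[OF refl])
    fix z :: 'a
    have "(\<Sum>y\<in>UNIV - {0}. \<psi> ((z - 1) * y)) = (\<Sum>y\<in>UNIV. \<psi> ((z - 1) * y)) - 1"
      by (subst sum.remove[of UNIV 0]) auto
    then show "X i z * (\<Sum>y\<in>UNIV - {0}. \<psi> ((z - 1) * y)) = X i z * ((if z = 1 then of_nat q else 0) - 1)"
      using sum_\<psi>_mult[of "z - 1"] by simp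
  qed
  also have "\<dots> = (\<Sum>z\<in>(UNIV::'a set). (if z = 1 then of_nat q else 0)) - (\<Sum>z\<in>UNIV. X i z)"
    by (subst sum_subtractf[symmetric]) (rule sum.cong, auto simp: algebra_simps)
  finally show ?thesis using sum_X[OF assms] by simp
qed

lemma G_nonzero: "\<not> 2 ^ m dvd i \<Longrightarrow> G i \<noteq> 0"
  using G_norm[of i] p_ge_5 by auto

section \<open>Frobenius invariance and the quadratic character\<close>

lemma inj_frob: "inj (\<lambda>x::'a. x ^ (p ^ k))"
proof (rule injI)
  fix x y :: 'a assume "x ^ (p ^ k) = y ^ (p ^ k)"
  moreover have "x ^ (p ^ k) = (x - y) ^ (p ^ k) + y ^ (p ^ k)" using frob_add[of "x - y" y k] by simp
  ultimately have "(x - y) ^ (p ^ k) = 0" by simp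
  then show "x = y" by simp
qed

lemma G_frob: "G (i * p ^ k) = G i"
proof -
  have p0: "p ^ k > 0" using p_ge_5 by simp
  have "G i = (\<Sum>x\<in>UNIV. X i (x ^ (p ^ k)) * \<psi> (x ^ (p ^ k)))"
    unfolding G_def
    by (rule sum.reindex_bij_betw[symmetric]) (simp add: bij_def inj_frob finite_UNIV_inj_surj)
  also have "\<dots> = G (i * p ^ k)"
    unfolding G_def by (simp only: \<psi>_frob X_power X_exp[OF p0])
  finally show ?thesis ..
qed

text \<open>The multiplier is a power of \<open>p\<close> modulo 2^m, so it is absorbed by
  Frobenius. Among the characters of one exact order at least 4, only a Gauss sum and its conjugate
  survive.\<close>

lemma G_mult_1_mod_4:
  assumes "u mod 4 = 1"
  shows "G (i * u) = G i"
proof -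
  have "m = (m - 2) + 2" using m_ge_2 by simp
  then obtain k where "[p ^ k = u] (mod 2 ^ m)"
    using power_generates_1_mod_4[OF p_mod_8 assms, of "m - 2"] by metis
  then have "[i * p ^ k = i * u] (mod 2 ^ m)" by (rule cong_scalar_left)
  then show ?thesis using G_cong G_frob by metis
qed

text \<open>The order of the subfield over which the field has degree 2^(m-1); x -> x^Q0 generates a
  Galois group of 2-power order.\<close>

definition Q0 :: nat where "Q0 = p ^ (s div 2 ^ (m - 1))"

lemma q_eq_Q0: "q = Q0 ^ (2 ^ (m - 1))"
  using s_dvd by (simp add: Q0_def flip: power_mult)

text \<open>For x = g^l, being fixed means that q - 1 divides l (Q0 - 1). As 2^(m-1) (Q0 - 1)
  divides q - 1, the exponent l is a multiple of 2^(m-1), and \<open>X i x\<close> is a power of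
  -1.\<close>

lemma X_Q0_fixed:
  assumes "x \<noteq> 0" "x ^ Q0 = x"
  shows "X i x = 1 \<or> X i x = -1"
proof -
  obtain l where l: "x = g ^ l" using nonzero_power_g assms by blast
  have Q1: "Q0 > 1"
  proof (rule ccontr)
    assume "\<not> Q0 > 1"
    then have "Q0 = 0 \<or> Q0 = 1" by linarith
    then show False using q_eq_Q0 q_gt_1 by (auto simp: power_0_left split: if_splits)
  qed
  have "g ^ (l * Q0) = g ^ l" using assms l by (simp add: power_mult)
  then have "[l * Q0 = l] (mod (q - 1))" by (simp only: generator_cong)
  moreover have "l * Q0 = l + l * (Q0 - 1)" using Q1 by (simp add: algebra_simps)
  ultimately have "[l + l * (Q0 - 1) = l + 0] (mod (q - 1))" by simp
  then have "[l * (Q0 - 1) = 0] (mod (q - 1))" by (simp only: cong_add_lcancel_nat)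
  then have "q - 1 dvd l * (Q0 - 1)" by (simp add: cong_0_iff)
  moreover have "2 ^ (m - 1) * (Q0 - 1) dvd q - 1"
    unfolding q_eq_Q0 using p_odd by (intro two_power_dvd_power_minus_1) (simp add: Q0_def)
  ultimately have "2 ^ (m - 1) * (Q0 - 1) dvd l * (Q0 - 1)" using dvd_trans by blast
  then have "2 ^ (m - 1) dvd l" using Q1 by simp
  then obtain k where "l = 2 ^ (m - 1) * k" by blast
  then have "X i x = (\<zeta> ^ (2 ^ (m - 1))) ^ (k * i)" by (simp add: l X_g mult_ac flip: power_mult)
  also have "\<dots> = (-1) ^ (k * i)" by (simp only: \<zeta>_half)
  finally show ?thesis using neg_one_even_power neg_one_odd_power by metis
qed

lemma of_nat_frob: "(of_nat c :: 'a) ^ (p ^ k) = of_nat c"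
proof (induction c)
  case (Suc c)
  then show ?case using frob_add[of 1 "of_nat c" k] by simp
qed (use p_ge_5 in simp)

lemma X_of_nat: "(of_nat c :: 'a) \<noteq> 0 \<Longrightarrow> X i (of_nat c) = 1 \<or> X i (of_nat c) = -1"
  by (rule X_Q0_fixed) (auto simp: Q0_def of_nat_frob)

lemma two_nonzero: "(2 :: 'a) \<noteq> 0"
proof -
  have "\<not> [2 = 0] (mod p)" using p_ge_5 by (auto simp: cong_0_iff dest: dvd_imp_le)
  then show ?thesis using of_nat_eq_iff_cong[of 2 0] by simp
qed

lemma X_4: "X i 4 = 1"
proof -
  have "X i 4 = X i 2 * X i 2" using X_mult[of i 2 2] by simp
  then show ?thesis using X_of_nat[of 2 i] two_nonzero by auto
qed

lemma X_half_g: "X (2 ^ (m - 1)) (g ^ k) = (- 1) ^ k"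
  by (simp only: X_g power_mult \<zeta>_half)

text \<open>\<open>X (2 ^ (m - 1))\<close> is the quadratic character, so the weight on the right
  counts the square roots of u, including the single root at u = 0.\<close>

lemma sum_squares_field:
  fixes f :: "'a \<Rightarrow> complex"
  shows "(\<Sum>y\<in>UNIV. f (y ^ 2)) = (\<Sum>u\<in>UNIV. f u * (1 + X (2 ^ (m - 1)) u))"
proof -
  obtain U where U: "q - 1 = 2 * U" using even_q1 by blast
  have "(\<Sum>k<q - 1. f ((g ^ k) ^ 2)) = 2 * (\<Sum>k<U. f (g ^ (2 * k)))"
  proof -
    have per: "g ^ (2 * (k + U)) = g ^ (2 * k)" for k
      using power_q1[OF g_nonzero] by (simp only: U power_add distrib_left mult_1_right)
    have "(\<Sum>k<U * 2. f (g ^ (2 * k))) = of_nat 2 * (\<Sum>k<U. f (g ^ (2 * k)))"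
      by (rule sum_lessThan_periodic) (simp only: per)
    then show ?thesis unfolding U by (simp add: mult.commute flip: power_mult)
  qed
  moreover have "(\<Sum>k<q - 1. f (g ^ k) * (1 + X (2 ^ (m - 1)) (g ^ k))) = 2 * (\<Sum>k<U. f (g ^ (2 * k)))"
  proof -
    have "(\<Sum>k<2 * U. f (g ^ k) * (1 + X (2 ^ (m - 1)) (g ^ k)))
        = (\<Sum>j<2. \<Sum>l<U. f (g ^ (j + 2 * l)) * (1 + (-1) ^ (j + 2 * l)))"
      by (subst sum_lessThan_mult_residues) (simp_all only: X_half_g zero_less_numeral)
    also have "\<dots> = 2 * (\<Sum>k<U. f (g ^ (2 * k)))"
      by (simp add: lessThan_Suc[of 1, simplified] lessThan_nat_numeral sum_distrib_left mult.commute)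
    finally show ?thesis unfolding U .
  qed
  ultimately show ?thesis by (simp only: sum_field) simp
qed

lemma J_commute: "J i j = J j i"
  unfolding J_def by (rule sum.reindex_bij_witness[of _ "\<lambda>x. 1 - x" "\<lambda>x. 1 - x"]) auto

text \<open>Completing the square: 4 x (1 - x) = 1 - (2 x - 1)^2. The factor 4 is harmless because 2
  lies in the prime field, where characters take only the values 1 and -1; the square is then
  removed by counting roots.\<close>

lemma J_diag:
  assumes "\<not> 2 ^ m dvd i"
  shows "J i i = J i (2 ^ (m - 1))"
proof -
  have "J i i = (\<Sum>x\<in>UNIV. X i (1 - (2 * x - 1) ^ 2))"
    unfolding J_def
  proof (rule sum.cong[OF refl])
    fix x :: 'a
    have "1 - (2 * x - 1) ^ 2 = 4 * (x * (1 - x))" by (simp add: algebra_simps power2_eq_square)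
    then show "X i x * X i (1 - x) = X i (1 - (2 * x - 1) ^ 2)"
      by (simp add: X_mult X_4)
  qed
  also have "\<dots> = (\<Sum>y\<in>UNIV. X i (1 - y ^ 2))"
    using two_nonzero
    by (intro sum.reindex_bij_witness[of _ "\<lambda>y. (y + 1) / 2" "\<lambda>x. 2 * x - 1"])
      (auto simp: field_simps)
  also have "\<dots> = (\<Sum>u\<in>UNIV. X i (1 - u)) + (\<Sum>u\<in>UNIV. X i (1 - u) * X (2 ^ (m - 1)) u)"
    by (simp add: sum_squares_field[of "\<lambda>u. X i (1 - u)"] distrib_left sum.distrib)
  also have "(\<Sum>u\<in>UNIV. X i (1 - u)) = (\<Sum>u\<in>UNIV. X i u)"
    by (rule sum.reindex_bij_witness[of _ "\<lambda>x. 1 - x" "\<lambda>x. 1 - x"]) auto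
  finally have "J i i = J (2 ^ (m - 1)) i" using sum_X[OF assms] by (simp add: J_def mult.commute)
  then show ?thesis by (simp only: J_commute[of i "2 ^ (m - 1)"])
qed

text \<open>Davenport--Hasse for the quadratic twist; the twisted sum equals the original one because
  \<open>1 + 2 ^ (r - 1)\<close> is a power of \<open>p\<close> modulo \<open>2 ^ r\<close>.\<close>

lemma G_square_recursion:
  assumes "3 \<le> r" "r \<le> m"
  shows "G (2 ^ (m - r)) ^ 2 = G (2 ^ (m - 1)) * G (2 ^ (m - (r - 1)))"
proof -
  define i :: nat where "i = 2 ^ (m - r)"
  define h :: nat where "h = 2 ^ (m - 1)"
  have i2: "2 * i = 2 ^ (m - (r - 1))" using assms by (simp add: i_def Suc_diff_le flip: power_Suc)
  have n2: "\<not> 2 ^ m dvd 2 * i" unfolding i2 using assms by (intro nat_dvd_not_less) auto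
  then have ni: "\<not> 2 ^ m dvd i" using dvd_mult by blast
  have h: "h = i * 2 ^ (r - 1)" using assms by (simp add: i_def h_def flip: power_add)
  have ih: "i + h = i * (1 + 2 ^ (r - 1))" by (simp add: h)
  \<comment> \<open>This is where r >= 3 enters: for r = 2 the multiplier would be 3 mod 4 and would
    give the conjugate Gauss sum instead.\<close>
  have "(4::nat) dvd 2 ^ (r - 1)" using assms le_imp_power_dvd[of 2 "r - 1" "2::nat"] by simp
  then have "(1 + 2 ^ (r - 1)) mod 4 = (1::nat)" by presburger
  then have Gih: "G (i + h) = G i" unfolding ih by (rule G_mult_1_mod_4)
  have nih: "\<not> 2 ^ m dvd i + h"
  proof
    assume "2 ^ m dvd i + h"
    then have "2 ^ m dvd 2 * i + 2 * h" by (metis dvd_mult distrib_left)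
    moreover have "2 * h = 2 ^ m" using assms by (simp add: h_def flip: power_Suc)
    ultimately show False using n2 by simp
  qed
  have "G i * G i = J i i * G (2 * i)" using G_mult[of i i] n2 by (simp add: mult_2)
  also have "J i i = J i h" using J_diag[OF ni] by (simp add: h_def)
  \<comment> \<open>In \<open>G i * G h = J i h * G (i + h)\<close> the twisted sum
    \<open>G (i + h)\<close> equals \<open>G i\<close>, which is nonzero and cancels.\<close>
  also have "J i h = G h"
    using G_mult[OF nih] Gih G_nonzero[OF ni] by (simp add: mult.commute)
  finally show ?thesis by (simp add: i2 i_def[symmetric] h_def power2_eq_square)
qed

text \<open>Stickelberger's evaluation: the quadratic character is trivial on the subfield \<open>K\<close> of
  order \<open>\<surd>q\<close>, and \<open>\<psi>\<close> is trivial on exactly one \<open>K\<close>-line.\<close>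

lemma G_quadratic: "G (2 ^ (m - 1)) = - of_nat (p ^ (s div 2))"
proof -
  define Q where "Q = p ^ (s div 2)"
  have qQ: "q = Q * Q" using s_even by (simp add: Q_def flip: power_add mult_2)
  have Q4: "Q mod 4 = 1" unfolding Q_def by (rule power_mod_4_eq_1[OF p_mod_4])
  have Q1: "Q > 1" using qQ q_gt_1 by (cases "Q \<le> 1") (auto simp: le_Suc_eq)
  have q1: "q - 1 = (Q + 1) * (Q - 1)" by (simp add: qQ diff_mult_distrib2)
  define K :: "'a set" where "K = {c. c ^ Q = c}"
  have K_add: "x + y \<in> K" if "x \<in> K" "y \<in> K" for x y
    using that frob_add[of x y "s div 2"] by (simp add: K_def Q_def)
  have K_diff: "x - y \<in> K" if "x \<in> K" "y \<in> K" for x y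
    using that frob_add[of "x - y" y "s div 2"] by (simp add: K_def Q_def eq_diff_eq)
  \<comment> \<open>The unit group of the subfield \<open>K\<close> is generated by g^(Q+1), so
    exponents modulo Q + 1 index the lines of the field over \<open>K\<close>.\<close>
  have bij: "bij_betw (\<lambda>l. g ^ ((Q + 1) * l)) {..<Q - 1} (K - {0})"
  proof (rule bij_betw_imageI)
    show "inj_on (\<lambda>l. g ^ ((Q + 1) * l)) {..<Q - 1}"
    proof (rule inj_onI)
      fix k l assume kl: "k \<in> {..<Q - 1}" "l \<in> {..<Q - 1}" and "g ^ ((Q + 1) * k) = g ^ ((Q + 1) * l)"
      then have "[(Q + 1) * k = (Q + 1) * l] (mod (q - 1))" by (simp only: generator_cong)
      moreover have "(Q + 1) * k < q - 1" "(Q + 1) * l < q - 1" unfolding q1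
        using kl by (intro mult_strict_left_mono; simp)+
      ultimately have "(Q + 1) * k = (Q + 1) * l" by (rule cong_less_modulus_unique_nat)
      then show "k = l" by (simp only: mult_cancel1) simp
    qed
    show "(\<lambda>l. g ^ ((Q + 1) * l)) ` {..<Q - 1} = K - {0}"
    proof (intro equalityI subsetI)
      fix x assume "x \<in> (\<lambda>l. g ^ ((Q + 1) * l)) ` {..<Q - 1}"
      then obtain l where x: "x = g ^ ((Q + 1) * l)" by auto
      have "(Q + 1) * l * Q = (Q + 1) * l + l * ((Q + 1) * (Q - 1))"
      proof -
        obtain R where "Q = Suc R" using Q1 not0_implies_Suc by fastforce
        then show ?thesis by (simp add: algebra_simps)
      qed
      then have "[(Q + 1) * l * Q = (Q + 1) * l] (mod (q - 1))"
        unfolding q1 by (simp add: cong_def)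
      then have "x ^ Q = x" unfolding x power_mult[symmetric] by (simp only: generator_cong)
      then show "x \<in> K - {0}" using g_nonzero by (simp add: K_def x)
    next
      fix x assume x: "x \<in> K - {0}"
      then have "x \<in> (\<lambda>k. g ^ k) ` {..<q - 1}" using generator unfolding bij_betw_def by blast
      then obtain k where k: "k < q - 1" "x = g ^ k" by auto
      have "g ^ (k * Q) = g ^ k" using x k by (simp add: K_def power_mult)
      then have "[k * Q = k] (mod (q - 1))" by (simp only: generator_cong)
      moreover have "k * Q = k + k * (Q - 1)" using Q1 by (simp add: algebra_simps)
      ultimately have "[k + k * (Q - 1) = k + 0] (mod (q - 1))" by simp
      then have "[k * (Q - 1) = 0] (mod (q - 1))" by (simp only: cong_add_lcancel_nat)
      then have "(Q + 1) * (Q - 1) dvd k * (Q - 1)" by (simp only: cong_0_iff q1)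
      then have "Q + 1 dvd k" using Q1 by (metis nat_mult_dvd_cancel1 mult.commute zero_less_diff)
      then obtain l where l: "k = (Q + 1) * l" by blast
      then have "l < Q - 1" using k(1) unfolding q1 by (simp only: mult_less_cancel1)
      then show "x \<in> (\<lambda>l. g ^ ((Q + 1) * l)) ` {..<Q - 1}" using k l by auto
    qed
  qed
  have card_K: "card K = Q"
  proof -
    have "0 \<in> K" using Q1 by (simp add: K_def)
    then have "card K = Suc (card (K - {0}))" using card.remove[of K 0] by simp
    also have "card (K - {0}) = Q - 1" using bij_betw_same_card[OF bij] by simp
    finally show ?thesis using Q1 by simp
  qed
  define S where "S = (\<lambda>a. \<Sum>c\<in>K. \<psi> (g ^ a * c))"
  define B :: "nat \<Rightarrow> nat" where "B = (\<lambda>a. if (\<forall>c\<in>K. \<psi> (g ^ a * c) = 1) then 1 else 0)"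
  have SB: "S a = of_nat (Q * B a)" for a
  proof (cases "\<forall>c\<in>K. \<psi> (g ^ a * c) = 1")
    case True
    then show ?thesis by (simp add: S_def B_def card_K)
  next
    case False
    then obtain d where d: "d \<in> K" "\<psi> (g ^ a * d) \<noteq> 1" by blast
    have "S a = (\<Sum>c\<in>K. \<psi> (g ^ a * (d + c)))" unfolding S_def
      by (rule sum.reindex_bij_witness[of _ "\<lambda>c. d + c" "\<lambda>c. c - d"]) (use d K_add K_diff in auto)
    also have "\<dots> = \<psi> (g ^ a * d) * S a" by (simp add: S_def distrib_left \<psi>_add sum_distrib_left)
    finally have "S a = 0" using d by simp
    moreover have "B a = 0" using False by (simp only: B_def if_False)
    ultimately show ?thesis by simp
  qed
  have ST: "(\<Sum>l<Q - 1. \<psi> (g ^ (a + (Q + 1) * l))) = S a - 1" for a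
  proof -
    have "0 \<in> K" using Q1 by (simp add: K_def)
    then have "S a = 1 + (\<Sum>c\<in>K - {0}. \<psi> (g ^ a * c))" unfolding S_def
      by (subst sum.remove[of K 0]) auto
    also have "(\<Sum>c\<in>K - {0}. \<psi> (g ^ a * c)) = (\<Sum>l<Q - 1. \<psi> (g ^ a * g ^ ((Q + 1) * l)))"
      by (rule sum.reindex_bij_betw[OF bij, symmetric])
    finally show ?thesis by (simp only: power_add[symmetric]) simp
  qed
  have "(\<Sum>k<q - 1. \<psi> (g ^ k)) = -1"
    using sum_\<psi> sum_field[of \<psi>] by (simp add: add_eq_0_iff)
  moreover have "(\<Sum>k<q - 1. \<psi> (g ^ k)) = (\<Sum>a<Q + 1. S a - 1)"
    unfolding q1 ST[symmetric] by (rule sum_lessThan_mult_residues) simp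
  moreover have "(\<Sum>a<Q + 1. S a - 1) = of_nat (Q * (\<Sum>a<Q + 1. B a)) - of_nat (Q + 1)"
    by (simp add: SB sum_subtractf sum_distrib_left del: sum.lessThan_Suc)
  ultimately have "of_nat (Q * (\<Sum>a<Q + 1. B a)) = (of_nat Q :: complex)" by (simp add: algebra_simps)
  then have "Q * (\<Sum>a<Q + 1. B a) = Q" using of_nat_eq_iff by blast
  \<comment> \<open>The total over all Q + 1 lines is -1, while each line contributes Q - 1 or -1;
    hence exactly one line is trivial for the character.\<close>
  then have sumB: "(\<Sum>a<Q + 1. B a) = 1" using Q1 by simp
  \<comment> \<open>The trivial line is found explicitly: (a0 (Q - 1)) is half of q - 1, so x -> x^Q
    negates the line of g^a0. Frobenius invariance makes the character value equal to its inverse,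
    hence 1 because \<open>p\<close> is odd. Oddness of \<open>a0\<close> produces the minus sign of
    the result.\<close>
  define a0 where "a0 = (Q + 1) div 2"
  have Qa0: "Q + 1 = 2 * a0" "odd a0" using Q4 unfolding a0_def by presburger+
  have Ba0: "B a0 = 1"
  proof -
    have "\<psi> (g ^ a0 * c) = 1" if c: "c \<in> K" for c
    proof -
      have "(q - 1) div 2 = a0 * (Q - 1)" unfolding q1 Qa0(1) by simp
      then have "g ^ (a0 * (Q - 1)) = -1" using g_half by simp
      then have "(g ^ a0) ^ (Q - 1) * g ^ a0 = - (g ^ a0)" by (simp add: power_mult)
      then have "(g ^ a0) ^ Q = - (g ^ a0)" using power_minus_mult[of Q "g ^ a0"] Q1 by simp
      then have "(g ^ a0 * c) ^ Q = - (g ^ a0 * c)" using c by (simp add: power_mult_distrib K_def)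
      then have "\<psi> (g ^ a0 * c) = \<psi> (- (g ^ a0 * c))" using \<psi>_frob[of "g ^ a0 * c" "s div 2"] by (simp add: Q_def)
      then have "\<psi> (g ^ a0 * c) * \<psi> (g ^ a0 * c) = 1" by (metis \<psi>_0 \<psi>_add add.right_inverse)
      then have "\<omega> ^ (2 * tr (g ^ a0 * c)) = 1" by (simp add: \<psi>_def mult_2 power_add)
      then have "p dvd 2 * tr (g ^ a0 * c)" by (simp only: \<omega>_power)
      then have "p dvd tr (g ^ a0 * c)" using prime_p p_ge_5
        by (auto simp: prime_dvd_mult_iff dest: dvd_imp_le)
      then show ?thesis by (simp add: \<psi>_def \<omega>_power)
    qed
    then show ?thesis by (simp add: B_def)
  qed
  have a0_mem: "a0 \<in> {..<Q + 1}" using Qa0 by (simp only: lessThan_iff)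
  have B0: "B a = 0" if "a \<in> {..<Q + 1} - {a0}" for a
  proof -
    have "(\<Sum>a\<in>{..<Q + 1} - {a0}. B a) = 0" using sumB Ba0 a0_mem
      by (subst (asm) sum.remove[of _ a0]) auto
    then show ?thesis using that by (simp only: sum_eq_0_iff finite_Diff finite_lessThan)
  qed
  have "G (2 ^ (m - 1)) = (\<Sum>k<(Q + 1) * (Q - 1). (-1) ^ k * \<psi> (g ^ k))"
    unfolding G_def q1[symmetric] by (simp only: sum_field X_half_g) simp
  also have "\<dots> = (\<Sum>a<Q + 1. \<Sum>l<Q - 1. (-1) ^ (a + (Q + 1) * l) * \<psi> (g ^ (a + (Q + 1) * l)))"
    by (rule sum_lessThan_mult_residues) simp
  also have "\<dots> = (\<Sum>a<Q + 1. (-1) ^ a * (S a - 1))"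
  proof (rule sum.cong[OF refl])
    fix a
    \<comment> \<open>As Q + 1 is even, the quadratic character is constant on each line.\<close>
    have "(-1::complex) ^ (a + (Q + 1) * l) = (-1) ^ a" for l
      unfolding Qa0(1) by (simp add: power_add power_mult)
    then show "(\<Sum>l<Q - 1. (-1) ^ (a + (Q + 1) * l) * \<psi> (g ^ (a + (Q + 1) * l))) = (-1) ^ a * (S a - 1)"
      by (simp only: ST[symmetric] sum_distrib_left)
  qed
  also have "\<dots> = (\<Sum>a<Q + 1. (-1) ^ a * S a) - (\<Sum>a<Q + 1. (-1) ^ a)"
    by (simp add: algebra_simps sum_subtractf del: sum.lessThan_Suc)
  also have "(\<Sum>a<Q + 1. (-1::complex) ^ a) = 0"
    unfolding Qa0(1) by (subst geometric_sum) (simp_all add: power_mult)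
  also have "(\<Sum>a<Q + 1. (-1) ^ a * S a) = (-1) ^ a0 * S a0"
  proof -
    have "(\<Sum>a\<in>{..<Q + 1} - {a0}. (-1) ^ a * S a) = 0"
      by (rule sum.neutral) (simp add: SB B0 del: Suc_eq_plus1 add_Suc_right)
    then show ?thesis by (subst sum.remove[OF _ a0_mem]) simp_all
  qed
  finally show ?thesis using Qa0(2) by (simp add: SB Ba0 Q_def)
qed

section \<open>The quartic Jacobi sum\<close>

lemma sum_power_field:
  assumes "n > 0"
  shows "(\<Sum>x\<in>UNIV. x ^ n) = (if q - 1 dvd n then - 1 else (0::'a))"
proof -
  have "(\<Sum>x\<in>UNIV. x ^ n) = (\<Sum>k<q - 1. (g ^ n) ^ k)"
    using assms by (simp add: sum_field power_0_left mult.commute flip: power_mult)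
  moreover have "g ^ n = 1 \<longleftrightarrow> q - 1 dvd n"
    using generator_cong[of n 0] by (simp add: cong_0_iff)
  moreover have "(of_nat (q - 1) :: 'a) = -1"
  proof -
    have "p dvd q" using s_pos by simp
    then have "(of_nat q :: 'a) = 0" using of_nat_eq_iff_cong[of q 0] by (simp only: cong_0_iff of_nat_0)
    then show ?thesis using q_gt_1 by (simp add: of_nat_diff)
  qed
  moreover have "(g ^ n) ^ (q - 1) = 1" using g_nonzero by (intro power_q1) simp
  ultimately show ?thesis by (cases "g ^ n = 1") (simp_all add: geometric_sum del: One_nat_def)
qed

text \<open>The norm comes from the absolute values of the Gauss sums, the parity of
  \<open>b\<close> from the symmetry x -> 1 - x. For primality to \<open>p\<close> the sum is
  reduced into the finite field, where it becomes a signed binomial coefficient that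
  \<open>p\<close> does not divide.\<close>

lemma J_quartic:
  "\<exists>a b. J (2 ^ (m - 2)) (2 ^ (m - 2)) = Complex (of_int a) (of_int b) \<and>
     odd a \<and> even b \<and> a\<^sup>2 + b\<^sup>2 = int q \<and> \<not> int p dvd a"
proof -
  define i :: nat where "i = 2 ^ (m - 2)"
  define A where "A = (q - 1) div 4"
  have q4: "q - 1 = 4 * A" using power_mod_4_eq_1[OF p_mod_4, of s] unfolding A_def by presburger
  have A0: "A > 0" using q4 q_gt_1 by simp
  define \<iota> where "\<iota> = g ^ A"
  have \<iota>2: "\<iota> * \<iota> = -1"
  proof -
    have "A + A = (q - 1) div 2" using q4 by simp
    then show ?thesis using g_half by (simp add: \<iota>_def flip: power_add)
  qed
  define e where "e = (\<lambda>y. lg y mod 4)"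
  define ra :: "nat \<Rightarrow> int" where "ra = (\<lambda>k. if k = 0 then 1 else if k = 2 then -1 else 0)"
  define rb :: "nat \<Rightarrow> int" where "rb = (\<lambda>k. if k = 1 then 1 else if k = 3 then -1 else 0)"
  have e_cases: "e y = 0 \<or> e y = 1 \<or> e y = 2 \<or> e y = 3" for y
    unfolding e_def by presburger
  have Xi: "X i y = Complex (of_int (ra (e y))) (of_int (rb (e y)))" if "y \<noteq> 0" for y
  proof -
    have "X i y = \<i> ^ (4 * (lg y div 4) + lg y mod 4)"
      using that by (simp add: X_def i_def power_mult \<zeta>_quarter)
    also have "\<dots> = \<i> ^ e y" unfolding power_add power_mult e_def by simp
    finally show ?thesis using e_cases[of y]
      by (auto simp: ra_def rb_def complex_eq_iff power2_eq_square power3_eq_cube numeral_3_eq_3 numeral_2_eq_2)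
  qed
  \<comment> \<open>The ring homomorphism from the Gaussian integers that sends the imaginary unit
    to minus \<open>\<iota>\<close> turns the quartic character into y -> y^(3A). With exponent A
    instead, the reduced sum below would vanish identically.\<close>
  have Pi: "y ^ (3 * A) = of_int (ra (e y)) - \<iota> * of_int (rb (e y))" if "y \<noteq> 0" for y
  proof -
    have \<iota>4: "\<iota> ^ 4 = 1" using \<iota>2 by (simp add: eval_nat_numeral)
    have "y ^ (3 * A) = (g ^ lg y) ^ (3 * A)" using power_lg[OF that] by simp
    also have "\<dots> = \<iota> ^ (3 * (4 * (lg y div 4) + lg y mod 4))"
      by (simp add: \<iota>_def mult_ac flip: power_mult)
    also have "\<dots> = (\<iota> ^ 4) ^ (3 * (lg y div 4)) * \<iota> ^ (3 * e y)"
      by (simp only: distrib_left power_add e_def power_mult[symmetric] mult.left_commute)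
    also have "\<dots> = \<iota> ^ (3 * e y)" by (simp add: \<iota>4)
    finally show ?thesis using e_cases[of y] \<iota>2 \<iota>4
      by (auto simp: ra_def rb_def eval_nat_numeral mult.assoc)
  qed
  define Y :: "'a set" where "Y = UNIV - {0, 1}"
  have Y: "x * (1 - x) \<noteq> 0" if "x \<in> Y" for x using that by (auto simp: Y_def)
  define a where "a = (\<Sum>x\<in>Y. ra (e (x * (1 - x))))"
  define b where "b = (\<Sum>x\<in>Y. rb (e (x * (1 - x))))"
  have Jab: "J i i = Complex (of_int a) (of_int b)"
  proof -
    have "J i i = (\<Sum>x\<in>UNIV. X i (x * (1 - x)))" by (simp add: J_def X_mult)
    also have "\<dots> = (\<Sum>x\<in>Y. X i (x * (1 - x)))"
      by (rule sum.mono_neutral_right) (auto simp: Y_def)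
    also have "\<dots> = (\<Sum>x\<in>Y. Complex (of_int (ra (e (x * (1 - x))))) (of_int (rb (e (x * (1 - x))))))"
      by (rule sum.cong) (use Xi Y in auto)
    finally show ?thesis by (simp add: complex_eq_iff a_def b_def)
  qed
  have "2 ^ (m - 1) = 2 * i" using m_ge_2 unfolding i_def by (metis Suc_diff_le diff_Suc_Suc numeral_2_eq_2 power_Suc One_nat_def)
  then have i2: "i + i = 2 ^ (m - 1)" by simp
  have ni2: "\<not> 2 ^ m dvd i + i" unfolding i2 using m_ge_2 by (intro nat_dvd_not_less) auto
  then have ni: "\<not> 2 ^ m dvd i" using dvd_add by blast
  have norm: "a\<^sup>2 + b\<^sup>2 = int q"
  proof -
    have GJ: "G i * G i = J i i * G (i + i)" by (rule G_mult[OF ni2])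
    have "of_nat q * (of_nat q :: complex) = (G i * G i) * cnj (G i * G i)"
      using G_norm[OF ni] by (simp add: mult_ac)
    also have "\<dots> = (J i i * cnj (J i i)) * (G (i + i) * cnj (G (i + i)))"
      by (simp add: GJ mult_ac)
    also have "\<dots> = (J i i * cnj (J i i)) * of_nat q" by (simp add: G_norm[OF ni2])
    finally have "J i i * cnj (J i i) = of_nat q" using p_ge_5 by simp
    then have "complex_of_real (of_int (a\<^sup>2 + b\<^sup>2)) = complex_of_real (of_int (int q))"
      by (simp add: Jab complex_mult_cnj)
    then show ?thesis by (simp only: of_real_eq_iff of_int_eq_iff)
  qed
  \<comment> \<open>Modulo 2, \<open>b\<close> counts the points with odd quartic index. The only
    possible fixed point of x -> 1 - x is 1/2, where x (1 - x) = 1/4 has character value 1 and is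
    not counted.\<close>
  have "even b"
  proof -
    define Z where "Z = {x \<in> Y. odd (e (x * (1 - x)))}"
    have "even (card Z)"
    proof (rule even_card_involution[of Z "\<lambda>x. 1 - x"])
      fix x assume x: "x \<in> Z"
      then show "1 - x \<in> Z" by (auto simp: Z_def Y_def mult.commute)
      show "1 - x \<noteq> x"
      proof
        assume "1 - x = x"
        then have "2 * x = 1" by (simp add: algebra_simps)
        moreover have "4 * (x * (1 - x)) = (2 * x) * (2 * x)" unfolding \<open>1 - x = x\<close> by simp
        ultimately have x2: "4 * (x * (1 - x)) = 1" by simp
        have "X i (4 * (x * (1 - x))) = 1" unfolding x2 by simp
        then have "X i (x * (1 - x)) = 1" by (simp add: X_mult X_4)
        moreover have "x \<in> Y" "odd (e (x * (1 - x)))" using x by (auto simp: Z_def)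
        ultimately show False using Xi[OF Y] e_cases[of "x * (1 - x)"]
          by (auto simp: ra_def complex_eq_iff)
      qed
    qed auto
    moreover have "even (b - int (card Z))"
    proof -
      have "int (card Z) = (\<Sum>x\<in>Y. if odd (e (x * (1 - x))) then 1 else 0)"
        by (simp add: Z_def sum.If_cases Int_def conj_commute)
      then have "b - int (card Z) = (\<Sum>x\<in>Y. rb (e (x * (1 - x))) - (if odd (e (x * (1 - x))) then 1 else 0))"
        by (simp add: b_def sum_subtractf)
      also have "even \<dots>"
      proof (rule dvd_sum)
        fix x
        show "even (rb (e (x * (1 - x))) - (if odd (e (x * (1 - x))) then 1 else 0))"
          using e_cases[of "x * (1 - x)"] by (auto simp: rb_def)
      qed
      finally show ?thesis .
    qed
    ultimately show ?thesis by simp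
  qed
  moreover have "odd a"
  proof -
    have "odd (a\<^sup>2 + b\<^sup>2)" unfolding norm using p_odd by simp
    then show ?thesis using \<open>even b\<close> by simp
  qed
  moreover have "\<not> int p dvd a"
  proof
    assume pa: "int p dvd a"
    have "int p dvd int q" using s_pos by simp
    then have "int p dvd b\<^sup>2" using pa norm
      by (metis dvd_add_right_iff dvd_mult power2_eq_square)
    then have pb: "int p dvd b" using prime_p by (metis prime_dvd_power prime_nat_int_transfer)
    have of_int0: "(of_int z :: 'a) = 0" if "int p dvd z" for z
      using that char_eq by (simp add: of_int_eq_0_iff_char_dvd)
    \<comment> \<open>If \<open>p\<close> divided \<open>a\<close>, the norm would make it divide
      \<open>b\<close> as well, so the image of the Jacobi sum in the field would be zero.\<close>
    have "(\<Sum>x\<in>UNIV. (x * (1 - x)) ^ (3 * A)) = (\<Sum>x\<in>Y. (x * (1 - x)) ^ (3 * A))"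
      using A0 by (intro sum.mono_neutral_right) (auto simp: Y_def)
    also have "\<dots> = (\<Sum>x\<in>Y. of_int (ra (e (x * (1 - x)))) - \<iota> * of_int (rb (e (x * (1 - x)))))"
      by (rule sum.cong) (use Pi Y in auto)
    also have "\<dots> = of_int a - \<iota> * of_int b"
      by (simp add: a_def b_def sum_subtractf sum_distrib_left)
    finally have zero: "(\<Sum>x\<in>UNIV. (x * (1 - x)) ^ (3 * A)) = (0::'a)" using of_int0 pa pb by simp
    have "(\<Sum>x\<in>UNIV. (x * (1 - x)) ^ (3 * A))
        = (\<Sum>x\<in>UNIV. \<Sum>k\<le>3 * A. of_nat (3 * A choose k) * (-1) ^ k * (x::'a) ^ (3 * A + k))"
    proof (rule sum.cong[OF refl])
      fix x :: 'a
      have "(1 - x) ^ (3 * A) = (- x + 1) ^ (3 * A)" by simp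
      also have "\<dots> = (\<Sum>k\<le>3 * A. of_nat (3 * A choose k) * (- x) ^ k)" by (subst binomial_ring) simp
      finally show "(x * (1 - x)) ^ (3 * A) = (\<Sum>k\<le>3 * A. of_nat (3 * A choose k) * (-1) ^ k * x ^ (3 * A + k))"
        by (simp add: power_mult_distrib sum_distrib_left power_add mult_ac power_minus[of x])
    qed
    also have "\<dots> = (\<Sum>k\<le>3 * A. of_nat (3 * A choose k) * (-1) ^ k * (\<Sum>x\<in>UNIV. (x::'a) ^ (3 * A + k)))"
      by (subst sum.swap) (simp add: sum_distrib_left)
    also have "\<dots> = (\<Sum>k\<le>3 * A. if k = A then - (of_nat (3 * A choose k) * (-1) ^ k) else 0)"
    proof (rule sum.cong[OF refl])
      fix k assume k: "k \<in> {..3 * A}"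
      \<comment> \<open>Power sums survive only at exponents divisible by q - 1 = 4 A. Those
        occurring lie between 3 A and 6 A, which leaves 4 A alone.\<close>
      have "q - 1 dvd 3 * A + k \<longleftrightarrow> k = A"
      proof
        assume "q - 1 dvd 3 * A + k"
        then obtain t where t: "3 * A + k = 4 * A * t" unfolding q4 by blast
        have "t \<noteq> 0" using t A0 by (intro notI) simp
        moreover have "t < 2"
        proof (rule ccontr)
          assume "\<not> t < 2"
          then have "4 * A * 2 \<le> 4 * A * t" by (intro mult_le_mono2) simp
          then have "8 * A \<le> 3 * A + k" using t by simp
          then show False using k A0 by simp
        qed
        ultimately have "t = 1" by simp
        then show "k = A" using t by simp
      qed (simp add: q4 del: One_nat_def)
      then show "of_nat (3 * A choose k) * (-1) ^ k * (\<Sum>x\<in>UNIV. (x::'a) ^ (3 * A + k))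
          = (if k = A then - (of_nat (3 * A choose k) * (-1) ^ k) else 0)"
        using A0 by (simp add: sum_power_field)
    qed
    also have "\<dots> = - (of_nat (3 * A choose A) * (-1) ^ A)" by simp
    finally have "(of_nat (3 * A choose A) :: 'a) = 0" using zero by simp
    then have "p dvd 3 * A choose A" using of_nat_eq_iff_cong[of "3 * A choose A" 0] by (simp add: cong_0_iff)
    then show False using not_dvd_binomial_quarter[OF prime_p p_mod_4, of s] unfolding A_def by simp
  qed
  ultimately show ?thesis using Jab norm unfolding i_def by blast
qed

text \<open>All the Gauss sums with index i (1 + 4 k) coincide. Averaging over k kills every field
  element at which the character value is not a fourth root of unity.\<close>

lemma G_fourth_roots:
  "G i = (\<Sum>x\<in>UNIV. if X i x ^ 4 = 1 then X i x * \<psi> x else 0)"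
proof -
  have "of_nat (2 ^ m) * G i = (\<Sum>k<2 ^ m. G (i * (1 + 4 * k)))"
  proof -
    have "G (i * (1 + 4 * k)) = G i" for k by (rule G_mult_1_mod_4) presburger
    then show ?thesis by simp
  qed
  also have "\<dots> = (\<Sum>k<2 ^ m. \<Sum>x\<in>UNIV. X i x * \<psi> x * (X i x ^ 4) ^ k)"
    unfolding G_def
    by (intro sum.cong refl) (subst X_exp, simp_all add: power_add power_mult)
  also have "\<dots> = (\<Sum>x\<in>UNIV. X i x * \<psi> x * (\<Sum>k<2 ^ m. (X i x ^ 4) ^ k))"
    by (subst sum.swap) (simp add: sum_distrib_left)
  also have "\<dots> = (\<Sum>x\<in>UNIV. of_nat (2 ^ m) * (if X i x ^ 4 = 1 then X i x * \<psi> x else 0))"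
  proof (rule sum.cong[OF refl])
    fix x
    show "X i x * \<psi> x * (\<Sum>k<2 ^ m. (X i x ^ 4) ^ k) = of_nat (2 ^ m) * (if X i x ^ 4 = 1 then X i x * \<psi> x else 0)"
    proof (cases "x = 0 \<or> X i x ^ 4 = 1")
      case False
      have "X i x ^ (2 ^ m) = 1" using False by (simp add: X_def \<zeta>_power flip: power_mult)
      then have "(X i x ^ 4) ^ (2 ^ m) = 1" by (metis power_mult mult.commute power_one)
      then show ?thesis using False by (simp add: geometric_sum)
    qed auto
  qed
  also have "\<dots> = of_nat (2 ^ m) * (\<Sum>x\<in>UNIV. if X i x ^ 4 = 1 then X i x * \<psi> x else 0)"
    by (simp only: sum_distrib_left)
  finally show ?thesis by simp
qed

text \<open>This parity obstruction fixes all signs. The map \<open>x \<mapsto> x ^ Q0\<close> acts without fixed points on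
  \<open>{x. X i x = \<plusminus>\<i>}\<close>, so \<open>Im (G i)\<close> is twice an element \<open>v\<close> of \<open>\<int>[\<omega>]\<close>. The conjugates
  of \<open>v\<close> differ from it by signs only, so \<open>(p - 1) * (2 * v) ^ 4\<close> is \<open>16\<close> times an
  integer trace, while \<open>p - 1\<close> is divisible by \<open>4\<close> only.\<close>

lemma Im_G_square_not_odd:
  assumes "(Im (G i))\<^sup>2 = of_int N"
  shows "even N"
proof (rule ccontr)
  assume "odd N"
  \<comment> \<open>The imaginary part of the character value where that value is a fourth root of
    unity, and 0 elsewhere.\<close>
  define f :: "'a \<Rightarrow> int" where "f = (\<lambda>x. if X i x = \<i> then 1 else if X i x = - \<i> then -1 else 0)"
  have ImG: "complex_of_real (Im (G i)) = (\<Sum>x\<in>UNIV. of_int (f x) * \<psi> x)"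
  proof -
    \<comment> \<open>A natural-number representative of -i modulo 2^m, the index of the conjugate
      character.\<close>
    define j where "j = i * (2 ^ m - 1)"
    have "i + j = i * 2 ^ m" by (simp add: j_def diff_mult_distrib2)
    then have ij: "2 ^ m dvd i + j" by simp
    have Xj: "X j x = cnj (X i x)" for x by (rule X_cnj[OF ij])
    have "2 * \<i> * complex_of_real (Im (G i)) = G i - G j"
      by (simp add: G_cnj[OF ij] complex_eq_iff)
    also have "\<dots> = (\<Sum>x\<in>UNIV. if X i x ^ 4 = 1 then (X i x - cnj (X i x)) * \<psi> x else 0)"
    proof -
      have "X j x ^ 4 = 1 \<longleftrightarrow> X i x ^ 4 = 1" for x
        unfolding Xj by (metis complex_cnj_power complex_cnj_one complex_cnj_cancel_iff)
      then show ?thesis unfolding G_fourth_roots[of i] G_fourth_roots[of j]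
        by (simp add: Xj sum_subtractf[symmetric] algebra_simps if_distrib cong: if_cong)
    qed
    also have "\<dots> = (\<Sum>x\<in>UNIV. 2 * \<i> * (of_int (f x) * \<psi> x))"
    proof (rule sum.cong[OF refl])
      fix x
      have "X i x = 1 \<or> X i x = -1 \<or> X i x = \<i> \<or> X i x = - \<i>" if "X i x ^ 4 = 1"
      proof -
        have "(X i x - 1) * (X i x + 1) * (X i x - \<i>) * (X i x + \<i>) = X i x ^ 4 - 1"
          by (simp add: algebra_simps eval_nat_numeral)
        then show ?thesis using that by (auto simp: add_eq_0_iff2)
      qed
      moreover have "X i x \<noteq> \<i> \<and> X i x \<noteq> - \<i>" if "X i x ^ 4 \<noteq> 1"
        using that by (auto simp: eval_nat_numeral)
      moreover have "1 \<noteq> \<i>" "1 \<noteq> - \<i>" "-1 \<noteq> \<i>" "-1 \<noteq> - \<i>" "- \<i> \<noteq> \<i>"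
        by (simp_all add: complex_eq_iff)
      ultimately show "(if X i x ^ 4 = 1 then (X i x - cnj (X i x)) * \<psi> x else 0) = 2 * \<i> * (of_int (f x) * \<psi> x)"
        by (cases "X i x ^ 4 = 1") (auto simp: f_def)
    qed
    also have "\<dots> = 2 * \<i> * (\<Sum>x\<in>UNIV. of_int (f x) * \<psi> x)" by (simp only: sum_distrib_left)
    finally show ?thesis by simp
  qed
  define n where "n = (\<lambda>t. \<Sum>x\<in>{x. tr x = t}. f x)"
  have n_even: "even (n t)" for t
  proof -
    define S where "S = {x. tr x = t \<and> (X i x = \<i> \<or> X i x = - \<i>)}"
    have Q0: "\<exists>k. Q0 = p ^ k" by (auto simp: Q0_def)
    have "even (card S)"
    proof (rule even_card_two_power_period[where k = "m - 1" and f = "\<lambda>x. x ^ Q0"])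
      fix x assume x: "x \<in> S"
      have "Q0 mod 4 = 1" unfolding Q0_def by (rule power_mod_4_eq_1[OF p_mod_4])
      then obtain l where l: "Q0 = 4 * l + 1" by (metis mod_mult_div_eq add.commute mult.commute)
      have "\<i> ^ 4 = 1" "(- \<i>) ^ 4 = 1" by (simp_all add: eval_nat_numeral)
      then have "\<i> ^ Q0 = \<i>" "(- \<i>) ^ Q0 = - \<i>" by (simp_all add: l power_add power_mult)
      then show "x ^ Q0 \<in> S" using x Q0 by (auto simp: S_def X_power tr_frob)
      have "((\<lambda>x. x ^ Q0) ^^ k) x = x ^ (Q0 ^ k)" for k
        by (induction k) (simp_all add: mult.commute flip: power_mult)
      then show "((\<lambda>x. x ^ Q0) ^^ 2 ^ (m - 1)) x = x" using q_eq_Q0 power_q[of x] by simp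
      show "x ^ Q0 \<noteq> x"
      proof
        assume "x ^ Q0 = x"
        moreover have "x \<noteq> 0" using x by (auto simp: S_def)
        ultimately have "X i x = 1 \<or> X i x = -1" by (intro X_Q0_fixed)
        then show False using x by (auto simp: S_def complex_eq_iff)
      qed
    qed simp
    moreover have "even (n t - int (card S))"
    proof -
      have "int (card S) = (\<Sum>x\<in>{x. tr x = t}. if X i x = \<i> \<or> X i x = - \<i> then 1 else 0)"
        by (simp add: S_def sum.If_cases Int_def conj_commute)
      then have "n t - int (card S) = (\<Sum>x\<in>{x. tr x = t}. f x - (if X i x = \<i> \<or> X i x = - \<i> then 1 else 0))"
        by (simp add: n_def sum_subtractf)
      also have "even \<dots>" by (rule dvd_sum) (simp add: f_def)
      finally show ?thesis .
    qed
    ultimately show ?thesis by simp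
  qed
  \<comment> \<open>With the even coefficients halved, \<open>2 * v 1\<close> is the imaginary part
    of \<open>G i\<close>, and \<open>v c\<close> for other nonzero c are its Galois conjugates
    halved.\<close>
  define P :: "int poly" where "P = (\<Sum>t<p. Polynomial.monom (n t div 2) t)"
  define v where "v = (\<lambda>c. poly (map_poly complex_of_int P) (\<omega> ^ c))"
  have v: "2 * v c = (\<Sum>x\<in>UNIV. of_int (f x) * \<psi> (of_nat c * x))" for c
  proof -
    have "map_poly complex_of_int P = (\<Sum>t<p. Polynomial.monom (of_int (n t div 2)) t)"
      by (rule poly_eqI) (simp add: coeff_map_poly P_def coeff_sum if_distrib cong: if_cong)
    then have "v c = (\<Sum>t<p. of_int (n t div 2) * (\<omega> ^ c) ^ t)"
      by (simp add: v_def poly_sum poly_monom)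
    moreover have "(2::complex) * of_int (n t div 2) = of_int (n t)" for t
    proof -
      have "2 * (n t div 2) = n t" using n_even by simp
      then show ?thesis by (metis of_int_mult of_int_numeral)
    qed
    ultimately have "2 * v c = (\<Sum>t<p. of_int (n t) * (\<omega> ^ c) ^ t)"
      by (simp add: sum_distrib_left mult.assoc[symmetric])
    also have "\<dots> = (\<Sum>t<p. \<Sum>x\<in>{x. x \<in> UNIV \<and> tr x = t}. of_int (f x) * \<psi> (of_nat c * x))"
    proof (rule sum.cong[OF refl])
      fix t
      have "(\<Sum>x\<in>{x. x \<in> UNIV \<and> tr x = t}. of_int (f x) * \<psi> (of_nat c * x))
          = (\<Sum>x\<in>{x. tr x = t}. of_int (f x) * (\<omega> ^ c) ^ t)"
      proof (rule sum.cong)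
        fix x assume "x \<in> {x. tr x = t}"
        then have "\<psi> (of_nat c * x) = (\<omega> ^ c) ^ t"
          unfolding \<psi>_of_nat_mult by (simp add: \<psi>_def mult.commute flip: power_mult)
        then show "of_int (f x) * \<psi> (of_nat c * x) = of_int (f x) * (\<omega> ^ c) ^ t" by simp
      qed simp
      then show "of_int (n t) * (\<omega> ^ c) ^ t = (\<Sum>x\<in>{x. x \<in> UNIV \<and> tr x = t}. of_int (f x) * \<psi> (of_nat c * x))"
        by (simp add: n_def sum_distrib_right)
    qed
    also have "\<dots> = (\<Sum>x\<in>UNIV. of_int (f x) * \<psi> (of_nat c * x))"
      by (rule sum.group) (auto simp: tr_less)
    finally show ?thesis .
  qed
  \<comment> \<open>Conjugation by c amounts to scaling x by c in the prime field, where the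
    character is 1 or -1; hence \<open>v c\<close> is \<open>v 1\<close> up to sign.\<close>
  have v_pos: "(2 * v c) ^ 4 = of_int (N\<^sup>2)" if "c \<in> {1..<p}" for c
  proof -
    define d :: 'a where "d = of_nat c"
    have "\<not> [c = 0] (mod p)" using that by (auto simp: cong_0_iff dest: dvd_imp_le)
    then have d0: "d \<noteq> 0" using of_nat_eq_iff_cong[of c 0] by (simp add: d_def)
    have "X i d = 1 \<or> X i d = -1" using d0 unfolding d_def by (rule X_of_nat)
    moreover have "X i (1 / d) * X i d = 1" using d0 by (simp flip: X_mult)
    ultimately obtain \<epsilon> where \<epsilon>: "X i (1 / d) = of_int \<epsilon>" "\<epsilon> = 1 \<or> \<epsilon> = -1"
      by (metis mult.right_neutral mult_minus1_right minus_equation_iff of_int_1 of_int_minus)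
    have fd: "f (x / d) = \<epsilon> * f x" for x
    proof -
      have "X i (x / d) = X i x * of_int \<epsilon>" using X_mult[of i x "1 / d"] \<epsilon> by simp
      then show ?thesis using \<epsilon>(2) by (auto simp: f_def complex_eq_iff)
    qed
    have "2 * v c = (\<Sum>x\<in>UNIV. of_int (f (x / d)) * \<psi> x)"
      unfolding v d_def[symmetric]
      by (rule sum.reindex_bij_witness[of _ "\<lambda>x. x / d" "\<lambda>x. d * x"]) (use d0 in auto)
    also have "\<dots> = of_int \<epsilon> * complex_of_real (Im (G i))"
      by (simp add: fd ImG sum_distrib_left mult.assoc)
    finally have "(2 * v c) ^ 2 = complex_of_real ((Im (G i))\<^sup>2)" using \<epsilon>(2) by (auto simp: power_mult_distrib)
    then have "(2 * v c) ^ 2 = of_int N" using assms by simp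
    then have "((2 * v c) ^ 2) ^ 2 = of_int (N\<^sup>2)" by simp
    then show ?thesis by (simp flip: power_mult)
  qed
  \<comment> \<open>The term c = 0 is no conjugate. It vanishes because inversion in the field
    conjugates character values and so negates \<open>f\<close>.\<close>
  have v_0: "2 * v 0 = 0"
  proof -
    have finv: "f (inverse x) = - f x" for x
    proof (cases "x = 0")
      case False
      then have "X i x * X i (inverse x) = 1" by (simp flip: X_mult)
      then have "X i (inverse x) = inverse (X i x)" by (metis inverse_unique)
      moreover have "inverse z = \<i> \<longleftrightarrow> z = - \<i>" "inverse z = - \<i> \<longleftrightarrow> z = \<i>" for z :: complex
        by (metis inverse_inverse_eq inverse_i inverse_minus_eq minus_minus)+
      ultimately show ?thesis by (simp add: f_def complex_eq_iff)
    qed (simp add: f_def)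
    have "(\<Sum>x\<in>UNIV. f x) = (\<Sum>x\<in>UNIV. f (inverse x))"
      by (rule sum.reindex_bij_witness[of _ inverse inverse]) auto
    then have "(\<Sum>x\<in>UNIV. f x) = 0" by (simp add: finv sum_negf)
    then show ?thesis unfolding v by (simp flip: of_int_sum)
  qed
  \<comment> \<open>The fourth power is essential: with squares one would get only that 4 divides (p
    - 1) N, which is consistent with p = 5 mod 8.\<close>
  obtain T where T: "(\<Sum>c<p. poly (map_poly of_int (P * P * (P * P))) (\<omega> ^ c)) = (of_int (int p * T) :: complex)"
    using sum_int_poly_roots_of_unity[OF \<omega>_p \<omega>_power] by blast
  have "(of_int (16 * (int p * T)) :: complex) = (\<Sum>c<p. (2 * v c) ^ 4)"
    unfolding of_int_mult[of 16] T[symmetric]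
    by (simp add: v_def map_poly_of_int_mult sum_distrib_left power_mult_distrib eval_nat_numeral(2,3) mult_ac)
  also have "\<dots> = (\<Sum>c\<in>{1..<p}. (2 * v c) ^ 4)"
  proof -
    have "{..<p} = insert 0 {1..<p}" using p_ge_5 by auto
    then show ?thesis using v_0 by simp
  qed
  also have "\<dots> = of_int (int (p - 1) * N\<^sup>2)" using v_pos by simp
  finally have "16 * (int p * T) = int (p - 1) * N\<^sup>2" by (simp only: of_int_eq_iff)
  then have "8 dvd int (p - 1) * N\<^sup>2" by (metis dvd_def mult.assoc numeral_times_numeral semiring_norm(11,13) mult_2 numeral_Bit0 dvd_triv_left dvd_mult2 dvd_refl num_double)
  moreover have "coprime 8 (N\<^sup>2)"
  proof -
    have "coprime (2 ^ 3) (N\<^sup>2)" using \<open>odd N\<close> by (metis coprime_left_2_iff_odd coprime_power_left_iff coprime_power_right_iff)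
    then show ?thesis by simp
  qed
  ultimately have "8 dvd int (p - 1)" by (simp add: coprime_dvd_mult_left_iff)
  then show False using p_mod_8 by presburger
qed

section \<open>Periods and the number of solutions\<close>

text \<open>One plus 2^m times the Gaussian period of the coset of g^j modulo 2^m-th powers; the 1
  comes from x = 0.\<close>

definition \<eta> :: "nat \<Rightarrow> complex" where
  "\<eta> j = (\<Sum>x\<in>UNIV. \<psi> (g ^ j * x ^ (2 ^ m)))"

lemma q1_eq: "q - 1 = 2 ^ m * ((q - 1) div 2 ^ m)"
  using dvd_q1' by simp

lemma diag_count_eq_periods:
  "of_nat q * of_nat (diag_count n m TYPE('a)) =
     (of_nat q ^ n + of_nat ((q - 1) div 2 ^ m) * (\<Sum>j<2 ^ m. \<eta> j ^ n) :: complex)"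
proof -
  define U where "U = (q - 1) div 2 ^ m"
  have fin: "finite {xs :: 'a list. length xs = n}"
    using finite_lists_length_eq[of "UNIV :: 'a set" n] by simp
  define h where "h = (\<lambda>xs :: 'a list. \<Sum>x\<leftarrow>xs. x ^ (2 ^ m))"
  have prod: "prod_list (map (\<lambda>x. \<psi> (c * x ^ (2 ^ m))) xs) = \<psi> (c * h xs)" for c xs
    by (induction xs) (simp_all add: h_def distrib_left \<psi>_add)
  have "(\<Sum>c\<in>UNIV. (\<Sum>x\<in>UNIV. \<psi> (c * x ^ (2 ^ m))) ^ n) = (\<Sum>c\<in>UNIV. \<Sum>xs | length xs = n. \<psi> (h xs * c))"
    by (simp add: sum_power_eq_sum_lists prod mult.commute)
  also have "\<dots> = (\<Sum>xs | length xs = n. if h xs = 0 then of_nat q else 0)"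
    by (subst sum.swap) (simp add: sum_\<psi>_mult)
  also have "\<dots> = of_nat q * of_nat (card {xs. length xs = n \<and> h xs = 0})"
    using fin by (simp add: sum.If_cases Int_def mult.commute)
  also have "card {xs. length xs = n \<and> h xs = 0} = diag_count n m TYPE('a)"
    by (simp add: diag_count_def h_def)
  finally have "of_nat q * of_nat (diag_count n m TYPE('a)) = (\<Sum>c\<in>UNIV. (\<Sum>x\<in>UNIV. \<psi> (c * x ^ (2 ^ m))) ^ n)" ..
  also have "\<dots> = of_nat q ^ n + (\<Sum>k<q - 1. \<eta> k ^ n)"
    by (simp only: sum_field[of "\<lambda>c. (\<Sum>x\<in>UNIV. \<psi> (c * x ^ (2 ^ m))) ^ n"] \<eta>_def) (simp add: card_field)
  also have "(\<Sum>k<q - 1. \<eta> k ^ n) = (\<Sum>j<2 ^ m. \<Sum>l<U. \<eta> (j + 2 ^ m * l) ^ n)"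
    unfolding U_def by (subst q1_eq, rule sum_lessThan_mult_residues) simp
  also have "\<dots> = (\<Sum>j<2 ^ m. \<Sum>l<U. \<eta> j ^ n)"
  proof -
    have "\<eta> (j + 2 ^ m * l) = \<eta> j" for j l
    proof -
      have "\<eta> (j + 2 ^ m * l) = (\<Sum>x\<in>UNIV. \<psi> (g ^ j * (g ^ l * x) ^ (2 ^ m)))"
        by (simp add: \<eta>_def power_add power_mult_distrib mult_ac flip: power_mult)
      also have "\<dots> = \<eta> j" unfolding \<eta>_def
        using g_nonzero by (intro sum.reindex_bij_witness[of _ "\<lambda>x. x / g ^ l" "\<lambda>x. g ^ l * x"]) auto
      finally show ?thesis .
    qed
    then show ?thesis by simp
  qed
  finally show ?thesis by (simp add: U_def sum_distrib_left)
qed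

lemma G_eq_sum: "G i = (\<Sum>k<q - 1. \<zeta> ^ (i * k) * \<psi> (g ^ k))"
  unfolding G_def by (simp only: sum_field X_g) simp

text \<open>Fourier inversion on the cyclic quotient of order 2^m: summing over all characters
  singles out the exponents congruent to j.\<close>

lemma \<eta>_eq_sum_G:
  assumes "j < 2 ^ m"
  shows "\<eta> j = 1 + (\<Sum>i<2 ^ m. cnj (\<zeta> ^ (i * j)) * G i)"
proof -
  define U where "U = (q - 1) div 2 ^ m"
  have q1: "q - 1 = U * 2 ^ m" unfolding U_def using q1_eq by (simp add: mult.commute)
  have "\<eta> j = 1 + (\<Sum>k<q - 1. \<psi> (g ^ j * (g ^ k) ^ (2 ^ m)))"
    by (simp only: \<eta>_def sum_field) (simp add: power_0_left)
  also have "(\<Sum>k<q - 1. \<psi> (g ^ j * (g ^ k) ^ (2 ^ m))) = (\<Sum>k<U * 2 ^ m. \<psi> (g ^ (j + 2 ^ m * k)))"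
    unfolding q1 by (simp add: power_add mult.commute flip: power_mult)
  also have "\<dots> = of_nat (2 ^ m) * (\<Sum>k<U. \<psi> (g ^ (j + 2 ^ m * k)))"
  proof (rule sum_lessThan_periodic)
    fix k
    have "g ^ (j + 2 ^ m * (k + U)) = g ^ (j + 2 ^ m * k) * g ^ (q - 1)"
      unfolding q1 by (simp only: power_add distrib_left mult.assoc mult.commute[of U])
    then show "\<psi> (g ^ (j + 2 ^ m * (k + U))) = \<psi> (g ^ (j + 2 ^ m * k))"
      using power_q1[OF g_nonzero] by simp
  qed
  also have "\<dots> = (\<Sum>i<2 ^ m. cnj (\<zeta> ^ (i * j)) * G i)"
  proof -
    have "(\<Sum>i<2 ^ m. cnj (\<zeta> ^ (i * j)) * G i)
        = (\<Sum>k<q - 1. \<psi> (g ^ k) * (\<Sum>i<2 ^ m. (cnj (\<zeta> ^ j) * \<zeta> ^ k) ^ i))"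
      unfolding G_eq_sum sum_distrib_left
      by (subst sum.swap) (simp add: power_mult_distrib mult_ac flip: power_mult)
    also have "\<dots> = (\<Sum>l<2 ^ m. \<Sum>k<U. \<psi> (g ^ (l + 2 ^ m * k)) * (\<Sum>i<2 ^ m. (cnj (\<zeta> ^ j) * \<zeta> ^ (l + 2 ^ m * k)) ^ i))"
      unfolding q1 mult.commute[of U] by (rule sum_lessThan_mult_residues) simp
    also have "\<dots> = (\<Sum>l<2 ^ m. if l = j then of_nat (2 ^ m) * (\<Sum>k<U. \<psi> (g ^ (l + 2 ^ m * k))) else 0)"
    proof (rule sum.cong[OF refl])
      fix l assume l: "l \<in> {..<(2::nat) ^ m}"
      have inv: "cnj (\<zeta> ^ j) * \<zeta> ^ j = 1"
        by (simp only: mult.commute[of "cnj _"] complex_norm_square[symmetric]) (simp add: norm_power norm_\<zeta>)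
      have red: "\<zeta> ^ (l + 2 ^ m * k) = \<zeta> ^ l" for k by (rule \<zeta>_cong) (simp add: cong_def)
      have "(\<Sum>i<2 ^ m. (cnj (\<zeta> ^ j) * \<zeta> ^ l) ^ i) = (if l = j then of_nat (2 ^ m) else 0)"
      proof (cases "l = j")
        case False
        have "cnj (\<zeta> ^ j) * \<zeta> ^ l \<noteq> 1"
        proof
          assume *: "cnj (\<zeta> ^ j) * \<zeta> ^ l = 1"
          then have eq: "\<zeta> ^ l = \<zeta> ^ j" using inv by (metis mult_left_cancel mult_zero_left zero_neq_one)
          have "\<zeta> \<noteq> 0" using norm_\<zeta> by force
          have aux: "x = y" if "x \<le> y" "\<zeta> ^ x = \<zeta> ^ y" "y < 2 ^ m" for x y
          proof -
            have "\<zeta> ^ x * \<zeta> ^ (y - x) = \<zeta> ^ y" using that(1) by (simp flip: power_add)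
            then have "\<zeta> ^ x * \<zeta> ^ (y - x) = \<zeta> ^ x * 1" using that(2) by simp
            then have "\<zeta> ^ (y - x) = 1" using \<open>\<zeta> \<noteq> 0\<close> by (metis mult_left_cancel power_not_zero)
            then have "2 ^ m dvd y - x" by (simp only: \<zeta>_power)
            then show ?thesis using that by (metis diff_is_0_eq dvd_imp_le le_antisym less_imp_diff_less neq0_conv not_le)
          qed
          show False using aux[of l j] aux[of j l] eq l assms False by (cases "l \<le> j") auto
        qed
        moreover have "(cnj (\<zeta> ^ j) * \<zeta> ^ l) ^ 2 ^ m = 1"
        proof -
          have "(\<zeta> ^ k) ^ 2 ^ m = 1" for k by (simp add: \<zeta>_power flip: power_mult)
          then show ?thesis by (metis power_mult_distrib complex_cnj_power complex_cnj_one mult_1)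
        qed
        ultimately show ?thesis using False by (simp add: geometric_sum)
      qed (simp only: inv power_one, simp)
      then show "(\<Sum>k<U. \<psi> (g ^ (l + 2 ^ m * k)) * (\<Sum>i<2 ^ m. (cnj (\<zeta> ^ j) * \<zeta> ^ (l + 2 ^ m * k)) ^ i))
          = (if l = j then of_nat (2 ^ m) * (\<Sum>k<U. \<psi> (g ^ (l + 2 ^ m * k))) else 0)"
        by (simp only: red) (simp add: sum_distrib_left mult.commute)
    qed
    finally show ?thesis using assms by simp
  qed
  finally show ?thesis .
qed

text \<open>The contribution to \<open>\<eta> j\<close> of the characters of exact order \<open>2 ^ r\<close>.\<close>

definition T :: "nat \<Rightarrow> nat \<Rightarrow> complex" where
  "T r j = (\<Sum>l<2 ^ (r - 1). cnj (\<zeta> ^ (2 ^ (m - r) * (1 + 2 * l) * j)) * G (2 ^ (m - r) * (1 + 2 * l)))"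

lemma \<eta>_eq_sum_T:
  assumes "j < 2 ^ m"
  shows "\<eta> j = (\<Sum>r = 1..m. T r j)"
proof -
  \<comment> \<open>\<open>E r\<close> collects the characters of order dividing 2^r. The trivial
    one gives \<open>E 0 = G 0\<close>, that is -1, which cancels the 1 contributed by x =
    0.\<close>
  define E where "E = (\<lambda>r. \<Sum>u<2 ^ r. cnj (\<zeta> ^ (2 ^ (m - r) * u * j)) * G (2 ^ (m - r) * u))"
  have "E r = -1 + (\<Sum>r = 1..r. T r j)" if "r \<le> m" for r
    using that
  proof (induction r)
    case 0
    have "G 0 = -1" using G_eq_sum[of 0] sum_\<psi> sum_field[of \<psi>] by (simp add: add_eq_0_iff)
    then show ?case by (simp add: E_def)
  next
    case (Suc r)
    have two: "{..<2::nat} = {0, 1}" by auto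
    have e: "2 ^ (m - Suc r) * (2 * l) = 2 ^ (m - r) * l" for l :: nat
      using Suc.prems by (simp add: Suc_diff_Suc mult.assoc[symmetric] flip: power_Suc2)
    have "E (Suc r) = (\<Sum>u<2 * 2 ^ r. cnj (\<zeta> ^ (2 ^ (m - Suc r) * u * j)) * G (2 ^ (m - Suc r) * u))"
      by (simp add: E_def)
    also have "\<dots> = (\<Sum>l<2 ^ r. cnj (\<zeta> ^ (2 ^ (m - Suc r) * (2 * l) * j)) * G (2 ^ (m - Suc r) * (2 * l)))
        + T (Suc r) j"
      by (subst sum_lessThan_mult_residues) (simp_all add: two T_def)
    also have "\<dots> = E r + T (Suc r) j" unfolding e E_def ..
    finally show ?case using Suc by (simp add: add.assoc)
  qed
  from this[of m] show ?thesis using \<eta>_eq_sum_G[OF assms] by (simp add: E_def)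
qed

lemma T_1: "T 1 j = (-1) ^ j * G (2 ^ (m - 1))"
proof -
  have "cnj (\<zeta> ^ (2 ^ (m - 1) * j)) = (-1) ^ j" by (simp only: power_mult \<zeta>_half) simp
  then show ?thesis by (simp add: T_def)
qed

text \<open>Odd multiples of \<open>i\<close> that are 1 mod 4 all share the Gauss sum
  \<open>G i\<close>, leaving a geometric sum of phases; those that are 3 mod 4 contribute the
  complex conjugate.\<close>

lemma T_eq:
  assumes "2 \<le> r" "r \<le> m"
  defines "i \<equiv> 2 ^ (m - r)"
  shows "T r j = of_real (2 * Re (G i * cnj (\<zeta> ^ (i * j) * (\<Sum>k<2 ^ (r - 2). (\<zeta> ^ (4 * i * j)) ^ k))))"
proof -
  define n :: nat where "n = 2 ^ (r - 2)"
  have i4n: "i * (4 * n) = 2 ^ m"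
  proof -
    have "4 * n = 2 ^ r" unfolding n_def by (simp add: two_power_minus_two(1)[OF assms(1)])
    then show ?thesis using assms by (simp add: i_def flip: power_add)
  qed
  have two: "{..<2::nat} = {0, 1}" by auto
  have r2: "(2::nat) ^ (r - 1) = 2 * n" unfolding n_def by (rule two_power_minus_two(2)[OF assms(1)])
  define S where "S = (\<Sum>k<n. cnj (\<zeta> ^ (i * (1 + 4 * k) * j)) * G (i * (1 + 4 * k)))"
  have "T r j = S + (\<Sum>k<n. cnj (\<zeta> ^ (i * (3 + 4 * k) * j)) * G (i * (3 + 4 * k)))"
    unfolding T_def r2 i_def[symmetric] S_def
    by (subst sum_lessThan_mult_residues) (simp_all add: two distrib_left mult.commute[of i 3])
  \<comment> \<open>Reversing the order of summation pairs each index with one that complements it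
    to 2^m, i.e. with the inverse character.\<close>
  also have "(\<Sum>k<n. cnj (\<zeta> ^ (i * (3 + 4 * k) * j)) * G (i * (3 + 4 * k))) = cnj S"
  proof -
    have "(\<Sum>k<n. cnj (\<zeta> ^ (i * (3 + 4 * k) * j)) * G (i * (3 + 4 * k)))
        = (\<Sum>k<n. cnj (\<zeta> ^ (i * (3 + 4 * (n - Suc k)) * j)) * G (i * (3 + 4 * (n - Suc k))))"
      by (rule sum.nat_diff_reindex[symmetric])
    also have "\<dots> = cnj S" unfolding S_def cnj_sum
    proof (rule sum.cong[OF refl])
      fix k assume "k \<in> {..<n}"
      then have "1 + 4 * k + (3 + 4 * (n - Suc k)) = 4 * n" by auto
      then have e: "i * (1 + 4 * k) + i * (3 + 4 * (n - Suc k)) = 2 ^ m"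
        by (simp only: distrib_left[symmetric] i4n)
      have "\<zeta> ^ (i * (1 + 4 * k) * j) * \<zeta> ^ (i * (3 + 4 * (n - Suc k)) * j) = 1"
        by (simp only: power_add[symmetric] distrib_right[symmetric] e) (simp add: \<zeta>_power)
      moreover have "\<zeta> ^ (i * (1 + 4 * k) * j) * cnj (\<zeta> ^ (i * (1 + 4 * k) * j)) = 1"
        by (simp only: complex_norm_square[symmetric]) (simp add: norm_power norm_\<zeta>)
      ultimately have "\<zeta> ^ (i * (3 + 4 * (n - Suc k)) * j) = cnj (\<zeta> ^ (i * (1 + 4 * k) * j))"
        by (metis mult_left_cancel mult_zero_left zero_neq_one)
      moreover have "G (i * (3 + 4 * (n - Suc k))) = cnj (G (i * (1 + 4 * k)))"
        by (rule G_cnj) (simp only: e dvd_refl)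
      ultimately show "cnj (\<zeta> ^ (i * (3 + 4 * (n - Suc k)) * j)) * G (i * (3 + 4 * (n - Suc k)))
          = cnj (cnj (\<zeta> ^ (i * (1 + 4 * k) * j)) * G (i * (1 + 4 * k)))" by (simp only: complex_cnj_mult)
    qed
    finally show ?thesis .
  qed
  also have "S + cnj S = of_real (2 * Re S)" by (simp add: complex_eq_iff)
  also have "S = G i * cnj (\<zeta> ^ (i * j) * (\<Sum>k<n. (\<zeta> ^ (4 * i * j)) ^ k))"
  proof -
    have "G (i * (1 + 4 * k)) = G i" for k by (rule G_mult_1_mod_4) presburger
    moreover have "\<zeta> ^ (i * (1 + 4 * k) * j) = \<zeta> ^ (i * j) * (\<zeta> ^ (4 * i * j)) ^ k" for k
      by (simp add: algebra_simps flip: power_mult power_add)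
    ultimately show ?thesis unfolding S_def by (simp add: sum_distrib_left mult_ac)
  qed
  finally show ?thesis unfolding n_def .
qed

text \<open>The geometric sum of phases runs over a full period of a nontrivial root of
  unity.\<close>

lemma T_not_dvd:
  assumes "2 \<le> r" "r \<le> m" "\<not> 2 ^ (r - 2) dvd j"
  shows "T r j = 0"
proof -
  define i :: nat where "i = 2 ^ (m - r)"
  have i4: "4 * i * 2 ^ (r - 2) = 2 ^ m"
  proof -
    have "m = 2 + (m - r) + (r - 2)" using assms by simp
    then have "(2::nat) ^ m = 2 ^ 2 * 2 ^ (m - r) * 2 ^ (r - 2)" by (metis power_add)
    then show ?thesis by (simp add: i_def)
  qed
  have "\<zeta> ^ (4 * i * j) \<noteq> 1"
  proof
    assume "\<zeta> ^ (4 * i * j) = 1"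
    then have "4 * i * 2 ^ (r - 2) dvd 4 * i * j" by (simp only: i4 \<zeta>_power)
    then show False using assms(3) by (simp add: i_def)
  qed
  moreover have "(\<zeta> ^ (4 * i * j)) ^ 2 ^ (r - 2) = 1"
  proof -
    have "4 * i * j * 2 ^ (r - 2) = 2 ^ m * j" by (simp only: i4[symmetric] mult_ac)
    then show ?thesis by (simp only: power_mult[symmetric] \<zeta>_power dvd_triv_left)
  qed
  ultimately show ?thesis using assms by (simp add: T_eq i_def[symmetric] geometric_sum)
qed

lemma T_dvd:
  assumes "2 \<le> r" "r \<le> m"
  shows "T r (2 ^ (r - 2) * l) = of_real (2 ^ (r - 1) * Re (G (2 ^ (m - r)) * cnj (\<i> ^ l)))"
proof -
  define i :: nat where "i = 2 ^ (m - r)"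
  have ir: "i * 2 ^ (r - 2) = 2 ^ (m - 2)" using assms by (simp add: i_def flip: power_add)
  have "\<zeta> ^ (i * (2 ^ (r - 2) * l)) = \<i> ^ l"
    by (simp only: mult.assoc[symmetric] ir power_mult \<zeta>_quarter)
  moreover have "\<zeta> ^ (4 * i * (2 ^ (r - 2) * l)) = 1"
  proof -
    have "4 * i * (2 ^ (r - 2) * l) = 2 ^ (m - 2) * (4 * l)" by (simp only: ir[symmetric] mult_ac)
    then have "\<zeta> ^ (4 * i * (2 ^ (r - 2) * l)) = \<i> ^ (4 * l)" by (simp only: power_mult \<zeta>_quarter)
    then show ?thesis by (simp add: power_mult)
  qed
  ultimately have "T r (2 ^ (r - 2) * l) = of_real (2 * Re (of_nat (2 ^ (r - 2)) * (G i * cnj (\<i> ^ l))))"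
    unfolding T_eq[OF assms] i_def[symmetric] by (simp only: power_one) (simp add: mult_ac)
  also have "of_nat (2 ^ (r - 2)) = complex_of_real (2 ^ (r - 2))" by simp
  also have "2 * Re (complex_of_real (2 ^ (r - 2)) * (G i * cnj (\<i> ^ l))) = 2 ^ (r - 1) * Re (G i * cnj (\<i> ^ l))"
    by (simp add: two_power_minus_two(2)[OF assms(1), simplified] algebra_simps del: complex_cnj_power complex_cnj_i)
  finally show ?thesis by (simp only: i_def)
qed

lemma T_le:
  assumes "2 \<le> r" "r \<le> m" "2 ^ r dvd j"
  shows "T r j = of_real (2 ^ (r - 1) * Re (G (2 ^ (m - r))))"
proof -
  obtain l where l: "j = 2 ^ r * l" using assms by blast
  have "(2::nat) ^ r = 2 ^ (r - 2) * 4" by (rule two_power_minus_two(1)[OF assms(1)])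
  then have "T r j = of_real (2 ^ (r - 1) * Re (G (2 ^ (m - r)) * cnj (\<i> ^ (4 * l))))"
    using T_dvd[OF assms(1,2), of "4 * l"] by (simp add: l mult.assoc)
  then show ?thesis by (simp add: power_mult)
qed

lemma T_half:
  assumes "2 \<le> r" "r \<le> m" "odd w"
  shows "T r (2 ^ (r - 1) * w) = of_real (- (2 ^ (r - 1) * Re (G (2 ^ (m - r)))))"
proof -
  have "(2::nat) ^ (r - 1) = 2 ^ (r - 2) * 2" by (subst two_power_minus_two(2)[OF assms(1)]) simp
  then have "T r (2 ^ (r - 1) * w) = of_real (2 ^ (r - 1) * Re (G (2 ^ (m - r)) * cnj (\<i> ^ (2 * w))))"
    using T_dvd[OF assms(1,2), of "2 * w"] by (simp add: mult.assoc)
  then show ?thesis using assms(3) by (simp add: power_mult)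
qed

lemma T_quarter:
  assumes "2 \<le> r" "r \<le> m"
  shows "T r (2 ^ (r - 2) * (4 * k + 1)) = of_real (2 ^ (r - 1) * Im (G (2 ^ (m - r))))"
    and "T r (2 ^ (r - 2) * (4 * k + 3)) = of_real (- (2 ^ (r - 1) * Im (G (2 ^ (m - r)))))"
proof -
  have "\<i> ^ (4 * k + 1) = \<i>" by (simp add: power_mult)
  moreover have "\<i> ^ (4 * k + 3) = - \<i>" by (simp add: power_add power_mult power3_eq_cube)
  ultimately show "T r (2 ^ (r - 2) * (4 * k + 1)) = of_real (2 ^ (r - 1) * Im (G (2 ^ (m - r))))"
    "T r (2 ^ (r - 2) * (4 * k + 3)) = of_real (- (2 ^ (r - 1) * Im (G (2 ^ (m - r)))))"
    unfolding T_dvd[OF assms] by (simp_all only: complex_cnj_minus complex_cnj_i) simp_all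
qed

text \<open>The contribution of the orders 4, ..., 2^t to any period whose index is divisible by
  2^t.\<close>

definition \<mu> :: "nat \<Rightarrow> real" where "\<mu> t = (\<Sum>r = 2..t. 2 ^ (r - 1) * Re (G (2 ^ (m - r))))"

lemma sum_T_low:
  assumes "2 ^ t dvd j" "t \<le> m"
  shows "(\<Sum>r = 2..t. T r j) = of_real (\<mu> t)"
  unfolding \<mu>_def of_real_sum
proof (rule sum.cong[OF refl])
  fix r assume r: "r \<in> {2..t}"
  have "2 ^ r dvd j" using r by (intro dvd_trans[OF _ assms(1)] le_imp_power_dvd) auto
  then show "T r j = complex_of_real (2 ^ (r - 1) * Re (G (2 ^ (m - r))))"
    using r assms(2) by (intro T_le) auto
qed

lemma \<eta>_0: "\<eta> 0 = of_real (Re (G (2 ^ (m - 1))) + \<mu> m)" if "Im (G (2 ^ (m - 1))) = 0"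
proof -
  have "\<eta> 0 = T 1 0 + (\<Sum>r = 2..m. T r 0)"
    using m_ge_2 by (subst \<eta>_eq_sum_T) (simp_all add: sum.atLeast_Suc_atMost numeral_2_eq_2)
  then show ?thesis using that by (simp add: T_1[unfolded One_nat_def] sum_T_low complex_eq_iff)
qed

lemma \<eta>_half:
  assumes "Im (G (2 ^ (m - 1))) = 0"
  shows "\<eta> (2 ^ (m - 1)) = of_real (Re (G (2 ^ (m - 1))) + \<mu> (m - 1) - 2 ^ (m - 1) * Re (G (2 ^ (m - m))))"
proof -
  have e: "even ((2::nat) ^ (m - 1))" using m_ge_2 by simp
  have "\<eta> (2 ^ (m - 1)) = T 1 (2 ^ (m - 1)) + (\<Sum>r = 2..m. T r (2 ^ (m - 1)))"
    using m_ge_2 by (subst \<eta>_eq_sum_T) (simp_all add: sum.atLeast_Suc_atMost numeral_2_eq_2)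
  also have "(\<Sum>r = 2..m. T r (2 ^ (m - 1))) = (\<Sum>r = 2..m - 1. T r (2 ^ (m - 1))) + T m (2 ^ (m - 1) * 1)"
  proof -
    obtain k where k: "m = Suc (Suc k)" using m_ge_2 by (metis add_2_eq_Suc le_Suc_ex)
    then have "{2..m} = insert m {2..m - 1}" by auto
    then show ?thesis by (simp add: k add.commute)
  qed
  also have "T m (2 ^ (m - 1) * 1) = of_real (- (2 ^ (m - 1) * Re (G (2 ^ (m - m)))))"
    using m_ge_2 by (intro T_half) auto
  also have "(\<Sum>r = 2..m - 1. T r (2 ^ (m - 1))) = of_real (\<mu> (m - 1))"
    by (rule sum_T_low) auto
  finally show ?thesis using assms e by (simp only: T_1) (simp add: complex_eq_iff)
qed

text \<open>For an index of exact valuation t, orders up to 2^t have trivial phase, order 2^(t+1)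
  has phase -1, order 2^(t+2) has phase i or -i, and higher orders cancel.\<close>

lemma \<eta>_two_adic:
  assumes "Im (G (2 ^ (m - 1))) = 0" "1 \<le> t" "t \<le> m - 2" "k < 2 ^ (m - t - 2)"
  shows "\<eta> (2 ^ t * (4 * k + 1)) = of_real (Re (G (2 ^ (m - 1))) + \<mu> t - 2 ^ t * Re (G (2 ^ (m - (t + 1))))
           + 2 ^ (t + 1) * Im (G (2 ^ (m - (t + 2)))))"
    and "\<eta> (2 ^ t * (4 * k + 3)) = of_real (Re (G (2 ^ (m - 1))) + \<mu> t - 2 ^ t * Re (G (2 ^ (m - (t + 1))))
           - 2 ^ (t + 1) * Im (G (2 ^ (m - (t + 2)))))"
proof -
  have gen: "\<eta> (2 ^ t * w) = of_real (Re (G (2 ^ (m - 1))) + \<mu> t - 2 ^ t * Re (G (2 ^ (m - (t + 1))))) + T (t + 2) (2 ^ t * w)"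
    if w: "odd w" "w < 2 ^ (m - t)" for w
  proof -
    define j where "j = 2 ^ t * w"
    have "j < 2 ^ t * 2 ^ (m - t)" unfolding j_def using w(2) by simp
    then have "j < 2 ^ m" using assms by (simp flip: power_add)
    then have "\<eta> j = T 1 j + (\<Sum>r = 2..m. T r j)"
      using m_ge_2 by (subst \<eta>_eq_sum_T) (simp_all add: sum.atLeast_Suc_atMost numeral_2_eq_2)
    also have "(\<Sum>r = 2..m. T r j) = (\<Sum>r\<in>{2..t} \<union> {t + 1, t + 2}. T r j)"
    proof (rule sum.mono_neutral_right)
      show "\<forall>r\<in>{2..m} - ({2..t} \<union> {t + 1, t + 2}). T r j = 0"
      proof
        fix r assume r: "r \<in> {2..m} - ({2..t} \<union> {t + 1, t + 2})"
        then have rt: "r - 2 \<ge> t + 1" by auto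
        have "\<not> 2 ^ (r - 2) dvd j"
        proof
          assume "2 ^ (r - 2) dvd j"
          then have "2 ^ (t + 1) dvd j" using rt dvd_trans le_imp_power_dvd by blast
          then have "2 ^ t * 2 dvd 2 ^ t * w" by (simp add: j_def mult.commute)
          then show False using w(1) by (simp only: nat_mult_dvd_cancel_disj) simp
        qed
        then show "T r j = 0" using r by (intro T_not_dvd) auto
      qed
    qed (use assms in auto)
    also have "\<dots> = (\<Sum>r = 2..t. T r j) + (T (t + 1) j + T (t + 2) j)"
      by (subst sum.union_disjoint) auto
    also have "(\<Sum>r = 2..t. T r j) = of_real (\<mu> t)"
      using assms by (intro sum_T_low) (auto simp: j_def)
    also have "T (t + 1) j = of_real (- (2 ^ t * Re (G (2 ^ (m - (t + 1))))))"
      using T_half[of "t + 1" w] assms w(1) by (simp add: j_def)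
    also have "T 1 j = of_real (Re (G (2 ^ (m - 1))))"
    proof -
      have "even j" using assms by (simp add: j_def)
      then show ?thesis using assms(1) by (simp only: T_1) (simp add: complex_eq_iff)
    qed
    finally show ?thesis by (simp add: j_def)
  qed
  have bound: "4 * k + 3 < 2 ^ (m - t)"
  proof -
    have "(2::nat) ^ (m - t) = 2 ^ (m - t - 2) * 4" using m_ge_2 assms by (intro two_power_minus_two(1)) simp
    then show ?thesis using assms(4) by simp
  qed
  show "\<eta> (2 ^ t * (4 * k + 1)) = of_real (Re (G (2 ^ (m - 1))) + \<mu> t - 2 ^ t * Re (G (2 ^ (m - (t + 1))))
           + 2 ^ (t + 1) * Im (G (2 ^ (m - (t + 2)))))"
    using gen[of "4 * k + 1"] T_quarter(1)[of "t + 2" k] bound assms by simp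
  show "\<eta> (2 ^ t * (4 * k + 3)) = of_real (Re (G (2 ^ (m - 1))) + \<mu> t - 2 ^ t * Re (G (2 ^ (m - (t + 1))))
           - 2 ^ (t + 1) * Im (G (2 ^ (m - (t + 2)))))"
    using gen[of "4 * k + 3"] T_quarter(2)[of "t + 2" k] bound assms by simp
qed

text \<open>Valuation 0 stands apart because here it is the quadratic character that has phase -1,
  turning -sqrt q into +sqrt q.\<close>

lemma \<eta>_odd:
  assumes "Im (G (2 ^ (m - 1))) = 0" "k < 2 ^ (m - 2)"
  shows "\<eta> (4 * k + 1) = of_real (- Re (G (2 ^ (m - 1))) + 2 * Im (G (2 ^ (m - 2))))"
    and "\<eta> (4 * k + 3) = of_real (- Re (G (2 ^ (m - 1))) - 2 * Im (G (2 ^ (m - 2))))"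
proof -
  have gen: "\<eta> w = of_real (- Re (G (2 ^ (m - 1)))) + T 2 w" if w: "odd w" "w < 2 ^ m" for w
  proof -
    have "\<eta> w = T 1 w + (\<Sum>r = 2..m. T r w)"
      using m_ge_2 w by (subst \<eta>_eq_sum_T) (simp_all add: sum.atLeast_Suc_atMost numeral_2_eq_2)
    also have "(\<Sum>r = 2..m. T r w) = (\<Sum>r\<in>{2}. T r w)"
    proof (rule sum.mono_neutral_right)
      show "\<forall>r\<in>{2..m} - {2}. T r w = 0"
      proof
        fix r assume r: "r \<in> {2..m} - {2}"
        have "\<not> 2 ^ (r - 2) dvd w"
        proof
          assume *: "2 ^ (r - 2) dvd w"
          have "(2::nat) dvd 2 ^ (r - 2)" using r by (intro dvd_power) auto
          then show False using * w(1) dvd_trans by blast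
        qed
        then show "T r w = 0" using r by (intro T_not_dvd) auto
      qed
    qed (use m_ge_2 in auto)
    finally show ?thesis using assms(1) w(1) by (simp only: T_1) (simp add: complex_eq_iff)
  qed
  have bound: "4 * k + 3 < 2 ^ m"
  proof -
    have "(2::nat) ^ m = 2 ^ (m - 2) * 4" using m_ge_2 by (rule two_power_minus_two(1))
    then show ?thesis using assms(2) by simp
  qed
  show "\<eta> (4 * k + 1) = of_real (- Re (G (2 ^ (m - 1))) + 2 * Im (G (2 ^ (m - 2))))"
    using gen[of "4 * k + 1"] T_quarter(1)[of 2 k] bound m_ge_2 by simp
  show "\<eta> (4 * k + 3) = of_real (- Re (G (2 ^ (m - 1))) - 2 * Im (G (2 ^ (m - 2))))"
    using gen[of "4 * k + 3"] T_quarter(2)[of 2 k] bound m_ge_2 by simp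
qed

end

section \<open>Evaluation of the Gauss sums\<close>

locale diagonal_field_squares = diagonal_field +
  fixes C D :: "nat \<Rightarrow> int"
  assumes CD: "\<And>r. 1 \<le> r \<Longrightarrow> r \<le> m \<Longrightarrow>
      real p powr (real s / 2 ^ (r - 1)) = of_int ((C r)\<^sup>2 + (D r)\<^sup>2)"
    and C_mod_4: "\<And>r. 1 \<le> r \<Longrightarrow> r \<le> m \<Longrightarrow> [C r = -1] (mod 4)"
    and C_coprime: "\<And>r. 1 \<le> r \<Longrightarrow> r \<le> m \<Longrightarrow> \<not> int p dvd C r"
begin

section \<open>Exponents and absolute values\<close>

definition sexp :: "nat \<Rightarrow> nat" where "sexp r = s div 2 ^ (r - 1)"

lemma s_eq_sexp: "1 \<le> r \<Longrightarrow> r \<le> m \<Longrightarrow> s = sexp r * 2 ^ (r - 1)"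
  using s_dvd unfolding sexp_def
  by (metis diff_le_mono dvd_div_mult_self dvd_trans le_imp_power_dvd)

lemma sexp_pos: "1 \<le> r \<Longrightarrow> r \<le> m \<Longrightarrow> sexp r > 0"
  using s_eq_sexp[of r] s_pos by (metis gr0I mult_0 less_irrefl)

lemma sexp_Suc:
  assumes "1 \<le> r" "r < m"
  shows "sexp r = sexp (Suc r) + sexp (Suc r)"
proof -
  have "sexp r * 2 ^ (r - 1) = sexp (Suc r) * 2 ^ (Suc r - 1)"
    using s_eq_sexp[of r] s_eq_sexp[of "Suc r"] assms by simp
  also have "(2::nat) ^ (Suc r - 1) = 2 * 2 ^ (r - 1)" using assms by (simp flip: power_Suc)
  finally show ?thesis by simp
qed

lemma CD_power:
  assumes "1 \<le> r" "r \<le> m"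
  shows "(C r)\<^sup>2 + (D r)\<^sup>2 = int p ^ sexp r"
proof -
  have "real s = real (sexp r) * 2 ^ (r - 1)"
    using arg_cong[OF s_eq_sexp[OF assms], of real] by simp
  then have "real s / 2 ^ (r - 1) = real (sexp r)" by simp
  then have "of_int ((C r)\<^sup>2 + (D r)\<^sup>2) = real p powr real (sexp r)" using CD[OF assms] by simp
  also have "\<dots> = of_int (int p ^ sexp r)" using p_ge_5 by (simp add: powr_realpow)
  finally show ?thesis by (simp only: of_int_eq_iff)
qed

lemma C_odd: "1 \<le> r \<Longrightarrow> r \<le> m \<Longrightarrow> odd (C r)"
  using C_mod_4[of r] unfolding cong_def by presburger

lemma D_even:
  assumes "1 \<le> r" "r \<le> m"
  shows "even (D r)"
proof -
  have "odd ((C r)\<^sup>2 + (D r)\<^sup>2)" unfolding CD_power[OF assms] using p_odd by simp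
  then show ?thesis using C_odd[OF assms] by simp
qed

text \<open>The exponent is 1/2 - 1/2^r, the gap between the absolute value q^(1/2) of a Gauss sum
  and the absolute value q^(1/2^r) of C_r + D_r i.\<close>

definition R :: "nat \<Rightarrow> real" where "R r = real q powr ((2 ^ (r - 1) - 1) / 2 ^ r)"

text \<open>\<open>R r\<close> may involve sqrt p when \<open>r = m\<close>; only its square is
  certain to be an odd integer, which is why the parity obstruction concerns the square of the
  imaginary part.\<close>

lemma R_square:
  assumes "1 \<le> r" "r \<le> m"
  shows "(R r)\<^sup>2 = of_int (int p ^ (sexp r * (2 ^ (r - 1) - 1)))"
proof -
  have "(R r)\<^sup>2 = real q powr ((2 ^ (r - 1) - 1) / 2 ^ r + (2 ^ (r - 1) - 1) / 2 ^ r)"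
    by (simp only: R_def powr_add power2_eq_square)
  also have "real q = real p powr (real (sexp r) * 2 ^ (r - 1))"
  proof -
    have "real q = real p powr real s" using p_ge_5 by (simp add: powr_realpow)
    also have "real s = real (sexp r) * 2 ^ (r - 1)"
      using arg_cong[OF s_eq_sexp[OF assms], of real] by simp
    finally show ?thesis .
  qed
  also have "(real p powr (real (sexp r) * 2 ^ (r - 1))) powr ((2 ^ (r - 1) - 1) / 2 ^ r + (2 ^ (r - 1) - 1) / 2 ^ r)
      = real p powr real (sexp r * (2 ^ (r - 1) - 1))"
  proof -
    have "2 ^ r = 2 * (2::real) ^ (r - 1)" using assms by (simp flip: power_Suc)
    then have "real (sexp r) * 2 ^ (r - 1) * ((2 ^ (r - 1) - 1) / 2 ^ r + (2 ^ (r - 1) - 1) / 2 ^ r)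
        = real (sexp r * (2 ^ (r - 1) - 1))"
      by (simp add: of_nat_diff field_simps)
    then show ?thesis by (simp only: powr_powr)
  qed
  also have "\<dots> = of_int (int p ^ (sexp r * (2 ^ (r - 1) - 1)))"
    using p_ge_5 by (subst powr_realpow) simp_all
  finally show ?thesis .
qed

lemma sqrt_q: "real q powr (1 / 2) = real (p ^ (s div 2))"
proof -
  have "real q = real p powr real s" using p_ge_5 by (simp add: powr_realpow)
  then have "real q powr (1 / 2) = real p powr (real s * (1 / 2))" by (simp only: powr_powr)
  also have "real s * (1 / 2) = real (s div 2)" using s_even by auto
  finally show ?thesis using p_ge_5 by (simp add: powr_realpow)
qed

lemma G_quadratic_powr: "G (2 ^ (m - 1)) = - complex_of_real (real q powr (1 / 2))"
  unfolding G_quadratic sqrt_q by simp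

lemma R_Suc:
  assumes "1 \<le> r"
  shows "real q powr (1 / 2) * R r = (R (Suc r))\<^sup>2"
proof -
  obtain k where k: "r = Suc k" using assms by (metis Suc_le_D One_nat_def)
  have "(1::real) / 2 + (2 ^ (r - 1) - 1) / 2 ^ r = (2 ^ (Suc r - 1) - 1) / 2 ^ Suc r + (2 ^ (Suc r - 1) - 1) / 2 ^ Suc r"
    by (simp add: k field_simps)
  then show ?thesis unfolding R_def power2_eq_square powr_add[symmetric] by simp
qed

text \<open>Real and imaginary part of the square of C_r + D_r i, prepared for the uniqueness lemma.
  The residue 1 mod 4 of the real part is what later decides signs.\<close>

lemma sum_two_squares_square:
  assumes "1 \<le> r" "r \<le> m"
  shows "((C r)\<^sup>2 - (D r)\<^sup>2)\<^sup>2 + (2 * C r * D r)\<^sup>2 = int p ^ (sexp r + sexp r)"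
    and "odd ((C r)\<^sup>2 - (D r)\<^sup>2)" and "\<not> int p dvd (C r)\<^sup>2 - (D r)\<^sup>2"
    and "((C r)\<^sup>2 - (D r)\<^sup>2) mod 4 = 1"
proof -
  have "((C r)\<^sup>2 - (D r)\<^sup>2)\<^sup>2 + (2 * C r * D r)\<^sup>2 = ((C r)\<^sup>2 + (D r)\<^sup>2)\<^sup>2"
    by (simp add: power2_eq_square algebra_simps)
  then show "((C r)\<^sup>2 - (D r)\<^sup>2)\<^sup>2 + (2 * C r * D r)\<^sup>2 = int p ^ (sexp r + sexp r)"
    by (simp only: CD_power[OF assms] power2_eq_square[of "int p ^ _"] power_add)
  show "odd ((C r)\<^sup>2 - (D r)\<^sup>2)" using C_odd[OF assms] D_even[OF assms] by simp
  show "((C r)\<^sup>2 - (D r)\<^sup>2) mod 4 = 1"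
  proof -
    obtain c where "C r = 2 * c + 1" using C_odd[OF assms] by (rule oddE)
    moreover obtain d where "D r = 2 * d" using D_even[OF assms] by (rule evenE)
    ultimately have "(C r)\<^sup>2 - (D r)\<^sup>2 = 4 * (c * c + c - d * d) + 1" by (simp add: power2_eq_square algebra_simps)
    then show ?thesis by presburger
  qed
  show "\<not> int p dvd (C r)\<^sup>2 - (D r)\<^sup>2"
  proof
    assume "int p dvd (C r)\<^sup>2 - (D r)\<^sup>2"
    moreover have "int p dvd (C r)\<^sup>2 + (D r)\<^sup>2"
      unfolding CD_power[OF assms] using sexp_pos[OF assms] by simp
    ultimately have "int p dvd ((C r)\<^sup>2 - (D r)\<^sup>2) + ((C r)\<^sup>2 + (D r)\<^sup>2)" by (rule dvd_add)
    then have "int p dvd 2 * (C r)\<^sup>2" by simp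
    moreover have "\<not> int p dvd 2" using p_ge_5 zdvd_imp_le[of "int p" 2] by auto
    moreover have "prime (int p)" using prime_p by simp
    ultimately show False using C_coprime[OF assms] by (simp add: prime_dvd_mult_iff prime_dvd_power_iff)
  qed
qed

text \<open>If the sign were -1, the imaginary part of the Gauss sum would be, up to sign,
  \<open>R r * C r\<close>, whose square is an odd integer; the parity obstruction forbids
  this.\<close>

lemma G_square_root:
  assumes r: "1 \<le> r" "r \<le> m" and \<epsilon>: "\<epsilon> = 1 \<or> \<epsilon> = -1"
    and sq: "(G i)\<^sup>2 = of_int \<epsilon> * (of_real (R r) * Complex (of_int (C r)) (of_int d))\<^sup>2"
  shows "\<epsilon> = 1" and "\<exists>\<epsilon>'. (\<epsilon>' = 1 \<or> \<epsilon>' = -1) \<and>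
    G i = of_int \<epsilon>' * (of_real (R r) * Complex (of_int (C r)) (of_int d))"
proof -
  let ?z = "of_real (R r) * Complex (of_int (C r)) (of_int d)"
  show "\<epsilon> = 1"
  proof (rule ccontr)
    assume "\<epsilon> \<noteq> 1"
    then have "(G i)\<^sup>2 = (\<i> * ?z)\<^sup>2" using sq \<epsilon> by (simp add: power_mult_distrib)
    then have "G i = \<i> * ?z \<or> G i = - (\<i> * ?z)" by (simp only: power2_eq_iff)
    then have "(Im (G i))\<^sup>2 = (R r)\<^sup>2 * (of_int (C r))\<^sup>2" by (auto simp: power_mult_distrib)
    also have "\<dots> = of_int (int p ^ (sexp r * (2 ^ (r - 1) - 1)) * (C r)\<^sup>2)"
      unfolding R_square[OF r] by simp
    finally have "even (int p ^ (sexp r * (2 ^ (r - 1) - 1)) * (C r)\<^sup>2)" by (rule Im_G_square_not_odd)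
    then show False using C_odd[OF r] p_odd by simp
  qed
  with sq have "G i = ?z \<or> G i = - ?z" by (simp add: power2_eq_iff)
  then show "\<exists>\<epsilon>'. (\<epsilon>' = 1 \<or> \<epsilon>' = -1) \<and> G i = of_int \<epsilon>' * ?z"
    by (metis mult_1 mult_minus_left of_int_1 of_int_minus)
qed

text \<open>\<open>\<epsilon>\<close> is the sign to be determined; \<open>\<delta>\<close> absorbs
  both the free choice of sign of \<open>D r\<close> and the passage to the conjugate.\<close>

definition G_form :: "nat \<Rightarrow> int \<Rightarrow> int \<Rightarrow> bool" where
  "G_form r \<epsilon> \<delta> \<longleftrightarrow> (\<epsilon> = 1 \<or> \<epsilon> = -1) \<and> (\<delta> = 1 \<or> \<delta> = -1) \<and>
     G (2 ^ (m - r)) = of_int \<epsilon> * (of_real (R r) * Complex (of_int (C r)) (of_int (\<delta> * D r)))"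

text \<open>Uniqueness identifies the quartic Jacobi sum with the square of C_2 + D_2 i up to
  conjugation and a sign \<open>\<alpha>\<close>. That sign stays open here, since
  \<open>G_square_root\<close> accepts either one.\<close>

lemma G_form_2: "\<exists>\<epsilon> \<delta>. G_form 2 \<epsilon> \<delta>"
proof -
  have r: "1 \<le> (2::nat)" "2 \<le> m" using m_ge_2 by auto
  define i :: nat where "i = 2 ^ (m - 2)"
  obtain a b where ab: "J i i = Complex (of_int a) (of_int b)" "odd a" "a\<^sup>2 + b\<^sup>2 = int q" "\<not> int p dvd a"
    using J_quartic unfolding i_def by blast
  have "sexp 2 + sexp 2 = s" using s_eq_sexp[OF r] by simp
  then have ab': "a\<^sup>2 + b\<^sup>2 = int p ^ (sexp 2 + sexp 2)" using ab by simp
  note U = sum_two_squares_prime_power_unique[OF prime_p p_odd ab' sum_two_squares_square(1)[OF r] ab(4)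
      sum_two_squares_square(3)[OF r] ab(2) sum_two_squares_square(2)[OF r]]
  obtain \<alpha> where \<alpha>: "\<alpha> = 1 \<or> \<alpha> = -1" "a = \<alpha> * ((C 2)\<^sup>2 - (D 2)\<^sup>2)" using abs_eq_sign[OF U(1)] by blast
  obtain \<beta> where \<beta>: "\<beta> = 1 \<or> \<beta> = -1" "b = \<beta> * (2 * C 2 * D 2)" using abs_eq_sign[OF U(2)] by blast
  define \<delta> where "\<delta> = \<alpha> * \<beta>"
  have \<delta>: "\<delta> = 1 \<or> \<delta> = -1" using \<alpha> \<beta> by (auto simp: \<delta>_def)
  let ?Z = "Complex (of_int (C 2)) (of_int (\<delta> * D 2))"
  have J: "J i i = of_int \<alpha> * ?Z\<^sup>2"
    unfolding Complex_square[OF \<delta>] unfolding ab(1) \<alpha>(2) \<beta>(2) \<delta>_def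
    using \<alpha>(1) by (auto simp: complex_eq_iff)
  have "2 ^ (m - 1) = 2 * i" using m_ge_2 unfolding i_def by (metis Suc_diff_le diff_Suc_Suc numeral_2_eq_2 power_Suc One_nat_def)
  then have i2: "i + i = 2 ^ (m - 1)" by simp
  have ni2: "\<not> 2 ^ m dvd i + i" unfolding i2 using m_ge_2 by (intro nat_dvd_not_less) auto
  have "(G i)\<^sup>2 = J i i * G (2 ^ (m - 1))" using G_mult[OF ni2] by (simp add: power2_eq_square i2)
  also have "\<dots> = of_int (- \<alpha>) * (of_real (real q powr (1 / 2)) * ?Z\<^sup>2)" unfolding J G_quadratic_powr by simp
  also have "real q powr (1 / 2) = (R 2)\<^sup>2"
    using R_Suc[of 1] p_ge_5 by (simp add: R_def numeral_2_eq_2)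
  finally have "(G i)\<^sup>2 = of_int (- \<alpha>) * (of_real (R 2) * ?Z)\<^sup>2" by (simp add: power_mult_distrib)
  moreover have "- \<alpha> = 1 \<or> - \<alpha> = -1" using \<alpha>(1) by auto
  ultimately obtain \<epsilon> where "\<epsilon> = 1 \<or> \<epsilon> = -1" "G i = of_int \<epsilon> * (of_real (R 2) * ?Z)"
    using G_square_root(2)[OF r] by blast
  then show ?thesis using \<delta> unfolding G_form_def i_def by blast
qed

text \<open>The congruence of \<open>C r\<close> pins down the minus sign in \<open>Z\<close>, which
  cancels that of the quadratic Gauss sum. The unknown \<open>\<epsilon>\<close> is then the sign
  tested by \<open>G_square_root\<close>.\<close>

lemma G_form_Suc:
  assumes r: "2 \<le> r" "r < m" and form: "G_form r \<epsilon> \<delta>"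
  shows "\<epsilon> = 1" and "\<exists>\<epsilon>' \<delta>'. G_form (Suc r) \<epsilon>' \<delta>'"
proof -
  have r1: "1 \<le> r" "r \<le> m" and r2: "1 \<le> Suc r" "Suc r \<le> m" using r by auto
  let ?c = "C (Suc r)" and ?d = "D (Suc r)"
  have CDr: "(C r)\<^sup>2 + (D r)\<^sup>2 = int p ^ (sexp (Suc r) + sexp (Suc r))"
    using CD_power[OF r1] sexp_Suc[of r] r by simp
  note U = sum_two_squares_prime_power_unique[OF prime_p p_odd CDr sum_two_squares_square(1)[OF r2] C_coprime[OF r1]
      sum_two_squares_square(3)[OF r2] C_odd[OF r1] sum_two_squares_square(2)[OF r2]]
  have "C r mod 4 = 3" using C_mod_4[OF r1] by (simp add: cong_def)
  then have Cr: "C r = - (?c\<^sup>2 - ?d\<^sup>2)"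
    using U(1) sum_two_squares_square(4)[OF r2] unfolding abs_eq_iff by presburger
  obtain \<beta> where \<beta>: "\<beta> = 1 \<or> \<beta> = -1" "D r = \<beta> * (2 * ?c * ?d)" using abs_eq_sign[OF U(2)] by blast
  from form have \<epsilon>: "\<epsilon> = 1 \<or> \<epsilon> = -1" and \<delta>: "\<delta> = 1 \<or> \<delta> = -1"
    and Gr: "G (2 ^ (m - r)) = of_int \<epsilon> * (of_real (R r) * Complex (of_int (C r)) (of_int (\<delta> * D r)))"
    unfolding G_form_def by auto
  define \<delta>' where "\<delta>' = - (\<delta> * \<beta>)"
  have \<delta>': "\<delta>' = 1 \<or> \<delta>' = -1" using \<beta> \<delta> by (auto simp: \<delta>'_def)
  let ?Z = "Complex (of_int ?c) (of_int (\<delta>' * ?d))"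
  have Z: "Complex (of_int (C r)) (of_int (\<delta> * D r)) = - ?Z\<^sup>2"
    unfolding Complex_square[OF \<delta>'] unfolding Cr \<beta>(2) \<delta>'_def by (simp add: complex_eq_iff)
  have "(G (2 ^ (m - Suc r)))\<^sup>2 = G (2 ^ (m - 1)) * G (2 ^ (m - r))"
    using G_square_recursion[of "Suc r"] r by simp
  also have "\<dots> = of_int \<epsilon> * (of_real (real q powr (1 / 2) * R r) * ?Z\<^sup>2)"
    unfolding Gr Z G_quadratic_powr by simp
  also have "real q powr (1 / 2) * R r = (R (Suc r))\<^sup>2" using R_Suc[OF r1(1)] .
  finally have "(G (2 ^ (m - Suc r)))\<^sup>2 = of_int \<epsilon> * (of_real (R (Suc r)) * ?Z)\<^sup>2" by (simp add: power_mult_distrib)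
  note * = G_square_root[OF r2 \<epsilon> this]
  show "\<epsilon> = 1" by (rule *(1))
  show "\<exists>\<epsilon>' \<delta>'. G_form (Suc r) \<epsilon>' \<delta>'" using *(2) \<delta>' unfolding G_form_def by blast
qed

lemma ex_G_form: "2 \<le> r \<Longrightarrow> r \<le> m \<Longrightarrow> \<exists>\<epsilon> \<delta>. G_form r \<epsilon> \<delta>"
proof (induction r rule: dec_induct)
  case base
  show ?case by (rule G_form_2)
next
  case (step r)
  then show ?case using G_form_Suc(2)[of r] by auto
qed

lemma Im_G:
  assumes "2 \<le> r" "r \<le> m"
  shows "Im (G (2 ^ (m - r))) = of_int (D r) * R r \<or> Im (G (2 ^ (m - r))) = - (of_int (D r) * R r)"
  using ex_G_form[OF assms] unfolding G_form_def by auto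

text \<open>The strict bound \<open>r < m\<close> is essential to the method: the sign at
  \<open>r\<close> is extracted from the square of the Gauss sum at \<open>r + 1\<close>.\<close>

lemma Re_G:
  assumes "2 \<le> r" "r < m"
  shows "Re (G (2 ^ (m - r))) = of_int (C r) * R r"
proof -
  obtain \<epsilon> \<delta> where f: "G_form r \<epsilon> \<delta>" using ex_G_form[of r] assms by auto
  then have "\<epsilon> = 1" using assms by (intro G_form_Suc(1))
  with f show ?thesis by (simp add: G_form_def)
qed

lemma Re_G_m:
  "Re (G (2 ^ (m - m))) = of_int (C m) * R m \<or> Re (G (2 ^ (m - m))) = - (of_int (C m) * R m)"
  using ex_G_form[of m] m_ge_2 unfolding G_form_def by auto

abbreviation h :: real where "h \<equiv> real q powr (1 / 2)"

text \<open>For \<open>t \<le> m - 2\<close> this is the common real part shared by the two periods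
  of valuation t; at \<open>t = m - 1\<close> it is the period at 0 or at 2^(m-1), according to the
  sign of G_m.\<close>

definition A :: "nat \<Rightarrow> real" where
  "A t = - h + (\<Sum>r = 2..t. 2 ^ (r - 1) * of_int (C r) * R r) - 2 ^ t * of_int (C (t + 1)) * R (t + 1)"

lemma sum_\<eta>_power:
  "(\<Sum>j<2 ^ m. \<eta> j ^ n) = of_real (
     2 ^ (m - 2) * ((h + 2 * of_int (D 2) * R 2) ^ n + (h - 2 * of_int (D 2) * R 2) ^ n)
     + (\<Sum>t = 1..m - 2. 2 ^ (m - t - 2) *
          ((A t + 2 ^ (t + 1) * of_int (D (t + 2)) * R (t + 2)) ^ n
         + (A t - 2 ^ (t + 1) * of_int (D (t + 2)) * R (t + 2)) ^ n))
     + A (m - 1) ^ n + (- h + (\<Sum>r = 2..m. 2 ^ (r - 1) * of_int (C r) * R r)) ^ n)"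
proof -
  have G1: "Re (G (2 ^ (m - 1))) = - h" "Im (G (2 ^ (m - 1))) = 0"
    unfolding G_quadratic_powr by simp_all
  \<comment> \<open>Sums of n-th powers over a pair a + c x, a - c x ignore the sign of x; this
    absorbs the unknown signs of the imaginary parts.\<close>
  have sym: "(a + c * x) ^ n + (a - c * x) ^ n = (a + c * y) ^ n + (a - c * y) ^ n"
    if "x = y \<or> x = - y" for a c x y :: real
    using that by (auto simp: add.commute)
  have \<mu>: "\<mu> t = (\<Sum>r = 2..t. 2 ^ (r - 1) * of_int (C r) * R r)" if "t < m" for t
    unfolding \<mu>_def by (rule sum.cong) (use that Re_G in \<open>auto simp: mult.assoc\<close>)
  have "(\<Sum>j<2 ^ m. \<eta> j ^ n) = (\<Sum>j<2 ^ (m - 2 + 2). \<eta> j ^ n)" using m_ge_2 by (simp only: le_add_diff_inverse2)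
  also have "\<dots> = (\<Sum>t = 0..m - 2. \<Sum>k<2 ^ (m - 2 - t). \<eta> (2 ^ t * (4 * k + 1)) ^ n + \<eta> (2 ^ t * (4 * k + 3)) ^ n)
      + \<eta> (2 ^ (m - 2 + 1)) ^ n + \<eta> 0 ^ n"
    by (rule sum_lessThan_two_power_two_adic)
  also have "(\<Sum>t = 0..m - 2. \<Sum>k<2 ^ (m - 2 - t). \<eta> (2 ^ t * (4 * k + 1)) ^ n + \<eta> (2 ^ t * (4 * k + 3)) ^ n)
    = (\<Sum>k<2 ^ (m - 2). \<eta> (4 * k + 1) ^ n + \<eta> (4 * k + 3) ^ n)
      + (\<Sum>t = 1..m - 2. \<Sum>k<2 ^ (m - 2 - t). \<eta> (2 ^ t * (4 * k + 1)) ^ n + \<eta> (2 ^ t * (4 * k + 3)) ^ n)"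
    by (subst sum.atLeast_Suc_atMost) simp_all
  also have "(\<Sum>k<2 ^ (m - 2). \<eta> (4 * k + 1) ^ n + \<eta> (4 * k + 3) ^ n)
    = of_real (2 ^ (m - 2) * ((h + 2 * of_int (D 2) * R 2) ^ n + (h - 2 * of_int (D 2) * R 2) ^ n))"
  proof -
    have "(\<Sum>k<2 ^ (m - 2). \<eta> (4 * k + 1) ^ n + \<eta> (4 * k + 3) ^ n)
      = (\<Sum>k<(2::nat) ^ (m - 2). of_real ((h + 2 * Im (G (2 ^ (m - 2)))) ^ n + (h - 2 * Im (G (2 ^ (m - 2)))) ^ n))"
    proof (rule sum.cong[OF refl])
      fix k assume "k \<in> {..<(2::nat) ^ (m - 2)}"
      then have k: "k < 2 ^ (m - 2)" by simp
      show "\<eta> (4 * k + 1) ^ n + \<eta> (4 * k + 3) ^ n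
        = of_real ((h + 2 * Im (G (2 ^ (m - 2)))) ^ n + (h - 2 * Im (G (2 ^ (m - 2)))) ^ n)"
        unfolding \<eta>_odd[OF G1(2) k] G1(1) by (simp only: of_real_power[symmetric] of_real_add[symmetric] minus_minus)
    qed
    also have "\<dots> = (\<Sum>k<(2::nat) ^ (m - 2). of_real ((h + 2 * (of_int (D 2) * R 2)) ^ n + (h - 2 * (of_int (D 2) * R 2)) ^ n))"
      using m_ge_2 by (subst sym[OF Im_G]) simp_all
    finally show ?thesis by (simp add: mult.assoc)
  qed
  also have "(\<Sum>t = 1..m - 2. \<Sum>k<2 ^ (m - 2 - t). \<eta> (2 ^ t * (4 * k + 1)) ^ n + \<eta> (2 ^ t * (4 * k + 3)) ^ n)
    = of_real (\<Sum>t = 1..m - 2. 2 ^ (m - t - 2) *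
          ((A t + 2 ^ (t + 1) * of_int (D (t + 2)) * R (t + 2)) ^ n
         + (A t - 2 ^ (t + 1) * of_int (D (t + 2)) * R (t + 2)) ^ n))"
    unfolding of_real_sum
  proof (rule sum.cong[OF refl])
    fix t assume "t \<in> {1..m - 2}"
    then have t: "1 \<le> t" "t \<le> m - 2" "t < m" "t + 1 < m" "t + 2 \<le> m" by auto
    have At: "Re (G (2 ^ (m - 1))) + \<mu> t - 2 ^ t * Re (G (2 ^ (m - (t + 1)))) = A t"
      unfolding A_def G1(1) \<mu>[OF t(3)] using Re_G[of "t + 1"] t by simp
    let ?I = "Im (G (2 ^ (m - (t + 2))))"
    have "(\<Sum>k<2 ^ (m - 2 - t). \<eta> (2 ^ t * (4 * k + 1)) ^ n + \<eta> (2 ^ t * (4 * k + 3)) ^ n)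
      = (\<Sum>k<(2::nat) ^ (m - t - 2). of_real ((A t + 2 ^ (t + 1) * ?I) ^ n + (A t - 2 ^ (t + 1) * ?I) ^ n))"
    proof (rule sum.cong)
      show "{..<(2::nat) ^ (m - 2 - t)} = {..<2 ^ (m - t - 2)}" by (simp add: diff_diff_add add.commute)
      fix k assume "k \<in> {..<(2::nat) ^ (m - t - 2)}"
      then have k: "k < 2 ^ (m - t - 2)" by simp
      show "\<eta> (2 ^ t * (4 * k + 1)) ^ n + \<eta> (2 ^ t * (4 * k + 3)) ^ n
        = of_real ((A t + 2 ^ (t + 1) * ?I) ^ n + (A t - 2 ^ (t + 1) * ?I) ^ n)"
        unfolding \<eta>_two_adic[OF G1(2) t(1,2) k] At by (simp only: of_real_power[symmetric] of_real_add[symmetric])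
    qed
    also have "(A t + 2 ^ (t + 1) * ?I) ^ n + (A t - 2 ^ (t + 1) * ?I) ^ n
      = (A t + 2 ^ (t + 1) * (of_int (D (t + 2)) * R (t + 2))) ^ n + (A t - 2 ^ (t + 1) * (of_int (D (t + 2)) * R (t + 2))) ^ n"
      using t by (intro sym Im_G) auto
    finally show "(\<Sum>k<2 ^ (m - 2 - t). \<eta> (2 ^ t * (4 * k + 1)) ^ n + \<eta> (2 ^ t * (4 * k + 3)) ^ n)
      = of_real (2 ^ (m - t - 2) * ((A t + 2 ^ (t + 1) * of_int (D (t + 2)) * R (t + 2)) ^ n
         + (A t - 2 ^ (t + 1) * of_int (D (t + 2)) * R (t + 2)) ^ n))"
      by (simp add: mult.assoc)
  qed
  also have "\<eta> (2 ^ (m - 2 + 1)) = of_real (- h + \<mu> (m - 1) - 2 ^ (m - 1) * Re (G (2 ^ (m - m))))"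
  proof -
    have "m - 2 + 1 = m - 1" using m_ge_2 by simp
    then show ?thesis using \<eta>_half[OF G1(2)] by (simp only: G1(1))
  qed
  also have "\<eta> 0 = of_real (- h + \<mu> (m - 1) + 2 ^ (m - 1) * Re (G (2 ^ (m - m))))"
  proof -
    have "{2..m} = insert m {2..m - 1}" "m \<notin> {2..m - 1}" using m_ge_2 by auto
    then have "\<mu> m = \<mu> (m - 1) + 2 ^ (m - 1) * Re (G (2 ^ (m - m)))" by (simp add: \<mu>_def)
    then show ?thesis using \<eta>_0[OF G1(2)] by (simp only: G1(1) add.assoc)
  qed
  finally have eq: "(\<Sum>j<2 ^ m. \<eta> j ^ n) = of_real (
     2 ^ (m - 2) * ((h + 2 * of_int (D 2) * R 2) ^ n + (h - 2 * of_int (D 2) * R 2) ^ n)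
     + (\<Sum>t = 1..m - 2. 2 ^ (m - t - 2) *
          ((A t + 2 ^ (t + 1) * of_int (D (t + 2)) * R (t + 2)) ^ n
         + (A t - 2 ^ (t + 1) * of_int (D (t + 2)) * R (t + 2)) ^ n))
     + ((- h + \<mu> (m - 1) + 2 ^ (m - 1) * Re (G (2 ^ (m - m)))) ^ n
       + (- h + \<mu> (m - 1) - 2 ^ (m - 1) * Re (G (2 ^ (m - m)))) ^ n))" (is "_ = of_real (?B + _)")
    by (simp only: of_real_power[symmetric] of_real_add[symmetric] add_ac)
  have sumC: "(\<Sum>r = 2..m. 2 ^ (r - 1) * of_int (C r) * R r) = \<mu> (m - 1) + 2 ^ (m - 1) * (of_int (C m) * R m)"
  proof -
    have "{2..m} = insert m {2..m - 1}" "m \<notin> {2..m - 1}" using m_ge_2 by auto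
    moreover have "m - 1 < m" using m_ge_2 by simp
    ultimately show ?thesis unfolding \<mu>[OF \<open>m - 1 < m\<close>] by (simp add: mult.assoc)
  qed
  have Am: "A (m - 1) = - h + \<mu> (m - 1) - 2 ^ (m - 1) * (of_int (C m) * R m)"
  proof -
    have m1: "m - 1 < m" "m - 1 + 1 = m" using m_ge_2 by simp_all
    show ?thesis unfolding A_def \<mu>[OF m1(1)] m1(2) by (simp only: mult.assoc)
  qed
  \<comment> \<open>The undetermined sign of G_m merely interchanges the periods at 0 and at
    2^(m-1), so \<open>sym\<close> applies once more.\<close>
  show ?thesis
    unfolding eq sym[OF Re_G_m] Am sumC by (simp only: add_ac)
qed

lemma diag_count_formula:
  assumes "n \<ge> 1"
  shows "real (diag_count n m TYPE('a)) = real q ^ (n - 1) + (real q - 1) / (2 ^ m * real q) *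
     (2 ^ (m - 2) * ((h + 2 * of_int (D 2) * R 2) ^ n + (h - 2 * of_int (D 2) * R 2) ^ n)
     + (\<Sum>t = 1..m - 2. 2 ^ (m - t - 2) *
          ((A t + 2 ^ (t + 1) * of_int (D (t + 2)) * R (t + 2)) ^ n
         + (A t - 2 ^ (t + 1) * of_int (D (t + 2)) * R (t + 2)) ^ n))
     + A (m - 1) ^ n + (- h + (\<Sum>r = 2..m. 2 ^ (r - 1) * of_int (C r) * R r)) ^ n)"
    (is "?N = _ + _ * ?S")
proof -
  have "complex_of_real (real q * ?N) = of_real (real q ^ n + real ((q - 1) div 2 ^ m) * ?S)"
    using diag_count_eq_periods[of n] unfolding sum_\<eta>_power by (simp only: of_real_add of_real_mult of_real_power of_real_of_nat_eq)
  then have eq: "real q * ?N = real q ^ n + real ((q - 1) div 2 ^ m) * ?S" by (simp only: of_real_eq_iff)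
  have U: "real ((q - 1) div 2 ^ m) = (real q - 1) / 2 ^ m"
  proof -
    have "real (q - 1) = 2 ^ m * real ((q - 1) div 2 ^ m)" using arg_cong[OF q1_eq, of real] by simp
    moreover have "real (q - 1) = real q - 1" using q_gt_1 by (simp only: of_nat_diff of_nat_1)
    ultimately show ?thesis by (simp add: field_simps)
  qed
  have q0: "real q > 0" using p_ge_5 by simp
  have "real q ^ n = real q * real q ^ (n - 1)" using assms by (simp flip: power_Suc)
  then have "real q * ?N = real q * (real q ^ (n - 1) + (real q - 1) / (2 ^ m * real q) * ?S)"
    unfolding eq U distrib_left using q0 by (simp only: mult.assoc[symmetric] times_divide_eq_right) (simp add: divide_simps del: of_nat_power)
  moreover have "real q \<noteq> 0" using q0 by linarith
  ultimately show ?thesis by (rule iffD1[OF mult_left_cancel, rotated])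
qed

end

theorem theorem3:
  fixes p s m n :: nat and C D :: "nat \<Rightarrow> int"
    and F :: "('a::{field,finite}) itself"
  assumes "prime p" and "p mod 8 = 5"
    and "s \<ge> 1"
    and "CARD('a) = p ^ s"
    and "m \<ge> 2" and "2 ^ (m + 1) dvd (p ^ s - 1)"
    and "n \<ge> 1"
    and "\<And>r. 1 \<le> r \<Longrightarrow> r \<le> m \<Longrightarrow>
           real p powr (real s / 2 ^ (r - 1)) = of_int ((C r)\<^sup>2 + (D r)\<^sup>2)"
    and "\<And>r. 1 \<le> r \<Longrightarrow> r \<le> m \<Longrightarrow> [C r = -1] (mod 4)"
    and "\<And>r. 1 \<le> r \<Longrightarrow> r \<le> m \<Longrightarrow> \<not> int p dvd C r"
  shows "(let q = real (p ^ s) in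
     real (diag_count n m F) =
       q ^ (n - 1) + (q - 1) / (2 ^ m * q) *
       ( 2 ^ (m - 2) * ((q powr (1/2) + 2 * of_int (D 2) * q powr (1/4)) ^ n
                       + (q powr (1/2) - 2 * of_int (D 2) * q powr (1/4)) ^ n)
       + (\<Sum>t = 1..m - 2. 2 ^ (m - t - 2) *
            ( (- (q powr (1/2))
               + (\<Sum>r = 2..t. 2 ^ (r - 1) * of_int (C r) * q powr ((2 ^ (r - 1) - 1) / 2 ^ r))
               - 2 ^ t * of_int (C (t + 1)) * q powr ((2 ^ t - 1) / 2 ^ (t + 1))
               + 2 ^ (t + 1) * of_int (D (t + 2)) * q powr ((2 ^ (t + 1) - 1) / 2 ^ (t + 2))) ^ n
            + (- (q powr (1/2))
               + (\<Sum>r = 2..t. 2 ^ (r - 1) * of_int (C r) * q powr ((2 ^ (r - 1) - 1) / 2 ^ r))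
               - 2 ^ t * of_int (C (t + 1)) * q powr ((2 ^ t - 1) / 2 ^ (t + 1))
               - 2 ^ (t + 1) * of_int (D (t + 2)) * q powr ((2 ^ (t + 1) - 1) / 2 ^ (t + 2))) ^ n))
       + (- (q powr (1/2))
          + (\<Sum>r = 2..m - 1. 2 ^ (r - 1) * of_int (C r) * q powr ((2 ^ (r - 1) - 1) / 2 ^ r))
          - 2 ^ (m - 1) * of_int (C m) * q powr ((2 ^ (m - 1) - 1) / 2 ^ m)) ^ n
       + (- (q powr (1/2))
          + (\<Sum>r = 2..m. 2 ^ (r - 1) * of_int (C r) * q powr ((2 ^ (r - 1) - 1) / 2 ^ r))) ^ n))"
proof -
  obtain g :: 'a where g: "bij_betw (\<lambda>k. g ^ k) {..<CARD('a) - 1} (UNIV - {0})"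
    using finite_field_has_generator by blast
  obtain tr :: "'a \<Rightarrow> nat" where tr: "\<And>x. tr x < p" "\<And>x. of_nat (tr x) = (\<Sum>i<s. x ^ (p ^ i))"
    using finite_field_trace_exists[OF assms(1,4)] by blast
  interpret diagonal_field_squares p s m g tr C D
    by unfold_locales (use assms g tr in \<open>simp_all only: not_False_eq_True\<close>)
  have F: "diag_count n m F = diag_count n m TYPE('a)" by (simp add: diag_count_def)
  have R2: "R 2 = real (p ^ s) powr (1 / 4)" by (simp add: R_def)
  have Rt: "R (t + 1) = real (p ^ s) powr ((2 ^ t - 1) / 2 ^ (t + 1))"
    "R (t + 2) = real (p ^ s) powr ((2 ^ (t + 1) - 1) / 2 ^ (t + 2))" for t
    by (simp_all add: R_def)
  have Am: "A (m - 1) = - h + (\<Sum>r = 2..m - 1. 2 ^ (r - 1) * of_int (C r) * R r) - 2 ^ (m - 1) * of_int (C m) * R m"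
    using assms(5) by (simp add: A_def)
  show ?thesis
    using diag_count_formula[OF assms(7)] unfolding Let_def F Am unfolding A_def R2 Rt unfolding R_def .
qed

end
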